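(* Let $X$ be a compact metric space, $\varepsilon>0$, and $c\in C(X\times X;[0,\infty))$ symmetric such that $k_c=\exp(-c/\varepsilon)$ is a positive definite universal kernel. Let $(\mu_t)_{t\in[0,1]}$ be a weak-$*$ continuous path in $\mathcal{P}(X)$; denote $f_{t,t}=f_{\mu_t,\mu_t}$ and $\beta_t=B(\mu_t)$. Then $(\mu_t)_t$ is admissible, i.e. $(\beta_t)_t\in H^1((0,1);\mathcal{H}_c)$, or equivalently $(\mu_t)_t\in\mathrm{AC}^2((0,1);(\mathcal{P}(X),\mathsf{d}_S))$, if and only if the following conditions are satisfied: 1. $(\mu_t)_t$ is strongly differentiable, i.e. for almost all $s\in[0,1]$, $\frac{\mu_t-\mu_s}{t-s}\to\dot\mu_s$ in norm in $\mathcal{H}_{\mu_s}^*$ as $t\to s$; 2. $\int_0^1\mathbf{g}_{\mu_t}(\dot\mu_t,\dot\mu_t)\,dt<\infty$; 3. $(f_{t,t})_t\in\mathrm{AC}^1((0,1);C(X))$. Further, when these are satisfied, the following integration by parts formula holds for all functions of the form $\psi_t=\exp(f_{t,t}/\varepsilon)\cdot\phi_t$ with $\phi\in C_c^\infty((0,1);\mathcal{H}_c)$: $$\int_0^1\langle\mu_t,\partial_t\psi_t\rangle\,dt=-\int_0^1\langle\dot\mu_t,\psi_t\rangle\,dt .$$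
   Context: $\mathcal{P}(X)$: Radon probability measures. A kernel is universal if its reproducing kernel Hilbert space (RKHS) is dense in $C(X)$. For $\mu\in\mathcal{P}(X)$, $f_{\mu,\mu}\in C(X)$ is the unique function with $\int_X\exp\left(\frac1\varepsilon(f_{\mu,\mu}(x)+f_{\mu,\mu}(y)-c(x,y))\right)d\mu(x)=1$ for all $y\in X$; $a_\mu=\exp(f_{\mu,\mu}/\varepsilon)$; $k_\mu(x,y)=a_\mu(x)a_\mu(y)k_c(x,y)$. $\mathcal{H}_c,\mathcal{H}_\mu$ are the RKHS of $k_c,k_\mu$; multiplication by $a_\mu$ is an isometry $\mathcal{H}_c\to\mathcal{H}_\mu$ (so $\psi_t\in\mathcal{H}_{\mu_t}$). $B(\mu)=\int_X a_\mu(x)k_c(x,\cdot)\,d\mu(x)=\exp(-f_{\mu,\mu}/\varepsilon)\in\mathcal{H}_c$. Measures are viewed as elements of $\mathcal{H}_\mu^*$ by integration. $K_\mu[\phi](y)=\int_X\phi(x)k_\mu(x,y)\,d\mu(x)$; $H_\mu[\sigma](y)=\langle\sigma,k_\mu(\cdot,y)\rangle$ is the Riesz isometry $\mathcal{H}_\mu^*\to\mathcal{H}_\mu$. For $\dot\mu\in\mathcal{H}_\mu^*$ with $\langle\dot\mu,1_X\rangle=0$, $\mathbf{g}_\mu(\dot\mu,\dot\mu)=\frac\varepsilon2\langle\dot\mu,(\mathrm{id}-K_\mu^2)^{-1}H_\mu[\dot\mu]\rangle$, the inverse being taken on $\mathcal{H}_\mu/\mathbb{R}$ (quotient by constants), where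 $\mathrm{id}-K_\mu^2$ is boundedly invertible. For $\dot\beta\in\mathcal{H}_c$ with $\langle B(\mu),\dot\beta\rangle_{\mathcal{H}_c}=0$, $$\tilde{\mathbf{g}}_\mu(\dot\beta,\dot\beta)=\frac\varepsilon2\left(\|\dot\beta\|_{\mathcal{H}_c}^2+2\left\langle a_\mu\dot\beta,(\mathrm{id}-K_\mu)^{-1}[a_\mu\dot\beta]\right\rangle_{L^2(X,\mu)}\right)$$ with the inverse on $L^2(X,\mu)/\mathbb{R}$. $H^1((0,1);\mathcal{H}_c)$ is the Sobolev space of $L^2$ functions $(0,1)\to\mathcal{H}_c$ with distributional derivative in $L^2$. A path $(\mu_t)_{t\in[0,1]}$ is admissible if $(B(\mu_t))_t\in H^1((0,1);\mathcal{H}_c)$ (continuous representative on $[0,1]$). $\mathsf{d}_S(\mu_0,\mu_1)^2$ is the infimum of $\int_0^1\tilde{\mathbf{g}}_{\mu_t}(\dot\beta_t,\dot\beta_t)\,dt$ over admissible paths from $\mu_0$ to $\mu_1$, with $\beta_t=B(\mu_t)$; $\mathsf{d}_S$ is a metric on $\mathcal{P}(X)$. For a complete metric space $(\mathcal{X},\mathsf{d})$ and $p\in[1,\infty]$, $\gamma\in\mathrm{AC}^p((a,b);\mathcal{X})$ means that there is $m\in L^p(a,b)$ with $\mathsf{d}(\gamma(s),\gamma(t))\le\int_s^t m(\tau)\,d\tau$ for all $a<s\le t<b$. In the integration by parts formula, $\partial_t\psi_t$ is the derivative in $C(X)$, which exists for a.e. $t$. *)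

theory Defs
  imports "HOL-Analysis.Analysis" "HOL-Probability.Probability_Measure"
begin

section \<open>Positive definite kernels and reproducing kernel Hilbert spaces\<close>

definition positive_definite_kernel :: "('a \<Rightarrow> 'a \<Rightarrow> real) \<Rightarrow> bool" where
  "positive_definite_kernel k \<longleftrightarrow>
     (\<forall>x y. k x y = k y x) \<and>
     (\<forall>A w. finite A \<longrightarrow> (\<Sum>x\<in>A. \<Sum>y\<in>A. w x * w y * k x y) \<ge> 0)"

text \<open>
  A Hilbert space \<open>'h\<close> is presented as a space of functions on \<open>'a\<close> by an injective linear
  evaluation map \<open>ev\<close>: the abstract vector \<open>h\<close> stands for the function \<open>ev h\<close>, and \<open>inv ev f\<close> is
  the vector standing for the function \<open>f\<close>. The predicate says that this function space is the
  RKHS of \<open>k\<close>. Completeness of \<open>'h\<close> comes from the class \<open>banach\<close>; second countability is what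
  the Bochner integral of the library asks for, and it is automatic for a continuous kernel on a
  compact metric space.
\<close>

definition is_rkhs ::
  "('a \<Rightarrow> 'a \<Rightarrow> real) \<Rightarrow> ('h::{real_inner,banach,second_countable_topology} \<Rightarrow> 'a \<Rightarrow> real) \<Rightarrow> bool"
where
  "is_rkhs k ev \<longleftrightarrow>
     inj ev \<and> (\<forall>x. linear (\<lambda>h. ev h x)) \<and>
     (\<forall>y. (\<lambda>x. k x y) \<in> range ev \<and> (\<forall>h. ev h y = h \<bullet> inv ev (\<lambda>x. k x y)))"

definition universal_rkhs ::
  "('h \<Rightarrow> 'a::metric_space \<Rightarrow> real) \<Rightarrow> bool" where
  "universal_rkhs ev \<longleftrightarrow>
     closure {g :: 'a \<Rightarrow>\<^sub>C real. apply_bcontfun g \<in> range ev} = UNIV"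

text \<open>The pairing of a functional with a function of the Hilbert space presented by \<open>ev\<close>.\<close>

definition pairing ::
  "('h::{real_inner,banach,second_countable_topology} \<Rightarrow> 'a \<Rightarrow> real) \<Rightarrow>
   ('h \<Rightarrow>\<^sub>L real) \<Rightarrow> ('a \<Rightarrow> real) \<Rightarrow> real" where
  "pairing ev \<sigma> f = blinfun_apply \<sigma> (inv ev f)"

text \<open>A measure as an element of the dual of the Hilbert space presented by \<open>ev\<close>.\<close>

definition measure_functional ::
  "('h::{real_inner,banach,second_countable_topology} \<Rightarrow> 'a \<Rightarrow> real) \<Rightarrow>
   'a measure \<Rightarrow> ('h \<Rightarrow>\<^sub>L real)" where
  "measure_functional ev \<nu> = Blinfun (\<lambda>h. \<integral>x. ev h x \<partial>\<nu>)"

text \<open>The operators \<open>K\<close> (for the kernel \<open>k\<close> and the measure \<open>\<mu>\<close>) and \<open>H\<close> (the Riesz map).\<close>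

definition kernel_op :: "('a \<Rightarrow> 'a \<Rightarrow> real) \<Rightarrow> 'a measure \<Rightarrow> ('a \<Rightarrow> real) \<Rightarrow> 'a \<Rightarrow> real" where
  "kernel_op k \<mu> \<phi> y = (\<integral>x. \<phi> x * k x y \<partial>\<mu>)"

definition riesz_op ::
  "('a \<Rightarrow> 'a \<Rightarrow> real) \<Rightarrow> ('h::{real_inner,banach,second_countable_topology} \<Rightarrow> 'a \<Rightarrow> real) \<Rightarrow>
   ('h \<Rightarrow>\<^sub>L real) \<Rightarrow> 'a \<Rightarrow> real" where
  "riesz_op k ev \<sigma> y = pairing ev \<sigma> (\<lambda>x. k x y)"


section \<open>Function spaces over intervals\<close>

definition test_functions :: "real set \<Rightarrow> (real \<Rightarrow> 'v::real_normed_vector) set" where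
  "test_functions I = {\<phi>.
     (\<exists>D :: nat \<Rightarrow> real \<Rightarrow> 'v. D 0 = \<phi> \<and>
        (\<forall>n t. (D n has_vector_derivative D (Suc n) t) (at t))) \<and>
     (\<exists>C. compact C \<and> C \<subseteq> I \<and> (\<forall>t. t \<notin> C \<longrightarrow> \<phi> t = 0))}"

definition square_integrable_on ::
  "(real \<Rightarrow> 'h::{real_inner,banach,second_countable_topology}) \<Rightarrow> real set \<Rightarrow> bool" where
  "square_integrable_on u I \<longleftrightarrow>
     u \<in> borel_measurable (lebesgue_on I) \<and> integrable (lebesgue_on I) (\<lambda>t. (norm (u t))\<^sup>2)"

definition weak_derivative_on ::
  "(real \<Rightarrow> 'h::{real_inner,banach,second_countable_topology}) \<Rightarrow> (real \<Rightarrow> 'h) \<Rightarrow> real set \<Rightarrow> bool"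
where
  "weak_derivative_on u v I \<longleftrightarrow>
     (\<forall>\<phi> \<in> (test_functions I :: (real \<Rightarrow> real) set).
        (\<integral>t. vector_derivative \<phi> (at t) *\<^sub>R u t \<partial>lebesgue_on I) =
        - (\<integral>t. \<phi> t *\<^sub>R v t \<partial>lebesgue_on I))"

definition sobolev_H1_derivative ::
  "(real \<Rightarrow> 'h::{real_inner,banach,second_countable_topology}) \<Rightarrow> (real \<Rightarrow> 'h) \<Rightarrow> real set \<Rightarrow> bool"
where
  "sobolev_H1_derivative u v I \<longleftrightarrow>
     square_integrable_on u I \<and> square_integrable_on v I \<and> weak_derivative_on u v I"

definition sobolev_H1 ::
  "(real \<Rightarrow> 'h::{real_inner,banach,second_countable_topology}) \<Rightarrow> real set \<Rightarrow> bool" where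
  "sobolev_H1 u I \<longleftrightarrow> (\<exists>v. sobolev_H1_derivative u v I)"

text \<open>
  Absolutely continuous curves of finite exponent \<open>p \<ge> 1\<close> on a bounded interval, with respect
  to an explicitly given distance \<open>d\<close>.
\<close>

definition AC_curve ::
  "real \<Rightarrow> ('x \<Rightarrow> 'x \<Rightarrow> real) \<Rightarrow> real \<Rightarrow> real \<Rightarrow> (real \<Rightarrow> 'x) \<Rightarrow> bool" where
  "AC_curve p d a b \<gamma> \<longleftrightarrow>
     (\<exists>m :: real \<Rightarrow> real.
        m \<in> borel_measurable (lebesgue_on {a<..<b}) \<and>
        integrable (lebesgue_on {a<..<b}) (\<lambda>t. \<bar>m t\<bar> powr p) \<and>
        (\<forall>s t. a < s \<and> s \<le> t \<and> t < b \<longrightarrow> d (\<gamma> s) (\<gamma> t) \<le> (\<integral>\<tau>. m \<tau> \<partial>lebesgue_on {s..t})))"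


section \<open>Self-transport potentials and the induced kernels\<close>

text \<open>
  The space \<open>X\<close> is the whole type, assumed compact in the theorem. Then every finite Borel
  measure on it is Radon, and the type of bounded continuous functions is \<open>C(X)\<close> with the
  supremum norm.
\<close>

definition prob_measures :: "'a::metric_space measure set" where
  "prob_measures = {\<mu>. prob_space \<mu> \<and> sets \<mu> = sets borel}"

definition weak_star_continuous_path ::
  "(real \<Rightarrow> 'a::metric_space measure) \<Rightarrow> bool" where
  "weak_star_continuous_path \<mu> \<longleftrightarrow>
     (\<forall>g :: 'a \<Rightarrow>\<^sub>C real. continuous_on {0..1} (\<lambda>t. \<integral>x. apply_bcontfun g x \<partial>\<mu> t))"

definition gibbs_kernel :: "('a \<Rightarrow> 'a \<Rightarrow> real) \<Rightarrow> real \<Rightarrow> 'a \<Rightarrow> 'a \<Rightarrow> real" where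
  "gibbs_kernel c \<epsilon> x y = exp (- c x y / \<epsilon>)"

definition self_potential ::
  "('a \<Rightarrow> 'a \<Rightarrow> real) \<Rightarrow> real \<Rightarrow> 'a::metric_space measure \<Rightarrow> ('a \<Rightarrow>\<^sub>C real)" where
  "self_potential c \<epsilon> \<mu> =
     (THE f. \<forall>y. (\<integral>x. exp (1 / \<epsilon> * (apply_bcontfun f x + apply_bcontfun f y - c x y)) \<partial>\<mu>) = 1)"

definition scaling ::
  "('a \<Rightarrow> 'a \<Rightarrow> real) \<Rightarrow> real \<Rightarrow> 'a::metric_space measure \<Rightarrow> 'a \<Rightarrow> real" where
  "scaling c \<epsilon> \<mu> x = exp (apply_bcontfun (self_potential c \<epsilon> \<mu>) x / \<epsilon>)"

definition self_kernel ::
  "('a \<Rightarrow> 'a \<Rightarrow> real) \<Rightarrow> real \<Rightarrow> 'a::metric_space measure \<Rightarrow> 'a \<Rightarrow> 'a \<Rightarrow> real"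
where
  "self_kernel c \<epsilon> \<mu> x y = scaling c \<epsilon> \<mu> x * scaling c \<epsilon> \<mu> y * gibbs_kernel c \<epsilon> x y"

text \<open>
  Below, \<open>ev\<close> presents the RKHS of the Gibbs kernel on the type \<open>'h\<close>. Since multiplication by
  the scaling is an isometry from it onto the RKHS of the self-kernel of \<open>\<mu>\<close>, the latter is
  presented on the same Hilbert space \<open>'h\<close>, with the following evaluation map; see the lemma.
\<close>

definition self_ev ::
  "('a \<Rightarrow> 'a \<Rightarrow> real) \<Rightarrow> real \<Rightarrow> ('h::{real_inner,banach,second_countable_topology} \<Rightarrow> 'a \<Rightarrow> real) \<Rightarrow>
   'a::metric_space measure \<Rightarrow> 'h \<Rightarrow> 'a \<Rightarrow> real" where
  "self_ev c \<epsilon> ev \<mu> h x = scaling c \<epsilon> \<mu> x * ev h x"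

lemma is_rkhs_self_kernel:
  assumes "is_rkhs (gibbs_kernel c \<epsilon>) ev"
  shows "is_rkhs (self_kernel c \<epsilon> \<mu>) (self_ev c \<epsilon> ev \<mu>)"
proof -
  let ?a = "scaling c \<epsilon> \<mu>" and ?k = "gibbs_kernel c \<epsilon>" and ?E = "self_ev c \<epsilon> ev \<mu>"
  have a: "?a x \<noteq> 0" for x by (simp add: scaling_def)
  have injE: "inj ?E"
  proof (rule injI)
    fix h h' assume "?E h = ?E h'"
    then have "?a x * ev h x = ?a x * ev h' x" for x
      unfolding self_ev_def by meson
    then have "ev h = ev h'" using a by (intro ext) simp
    then show "h = h'" using assms unfolding is_rkhs_def by (meson injD)
  qed
  have lin: "linear (\<lambda>h. ev h x)" for x using assms unfolding is_rkhs_def by blast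
  have linE: "linear (\<lambda>h. ?E h x)" for x
    unfolding self_ev_def using linear_compose_scale_right[OF lin[of x], of "?a x"] by simp
  have main: "(\<lambda>x. self_kernel c \<epsilon> \<mu> x y) \<in> range ?E \<and>
      (\<forall>h. ?E h y = h \<bullet> inv ?E (\<lambda>x. self_kernel c \<epsilon> \<mu> x y))" for y
  proof -
    define r where "r = inv ev (\<lambda>x. ?k x y)"
    have r: "ev r = (\<lambda>x. ?k x y)"
      using assms unfolding is_rkhs_def r_def by (meson f_inv_into_f)
    have rep: "ev h y = h \<bullet> r" for h
      using assms unfolding is_rkhs_def r_def by blast
    have eq: "?E (?a y *\<^sub>R r) = (\<lambda>x. self_kernel c \<epsilon> \<mu> x y)"
    proof
      fix x
      have "ev (?a y *\<^sub>R r) x = ?a y * ev r x"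
        using linear_scale[OF lin[of x]] by simp
      then show "?E (?a y *\<^sub>R r) x = self_kernel c \<epsilon> \<mu> x y"
        by (simp add: self_ev_def self_kernel_def r)
    qed
    have "inv ?E (\<lambda>x. self_kernel c \<epsilon> \<mu> x y) = ?a y *\<^sub>R r"
      using inv_f_f[OF injE, of "?a y *\<^sub>R r"] by (simp only: eq)
    moreover have "(\<lambda>x. self_kernel c \<epsilon> \<mu> x y) \<in> range ?E"
      using eq by (metis rangeI)
    ultimately show ?thesis by (simp add: self_ev_def rep)
  qed
  show ?thesis unfolding is_rkhs_def using injE linE main by blast
qed

definition B_embedding ::
  "('a \<Rightarrow> 'a \<Rightarrow> real) \<Rightarrow> real \<Rightarrow> ('h::{real_inner,banach,second_countable_topology} \<Rightarrow> 'a \<Rightarrow> real) \<Rightarrow>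
   'a::metric_space measure \<Rightarrow> 'h" where
  "B_embedding c \<epsilon> ev \<mu> =
     (\<integral>x. scaling c \<epsilon> \<mu> x *\<^sub>R inv ev (\<lambda>y. gibbs_kernel c \<epsilon> x y) \<partial>\<mu>)"


section \<open>The metric tensor and the Sinkhorn distance\<close>

text \<open>
  The inverses on the quotients by constants are expressed by choosing a representative of the
  solution class. For tangent vectors (\<open>\<langle>\<sigma>, 1\<rangle> = 0\<close>, respectively \<open>\<langle>B(\<mu>), v\<rangle> = 0\<close>, which says that
  \<open>a\<^sub>\<mu> v\<close> has mean zero) the value does not depend on the representative.
\<close>

definition metric_g ::
  "('a \<Rightarrow> 'a \<Rightarrow> real) \<Rightarrow> real \<Rightarrow> ('h::{real_inner,banach,second_countable_topology} \<Rightarrow> 'a \<Rightarrow> real) \<Rightarrow>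
   'a::metric_space measure \<Rightarrow> ('h \<Rightarrow>\<^sub>L real) \<Rightarrow> real" where
  "metric_g c \<epsilon> ev \<mu> \<sigma> =
     (let k = self_kernel c \<epsilon> \<mu>; E = self_ev c \<epsilon> ev \<mu> in
      \<epsilon> / 2 * pairing E \<sigma>
        (SOME \<phi>. \<phi> \<in> range E \<and>
           (\<exists>C. \<forall>y. \<phi> y - kernel_op k \<mu> (kernel_op k \<mu> \<phi>) y = riesz_op k E \<sigma> y + C)))"

definition metric_g_tilde ::
  "('a \<Rightarrow> 'a \<Rightarrow> real) \<Rightarrow> real \<Rightarrow> ('h::{real_inner,banach,second_countable_topology} \<Rightarrow> 'a \<Rightarrow> real) \<Rightarrow>
   'a::metric_space measure \<Rightarrow> 'h \<Rightarrow> real" where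
  "metric_g_tilde c \<epsilon> ev \<mu> v =
     (let k = self_kernel c \<epsilon> \<mu>; w = (\<lambda>x. scaling c \<epsilon> \<mu> x * ev v x) in
      \<epsilon> / 2 * ((norm v)\<^sup>2 + 2 * (\<integral>x. w x *
        (SOME \<phi>. \<phi> \<in> borel_measurable \<mu> \<and> integrable \<mu> (\<lambda>x. (\<phi> x)\<^sup>2) \<and>
           (\<exists>C. AE x in \<mu>. \<phi> x - kernel_op k \<mu> \<phi> x = w x + C)) x \<partial>\<mu>)))"

text \<open>
  The continuous representative of \<open>B(\<mu>\<^sub>t)\<close> is required to be \<open>B(\<mu>\<^sub>t)\<close> itself at every
  \<open>t \<in> [0,1]\<close>, so that the endpoints of an admissible path are meaningful.
\<close>

definition admissible_path ::
  "('a \<Rightarrow> 'a \<Rightarrow> real) \<Rightarrow> real \<Rightarrow> ('h::{real_inner,banach,second_countable_topology} \<Rightarrow> 'a \<Rightarrow> real) \<Rightarrow>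
   (real \<Rightarrow> 'a::metric_space measure) \<Rightarrow> bool" where
  "admissible_path c \<epsilon> ev \<mu> \<longleftrightarrow>
     (\<forall>t\<in>{0..1}. \<mu> t \<in> prob_measures) \<and>
     sobolev_H1 (\<lambda>t. B_embedding c \<epsilon> ev (\<mu> t)) {0<..<1} \<and>
     continuous_on {0..1} (\<lambda>t. B_embedding c \<epsilon> ev (\<mu> t))"

text \<open>
  The infimum is taken in \<open>[0,\<infinity>]\<close>. It is finite, as any two measures are joined by an admissible
  path, so nothing is lost in passing to a real number. The distributional derivative \<open>v\<close> is
  unique up to null sets, which do not affect the energy.
\<close>

definition sinkhorn_dist ::
  "('a \<Rightarrow> 'a \<Rightarrow> real) \<Rightarrow> real \<Rightarrow> ('h::{real_inner,banach,second_countable_topology} \<Rightarrow> 'a \<Rightarrow> real) \<Rightarrow>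
   'a::metric_space measure \<Rightarrow> 'a measure \<Rightarrow> real" where
  "sinkhorn_dist c \<epsilon> ev \<mu>0 \<mu>1 = sqrt (enn2real (Inf
     {(\<integral>\<^sup>+t. ennreal (metric_g_tilde c \<epsilon> ev (\<mu> t) (v t)) \<partial>lebesgue_on {0<..<1}) | \<mu> v.
        admissible_path c \<epsilon> ev \<mu> \<and> \<mu> 0 = \<mu>0 \<and> \<mu> 1 = \<mu>1 \<and>
        sobolev_H1_derivative (\<lambda>t. B_embedding c \<epsilon> ev (\<mu> t)) v {0<..<1}}))"


section \<open>Strong differentiability\<close>

definition has_strong_derivative ::
  "('a \<Rightarrow> 'a \<Rightarrow> real) \<Rightarrow> real \<Rightarrow> ('h::{real_inner,banach,second_countable_topology} \<Rightarrow> 'a \<Rightarrow> real) \<Rightarrow>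
   (real \<Rightarrow> 'a::metric_space measure) \<Rightarrow> real \<Rightarrow> ('h \<Rightarrow>\<^sub>L real) \<Rightarrow> bool" where
  "has_strong_derivative c \<epsilon> ev \<mu> s \<sigma> \<longleftrightarrow>
     (let M = measure_functional (self_ev c \<epsilon> ev (\<mu> s)) in
      ((\<lambda>t. (M (\<mu> t) - M (\<mu> s)) /\<^sub>R (t - s)) \<longlongrightarrow> \<sigma>) (at s within {0..1}))"

definition strong_derivative ::
  "('a \<Rightarrow> 'a \<Rightarrow> real) \<Rightarrow> real \<Rightarrow> ('h::{real_inner,banach,second_countable_topology} \<Rightarrow> 'a \<Rightarrow> real) \<Rightarrow>
   (real \<Rightarrow> 'a::metric_space measure) \<Rightarrow> real \<Rightarrow> ('h \<Rightarrow>\<^sub>L real)" where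
  "strong_derivative c \<epsilon> ev \<mu> s = (THE \<sigma>. has_strong_derivative c \<epsilon> ev \<mu> s \<sigma>)"

definition strongly_differentiable_path ::
  "('a \<Rightarrow> 'a \<Rightarrow> real) \<Rightarrow> real \<Rightarrow> ('h::{real_inner,banach,second_countable_topology} \<Rightarrow> 'a \<Rightarrow> real) \<Rightarrow>
   (real \<Rightarrow> 'a::metric_space measure) \<Rightarrow> bool" where
  "strongly_differentiable_path c \<epsilon> ev \<mu> \<longleftrightarrow>
     (AE s in lebesgue_on {0..1}. \<exists>\<sigma>. has_strong_derivative c \<epsilon> ev \<mu> s \<sigma>)"

text \<open>The functions \<open>\<psi>\<^sub>t = exp(f\<^sub>t\<^sub>,\<^sub>t/\<epsilon>) \<phi>\<^sub>t\<close>, as a path in \<open>C(X)\<close>.\<close>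

definition scaled_test_path ::
  "('a \<Rightarrow> 'a \<Rightarrow> real) \<Rightarrow> real \<Rightarrow> ('h::{real_inner,banach,second_countable_topology} \<Rightarrow> 'a \<Rightarrow> real) \<Rightarrow>
   (real \<Rightarrow> 'a::metric_space measure) \<Rightarrow> (real \<Rightarrow> 'h) \<Rightarrow> real \<Rightarrow> ('a \<Rightarrow>\<^sub>C real)" where
  "scaled_test_path c \<epsilon> ev \<mu> \<phi> t =
     Bcontfun (\<lambda>x. exp (apply_bcontfun (self_potential c \<epsilon> (\<mu> t)) x / \<epsilon>) * ev (\<phi> t) x)"

end

theory Submission
  imports Defs "HOL-Probability.Probability_Mass_Function"
begin

text \<open>
  Write \<open>B\<close> for \<open>B_embedding\<close> and \<open>a\<^sub>\<mu> = 1 / B(\<mu>)\<close> for the scaling. The vector \<open>B(\<mu>)\<close> is the fixed point of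
  \<open>b \<mapsto> \<integral> 1/b(x) k(x,\<cdot>) d\<mu>(x)\<close> in the RKHS of the Gibbs kernel \<open>k\<close> and has norm 1. Subtracting the
  fixed point equations of two measures gives
  \<open>(id + L) (B(\<mu>) - B(\<nu>)) = \<integral> a\<^sub>\<nu>(x) k(x,\<cdot>) d(\<mu> - \<nu>)(x)\<close> with a positive operator \<open>L\<close> depending
  on \<open>\<mu>\<close> and \<open>\<nu>\<close>, and the right-hand side represents the functional \<open>\<mu> - \<nu>\<close> on the RKHS of the
  self-kernel of \<open>\<nu>\<close>. Along a weakly continuous path \<open>L\<close> converges strongly, so the path is strongly
  differentiable at \<open>s\<close> exactly when \<open>B\<close> is differentiable along it, and both metric tensors are
  comparable with the square of the norm of the derivative, because the self-kernel has a spectral gap.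
  Since \<open>f = - \<epsilon> ln B\<close>, the increments of the potentials and of \<open>B\<close> are comparable in supremum norm, which
  the RKHS norm dominates; conversely absolute continuity in supremum norm suffices to recover \<open>B\<close> from
  its derivative, by evaluation at the points of the space. For the Sinkhorn distance, \<open>B\<close> is
  Lipschitz with respect to it, and the arc between two times bounds it from above by a multiple of the
  length of \<open>B\<close> along the arc; a Hilbert-valued curve with increments bounded by integrals of a square
  integrable function is \<open>H\<^sup>1\<close>.
\<close>

text \<open>The lower bound \<delta> of the Gibbs kernel makes the estimates uniform in the measure:
  it bounds the scaling by 1/\<delta> and it is the spectral gap. Since \<open>B(\<mu>)\<close> has
  norm 1, every derivative \<open>v\<close> of \<open>B\<close> is orthogonal to it, which is the
  tangency that both tensors ask for. The strong derivative is represented by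
  \<open>v + A v\<close>, where \<open>A\<close> is \<open>K\<close> transported to the fixed
  Hilbert space; as id - A^2 = (id - A)(id + A), the inverse in the first tensor reduces to that of
  id - A, as in the second.

  Condition 3 excludes a singular part: a Cantor-like curve has derivative zero almost everywhere
  and still moves. It controls evaluations only, so an increment of \<open>B\<close> is tested
  against itself: it is a difference of two embedded measures of mass at most 1/\<delta>, and
  pairing with it costs no more than the supremum norm.

  The distance is extracted from [0,\<infinity>] with infinity sent to 0, so its lower bound by
  \<open>B\<close> first requires a path of finite energy; mixtures of the two measures supply
  one.\<close>

section \<open>Absolutely continuous curves in a Hilbert space\<close>

text \<open>Off the null set the Riemann sums of \<open>g\<close> follow from differentiability; on it, where \<open>g\<close> is replaced
  by 0, the increments of \<open>q\<close> are bounded by integrals of \<open>m\<close>, which are small by Henstock's lemma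
  applied to \<open>m\<close>, also replaced by 0 there.\<close>
lemma ac_has_integral_derivative:
  fixes q g m :: "real \<Rightarrow> real"
  assumes ab: "a \<le> b" and m: "m integrable_on {a..b}"
    and bd: "\<And>s t. a \<le> s \<Longrightarrow> s \<le> t \<Longrightarrow> t \<le> b \<Longrightarrow> \<bar>q t - q s\<bar> \<le> integral {s..t} m"
    and N: "negligible N"
    and der: "\<And>t. t \<in> {a..b} \<Longrightarrow> t \<notin> N \<Longrightarrow> (q has_vector_derivative g t) (at t within {a..b})"
  shows "(g has_integral (q b - q a)) {a..b}"
proof -
  define m0 where "m0 t = (if t \<in> N then 0 else m t)" for t
  define g0 where "g0 t = (if t \<in> N then 0 else g t)" for t
  have m0: "m0 integrable_on cbox a b"
    using integrable_spike[OF m N, of m0] by (simp add: m0_def)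
  have int_m0: "integral S m0 = integral S m" for S
    by (rule integral_spike[OF N]) (simp add: m0_def)
  have "(g0 has_integral (q b - q a)) (cbox a b)"
    unfolding has_integral
  proof (intro allI impI)
    fix e :: real assume "e > 0"
    \<comment> \<open>The summand 1 keeps the denominator positive for a = b; summed over a
      division, the linear errors then stay below e/2.\<close>
    define \<eta> where "\<eta> = e / (2 * (b - a + 1))"
    have \<eta>: "\<eta> > 0" using \<open>e > 0\<close> ab by (simp add: \<eta>_def)
    have \<eta>b: "\<eta> * (b - a) < e / 2"
    proof -
      have "\<eta> * (b - a) < \<eta> * (b - a + 1)" using \<eta> by simp
      also have "\<dots> = e / 2" using ab by (simp add: \<eta>_def field_simps)
      finally show ?thesis .
    qed
    obtain \<gamma>1 where \<gamma>1: "gauge \<gamma>1" "\<And>p. p tagged_partial_division_of (cbox a b) \<Longrightarrow> \<gamma>1 fine p \<Longrightarrow>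
          (\<Sum>(x,k)\<in>p. norm (measure lborel k *\<^sub>R m0 x - integral k m0)) < e / 2"
      using Henstock_lemma[OF m0, of "e/2"] \<open>e > 0\<close> by auto
    have "\<exists>d>0. \<forall>y\<in>{a..b}. \<bar>y - t\<bar> < d \<longrightarrow> \<bar>q y - q t - (y - t) * g t\<bar> \<le> \<eta> * \<bar>y - t\<bar>"
      if "t \<in> {a..b}" "t \<notin> N" for t
      using der[OF that] \<eta> unfolding has_vector_derivative_def has_derivative_within_alt
      by (auto simp: real_norm_def)
    then obtain \<delta> where \<delta>: "\<And>t. t \<in> {a..b} \<Longrightarrow> t \<notin> N \<Longrightarrow> \<delta> t > 0 \<and>
        (\<forall>y\<in>{a..b}. \<bar>y - t\<bar> < \<delta> t \<longrightarrow> \<bar>q y - q t - (y - t) * g t\<bar> \<le> \<eta> * \<bar>y - t\<bar>)"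
      by metis
    \<comment> \<open>Tags in \<open>N\<close> are left to \<open>\<gamma>1\<close>: there the
      increment of \<open>q\<close> is compared with an integral of \<open>m0\<close>, not with a
      derivative.\<close>
    define \<gamma>2 where "\<gamma>2 t = (if t \<in> {a..b} \<and> t \<notin> N then ball t (\<delta> t) else UNIV)" for t
    have "gauge \<gamma>2" using \<delta> by (auto simp: gauge_def \<gamma>2_def)
    then have gg: "gauge (\<lambda>x. \<gamma>1 x \<inter> \<gamma>2 x)" using \<gamma>1(1) by (rule gauge_Int[rotated])
    have main: "norm ((\<Sum>(x,k)\<in>p. measure lborel k *\<^sub>R g0 x) - (q b - q a)) < e"
      if p: "p tagged_division_of cbox a b" and fine: "(\<lambda>x. \<gamma>1 x \<inter> \<gamma>2 x) fine p" for p
    proof -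
      have fin: "finite p" using p by blast
      have f1: "\<gamma>1 fine p" and f2: "\<gamma>2 fine p" using fine by (auto simp: fine_Int)
      have pd: "p tagged_partial_division_of cbox a b"
        using p by (simp add: tagged_division_of_def)
      have tele: "(\<Sum>(x,k)\<in>p. q (Sup k) - q (Inf k)) = q b - q a"
        using additive_tagged_division_1[OF ab] p by (simp add: cbox_interval)
      have each: "\<bar>measure lborel k * g0 x - (q (Sup k) - q (Inf k))\<bar>
           \<le> \<eta> * measure lborel k + norm (measure lborel k *\<^sub>R m0 x - integral k m0)"
        if xk: "(x,k) \<in> p" for x k
      proof -
        obtain u w where k: "k = cbox u w" using p xk by blast
        have xin: "x \<in> k" using p xk by blast
        have sub: "k \<subseteq> cbox a b" using p xk by blast
        have uw: "u \<le> x" "x \<le> w" using xin k by auto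
        then have SI: "Sup k = w" "Inf k = u" "measure lborel k = w - u" using k by auto
        have au: "a \<le> u" "w \<le> b" using sub k uw by auto
        show ?thesis
        proof (cases "x \<in> N")
          case True
          have "\<bar>q w - q u\<bar> \<le> integral k m0"
            using bd[of u w] au uw k by (simp add: int_m0 cbox_interval)
          moreover have "0 \<le> \<eta> * measure lborel k" using \<eta> by simp
          ultimately show ?thesis using True SI by (simp add: g0_def m0_def)
        next
          case False
          have xab: "x \<in> {a..b}" using au uw by auto
          have kb: "k \<subseteq> ball x (\<delta> x)" using fineD[OF f2 xk] xab False by (simp add: \<gamma>2_def)
          have "u \<in> k" "w \<in> k" using k uw by auto
          with kb have "\<bar>u - x\<bar> < \<delta> x" "\<bar>w - x\<bar> < \<delta> x" by (auto simp: dist_real_def abs_minus_commute)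
          then have "\<bar>q u - q x - (u - x) * g x\<bar> \<le> \<eta> * \<bar>u - x\<bar>" "\<bar>q w - q x - (w - x) * g x\<bar> \<le> \<eta> * \<bar>w - x\<bar>"
            using \<delta>[OF xab False] au uw by (meson atLeastAtMost_iff order_trans)+
          then have 1: "\<bar>q u - q x - (u - x) * g x\<bar> \<le> \<eta> * (x - u)" "\<bar>q w - q x - (w - x) * g x\<bar> \<le> \<eta> * (w - x)"
            using uw by auto
          \<comment> \<open>The increment is split at the tag, so that the derivative estimates on
            its two sides add up to \<eta> times the length.\<close>
          have "(w - u) * g x - (q w - q u) = (q u - q x - (u - x) * g x) - (q w - q x - (w - x) * g x)"
            by (simp add: algebra_simps)
          also have "\<bar>\<dots>\<bar> \<le> \<eta> * (x - u) + \<eta> * (w - x)" using 1 by linarith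
          also have "\<dots> = \<eta> * (w - u)" by (simp add: algebra_simps)
          finally show ?thesis using False SI by (simp add: g0_def add_increasing2)
        qed
      qed
      have "(\<Sum>(x,k)\<in>p. measure lborel k *\<^sub>R g0 x) - (q b - q a)
         = (\<Sum>(x,k)\<in>p. measure lborel k * g0 x - (q (Sup k) - q (Inf k)))"
        unfolding tele[symmetric] by (simp add: sum_subtractf case_prod_beta)
      also have "norm \<dots> \<le> (\<Sum>(x,k)\<in>p. \<eta> * measure lborel k + norm (measure lborel k *\<^sub>R m0 x - integral k m0))"
        using each by (intro sum_norm_le) auto
      also have "\<dots> = \<eta> * (\<Sum>(x,k)\<in>p. measure lborel k) + (\<Sum>(x,k)\<in>p. norm (measure lborel k *\<^sub>R m0 x - integral k m0))"
        by (simp add: sum.distrib sum_distrib_left case_prod_beta)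
      also have "(\<Sum>(x,k)\<in>p. measure lborel k) = b - a"
        using additive_content_tagged_division[OF p] ab by simp
      also have "\<eta> * (b - a) + (\<Sum>(x,k)\<in>p. norm (measure lborel k *\<^sub>R m0 x - integral k m0)) < e"
        using \<gamma>1(2)[OF pd f1] \<eta>b by linarith
      finally show ?thesis .
    qed
    show "\<exists>\<gamma>. gauge \<gamma> \<and> (\<forall>\<D>. \<D> tagged_division_of cbox a b \<and> \<gamma> fine \<D> \<longrightarrow>
          norm ((\<Sum>(x,k)\<in>\<D>. measure lborel k *\<^sub>R g0 x) - (q b - q a)) < e)"
    proof (intro exI[of _ "\<lambda>x. \<gamma>1 x \<inter> \<gamma>2 x"] conjI allI impI gg)
      fix p assume "p tagged_division_of cbox a b \<and> (\<lambda>x. \<gamma>1 x \<inter> \<gamma>2 x) fine p"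
      then show "norm ((\<Sum>(x,k)\<in>p. measure lborel k *\<^sub>R g0 x) - (q b - q a)) < e"
        using main by (elim conjE)
    qed
  qed
  then show ?thesis
    using has_integral_spike_eq[OF N, of "{a..b}" g g0 "q b - q a"] by (simp add: g0_def cbox_interval)
qed

text \<open>The working form of absolute continuity. It constrains \<open>u\<close> at every point
  of the closed interval, so end point values involve no choice of a representative, while
  \<open>v\<close> matters only up to null sets.\<close>

definition primitive_on01 :: "(real \<Rightarrow> 'h::{banach,second_countable_topology}) \<Rightarrow> (real \<Rightarrow> 'h) \<Rightarrow> bool" where
  "primitive_on01 u v \<longleftrightarrow> integrable (lebesgue_on {0..1}) v \<and>
     (\<forall>s t. 0 \<le> s \<longrightarrow> s \<le> t \<longrightarrow> t \<le> 1 \<longrightarrow> u t - u s = (\<integral>\<tau>. v \<tau> \<partial>lebesgue_on {s..t}))"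

lemma integrable_lebesgue_on_subset:
  fixes f :: "real \<Rightarrow> 'h::{banach,second_countable_topology}"
  assumes "integrable (lebesgue_on S) f" "T \<subseteq> S" "S \<in> sets lebesgue" "T \<in> sets lebesgue"
  shows "integrable (lebesgue_on T) f"
proof -
  have "integrable lebesgue (\<lambda>x. indicator S x *\<^sub>R f x)"
    using assms by (simp add: integrable_restrict_space)
  then have "integrable lebesgue (\<lambda>x. indicator T x *\<^sub>R (indicator S x *\<^sub>R f x))"
    using assms(4) by (rule integrable_mult_indicator[rotated])
  also have "(\<lambda>x. indicator T x *\<^sub>R (indicator S x *\<^sub>R f x)) = (\<lambda>x. indicator T x *\<^sub>R f x)"
    using assms(2) by (auto simp: indicator_def fun_eq_iff)
  finally show ?thesis using assms by (simp add: integrable_restrict_space)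
qed

lemma integral_lebesgue_on_indicator:
  fixes f :: "real \<Rightarrow> 'h::{banach,second_countable_topology}"
  assumes "T \<subseteq> S" "S \<in> sets lebesgue" "T \<in> sets lebesgue"
  shows "(\<integral>x. f x \<partial>lebesgue_on T) = (\<integral>x. indicator T x *\<^sub>R f x \<partial>lebesgue_on S)"
proof -
  have "(\<lambda>x. indicator S x *\<^sub>R (indicator T x *\<^sub>R f x)) = (\<lambda>x. indicator T x *\<^sub>R f x)"
    using assms(1) by (auto simp: indicator_def fun_eq_iff)
  then show ?thesis using assms by (simp add: integral_restrict_space)
qed

lemma integral_const_lebesgue_on_Icc:
  fixes p :: "'h::{banach,second_countable_topology}"
  assumes "s \<le> t"
  shows "(\<integral>\<tau>. p \<partial>lebesgue_on {s..t::real}) = (t - s) *\<^sub>R p"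
proof -
  have "measure (lebesgue_on {s..t}) {s..t} = measure lebesgue {s..t}"
    by (intro measure_restrict_space) auto
  then show ?thesis using assms by simp
qed

lemma AE_lebesgue_on_iff_negligible:
  assumes "S \<in> sets lebesgue"
  shows "(AE x in lebesgue_on S. P x) \<longleftrightarrow> (\<exists>N. negligible N \<and> (\<forall>x. x \<in> S \<longrightarrow> x \<notin> N \<longrightarrow> P x))"
proof -
  have "(AE x in lebesgue_on S. P x) \<longleftrightarrow> (AE x in lebesgue. x \<in> S \<longrightarrow> P x)"
    using assms by (simp add: AE_restrict_space_iff)
  also have "\<dots> \<longleftrightarrow> (\<exists>N. negligible N \<and> {x. \<not> (x \<in> S \<longrightarrow> P x)} \<subseteq> N)"
    by (simp add: eventually_ae_filter_negligible)
  finally show ?thesis by blast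
qed

text \<open>Pairing with a fixed vector reduces the claim to the scalar case. The null set where the
  derivative fails is the same for all vectors, and the bound on increments is multiplied by the
  norm of the vector.\<close>

lemma primitive_on01I_AC:
  fixes u v :: "real \<Rightarrow> 'h::{real_inner,banach,second_countable_topology}" and m :: "real \<Rightarrow> real"
  assumes v: "integrable (lebesgue_on {0..1}) v" and m: "integrable (lebesgue_on {0..1}) m"
    and bd: "\<And>s t. 0 \<le> s \<Longrightarrow> s \<le> t \<Longrightarrow> t \<le> 1 \<Longrightarrow> norm (u t - u s) \<le> (\<integral>\<tau>. m \<tau> \<partial>lebesgue_on {s..t})"
    and der: "AE t in lebesgue_on {0..1}. (u has_vector_derivative v t) (at t)"
  shows "primitive_on01 u v"
  unfolding primitive_on01_def
proof (intro conjI allI impI v)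
  fix s t :: real assume st: "0 \<le> s" "s \<le> t" "t \<le> 1"
  obtain N where N: "negligible N" "\<And>t. t \<in> {0..1} \<Longrightarrow> t \<notin> N \<Longrightarrow> (u has_vector_derivative v t) (at t)"
    using der by (auto simp: AE_lebesgue_on_iff_negligible)
  have sub: "integrable (lebesgue_on {x..y}) v" "integrable (lebesgue_on {x..y}) m" if "0 \<le> x" "y \<le> 1" for x y
    using that by (auto intro!: integrable_lebesgue_on_subset[OF v] integrable_lebesgue_on_subset[OF m])
  have "(u t - u s) \<bullet> h = (\<integral>\<tau>. v \<tau> \<partial>lebesgue_on {s..t}) \<bullet> h" for h
  proof -
    have mi: "(\<integral>\<tau>. m \<tau> \<partial>lebesgue_on {x..y}) = integral {x..y} m" if "0 \<le> x" "y \<le> 1" for x y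
      using sub[OF that] by (intro lebesgue_integral_eq_integral) auto
    have "((\<lambda>\<tau>. v \<tau> \<bullet> h) has_integral (u t \<bullet> h - u s \<bullet> h)) {s..t}"
    proof (rule ac_has_integral_derivative[OF st(2) _ _ N(1), where m = "\<lambda>\<tau>. norm h *\<^sub>R m \<tau>"])
      show "(\<lambda>\<tau>. norm h *\<^sub>R m \<tau>) integrable_on {s..t}"
        using integrable_on_lebesgue_on[OF sub(2)[OF st(1,3)]] by (intro integrable_cmul) simp
      show "\<bar>u y \<bullet> h - u x \<bullet> h\<bar> \<le> integral {x..y} (\<lambda>\<tau>. norm h *\<^sub>R m \<tau>)"
        if "s \<le> x" "x \<le> y" "y \<le> t" for x y
      proof -
        have "\<bar>u y \<bullet> h - u x \<bullet> h\<bar> \<le> norm (u y - u x) * norm h"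
          by (metis Cauchy_Schwarz_ineq2 inner_diff_left)
        also have "\<dots> \<le> norm h * integral {x..y} m"
          using bd[of x y] mi[of x y] that st by (subst mult.commute) (intro mult_left_mono, auto)
        finally show ?thesis by simp
      qed
      show "((\<lambda>\<tau>. u \<tau> \<bullet> h) has_vector_derivative v x \<bullet> h) (at x within {s..t})"
        if "x \<in> {s..t}" "x \<notin> N" for x
        using bounded_linear.has_vector_derivative[OF bounded_linear_inner_left N(2)[of x]] that st
        by (auto intro: has_vector_derivative_at_within)
    qed
    moreover have "((\<lambda>\<tau>. v \<tau> \<bullet> h) has_integral (\<integral>\<tau>. v \<tau> \<bullet> h \<partial>lebesgue_on {s..t})) {s..t}"
      using sub(1)[OF st(1,3)] by (intro has_integral_integral_lebesgue_on) auto
    moreover have "(\<integral>\<tau>. v \<tau> \<bullet> h \<partial>lebesgue_on {s..t}) = (\<integral>\<tau>. v \<tau> \<partial>lebesgue_on {s..t}) \<bullet> h"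
      using sub(1)[OF st(1,3)] by (intro integral_inner_left) auto
    ultimately show ?thesis by (metis has_integral_unique inner_diff_left)
  qed
  then have "(u t - u s - (\<integral>\<tau>. v \<tau> \<partial>lebesgue_on {s..t})) \<bullet> h = 0" for h
    by (simp add: inner_diff_left)
  then show "u t - u s = (\<integral>\<tau>. v \<tau> \<partial>lebesgue_on {s..t})"
    by (metis inner_eq_zero_iff eq_iff_diff_eq_0)
qed

section \<open>Almost everywhere differentiability of primitives\<close>

lemma lebesgue_differentiation_right:
  fixes f :: "real \<Rightarrow> real"
  assumes "\<And>a b. f integrable_on {a..b}"
  obtains N where "negligible N"
    "\<And>x e. x \<notin> N \<Longrightarrow> 0 < e \<Longrightarrow> \<exists>d>0. \<forall>h. 0 < h \<and> h < d \<longrightarrow> \<bar>integral {x..x+h} f - h * f x\<bar> \<le> e * h"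
proof -
  have "f integrable_on cbox a b" for a b using assms by (simp add: cbox_interval)
  then obtain N where N: "negligible N"
    "\<And>x e. x \<notin> N \<Longrightarrow> 0 < e \<Longrightarrow> \<exists>d>0. \<forall>h. 0 < h \<and> h < d \<longrightarrow>
                         norm(integral (cbox x (x + h *\<^sub>R One)) f /\<^sub>R h ^ DIM(real) - f x) < e"
    by (rule integrable_ccontinuous_explicit) blast
  show ?thesis
  proof (rule that[OF N(1)])
    fix x e :: real assume "x \<notin> N" "0 < e"
    then obtain d where d: "d > 0" "\<And>h. 0 < h \<Longrightarrow> h < d \<Longrightarrow> \<bar>integral {x..x+h} f / h - f x\<bar> < e"
      using N(2)[of x e] by (auto simp: cbox_interval divide_inverse mult.commute)
    have "\<bar>integral {x..x+h} f - h * f x\<bar> \<le> e * h" if h: "0 < h" "h < d" for h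
    proof -
      have "\<bar>integral {x..x+h} f - h * f x\<bar> = \<bar>integral {x..x+h} f / h - f x\<bar> * h"
        using h by (simp add: field_simps flip: abs_mult_pos)
      also have "\<dots> \<le> e * h" using d(2)[OF h] h by (intro mult_right_mono) auto
      finally show ?thesis .
    qed
    then show "\<exists>d>0. \<forall>h. 0 < h \<and> h < d \<longrightarrow> \<bar>integral {x..x+h} f - h * f x\<bar> \<le> e * h"
      using d(1) by blast
  qed
qed

text \<open>The left half is the right half for \<open>f (- x)\<close>, whose exceptional set is
  reflected back. Two-sided control is what a derivative at an interior point requires.\<close>

lemma lebesgue_differentiation:
  fixes f :: "real \<Rightarrow> real"
  assumes f: "\<And>a b. f integrable_on {a..b}"
  shows "\<exists>N. negligible N \<and> (\<forall>x e. x \<notin> N \<longrightarrow> 0 < e \<longrightarrow> (\<exists>d>0. \<forall>h. 0 < h \<and> h < d \<longrightarrow>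
        \<bar>integral {x..x+h} f - h * f x\<bar> \<le> e * h \<and> \<bar>integral {x-h..x} f - h * f x\<bar> \<le> e * h))"
proof -
  obtain N1 where N1: "negligible N1"
    "\<And>x e. x \<notin> N1 \<Longrightarrow> 0 < e \<Longrightarrow> \<exists>d>0. \<forall>h. 0 < h \<and> h < d \<longrightarrow> \<bar>integral {x..x+h} f - h * f x\<bar> \<le> e * h"
    using lebesgue_differentiation_right[OF f] by metis
  have f': "(\<lambda>x. f (- x)) integrable_on {a..b}" for a b
    using f[of "-b" "-a"] Henstock_Kurzweil_Integration.integrable_reflect_real[where f = f and a = "-b" and b = "-a"] by simp
  obtain N2 where N2: "negligible N2"
    "\<And>x e. x \<notin> N2 \<Longrightarrow> 0 < e \<Longrightarrow> \<exists>d>0. \<forall>h. 0 < h \<and> h < d \<longrightarrow> \<bar>integral {x..x+h} (\<lambda>x. f (-x)) - h * f (-x)\<bar> \<le> e * h"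
    using lebesgue_differentiation_right[OF f'] by metis
  have neg: "negligible (uminus ` N2)"
    using N2(1) by (intro negligible_differentiable_image_negligible) (auto intro!: derivative_intros)
  show ?thesis
  proof (rule exI[of _ "N1 \<union> uminus ` N2"], intro conjI allI impI)
    show "negligible (N1 \<union> uminus ` N2)" using N1(1) neg by (rule negligible_Un)
    fix x e :: real assume x: "x \<notin> N1 \<union> uminus ` N2" and e: "0 < e"
    have "- x \<notin> N2" using x by (metis UnI2 image_eqI minus_minus)
    then obtain d1 d2 where d: "d1 > 0" "d2 > 0"
        "\<And>h. 0 < h \<Longrightarrow> h < d1 \<Longrightarrow> \<bar>integral {x..x+h} f - h * f x\<bar> \<le> e * h"
        "\<And>h. 0 < h \<Longrightarrow> h < d2 \<Longrightarrow> \<bar>integral {-x..-x+h} (\<lambda>x. f (-x)) - h * f x\<bar> \<le> e * h"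
      using N1(2)[of x e] N2(2)[of "-x" e] x e by auto
    have "integral {-x..-x+h} (\<lambda>x. f (-x)) = integral {x-h..x} f" for h
      using Henstock_Kurzweil_Integration.integral_reflect_real[where b = x and a = "x-h" and f = f] by simp
    with d show "\<exists>d>0. \<forall>h. 0 < h \<and> h < d \<longrightarrow>
        \<bar>integral {x..x+h} f - h * f x\<bar> \<le> e * h \<and> \<bar>integral {x-h..x} f - h * f x\<bar> \<le> e * h"
      by (intro exI[of _ "min d1 d2"]) auto
  qed
qed

text \<open>Scalar Lebesgue differentiation is applied to the functions norm (V - q) with
  \<open>q\<close> in a countable dense set, so that a single null set serves all of them. At a good
  point \<open>q\<close> is then chosen close to the value.\<close>

lemma primitive_on01_AE_derivative:
  fixes u v :: "real \<Rightarrow> 'h::{banach,second_countable_topology}"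
  assumes "primitive_on01 u v"
  shows "AE t in lebesgue_on {0..1}. (u has_vector_derivative v t) (at t)"
proof -
  have v: "integrable (lebesgue_on {0..1}) v"
    and uv: "\<And>s t. 0 \<le> s \<Longrightarrow> s \<le> t \<Longrightarrow> t \<le> 1 \<Longrightarrow> u t - u s = (\<integral>\<tau>. v \<tau> \<partial>lebesgue_on {s..t})"
    using assms by (auto simp: primitive_on01_def)
  \<comment> \<open>Extended by zero, because \<open>lebesgue_differentiation\<close> asks for
    integrability on every interval.\<close>
  define V where "V t = indicator {0..1} t *\<^sub>R v t" for t :: real
  have V: "integrable lebesgue V"
    using v by (simp add: V_def[abs_def] integrable_restrict_space)
  have Vs: "integrable (lebesgue_on {a..b}) V" for a b
    using integrable_mult_indicator[OF _ V, of "{a..b}"] by (simp add: integrable_restrict_space)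
  obtain D :: "'h set" where D: "countable D" "\<And>X. open X \<Longrightarrow> X \<noteq> {} \<Longrightarrow> \<exists>d\<in>D. d \<in> X"
    using countable_dense_setE by metis
  have Vq: "integrable (lebesgue_on {a..b}) (\<lambda>t. norm (V t - q))" for q a b
    by (intro integrable_norm Bochner_Integration.integrable_diff Vs continuous_imp_integrable_real) auto
  have "(\<lambda>t. norm (V t - q)) integrable_on {a..b}" for q a b
    using integrable_on_lebesgue_on[OF Vq] by auto
  then have "\<exists>N. negligible N \<and> (\<forall>x e. x \<notin> N \<longrightarrow> 0 < e \<longrightarrow> (\<exists>d>0. \<forall>h. 0 < h \<and> h < d \<longrightarrow>
        \<bar>integral {x..x+h} (\<lambda>t. norm (V t - q)) - h * norm (V x - q)\<bar> \<le> e * h \<and>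
        \<bar>integral {x-h..x} (\<lambda>t. norm (V t - q)) - h * norm (V x - q)\<bar> \<le> e * h))" for q
    by (rule lebesgue_differentiation)
  then obtain N where N: "\<And>q. negligible (N q)"
    "\<And>q x e. x \<notin> N q \<Longrightarrow> 0 < e \<Longrightarrow> \<exists>d>0. \<forall>h. 0 < h \<and> h < d \<longrightarrow>
        \<bar>integral {x..x+h} (\<lambda>t. norm (V t - q)) - h * norm (V x - q)\<bar> \<le> e * h \<and>
        \<bar>integral {x-h..x} (\<lambda>t. norm (V t - q)) - h * norm (V x - q)\<bar> \<le> e * h"
    by metis
  have iq: "integral {a..b} (\<lambda>t. norm (V t - q)) = (\<integral>t. norm (V t - q) \<partial>lebesgue_on {a..b})" for a b q
    using Vq by (intro lebesgue_integral_eq_integral[symmetric]) auto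
  \<comment> \<open>The end points are excluded: \<open>u\<close> is unconstrained outside the unit
    interval and may have no two-sided derivative there.\<close>
  define M where "M = (\<Union>q\<in>D. N q) \<union> {0, 1}"
  have M: "negligible M"
    unfolding M_def using D(1) N(1) by (intro negligible_Un negligible_countable_Union) auto
  \<comment> \<open>\<open>p\<close> will be the value of \<open>v\<close> at the point of
    differentiation and \<open>q\<close> its approximation from \<open>D\<close>; the triangle
    inequality passes through \<open>q\<close>.\<close>
  have key: "norm (u t - u s - (t - s) *\<^sub>R p) \<le> (t - s) * norm (p - q) + (\<integral>\<tau>. norm (V \<tau> - q) \<partial>lebesgue_on {s..t})"
    if st: "0 \<le> s" "s \<le> t" "t \<le> 1" for s t p q
  proof -
    have "(\<integral>\<tau>. v \<tau> \<partial>lebesgue_on {s..t}) = (\<integral>\<tau>. V \<tau> \<partial>lebesgue_on {s..t})"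
      using st by (intro Bochner_Integration.integral_cong) (auto simp: V_def indicator_def)
    moreover have "(\<integral>\<tau>. p \<partial>lebesgue_on {s..t}) = (t - s) *\<^sub>R p"
      using st by (intro integral_const_lebesgue_on_Icc) auto
    moreover have cI: "integrable (lebesgue_on {s..t}) (\<lambda>\<tau>. p)" for p :: 'h
      by (intro finite_measure.integrable_const finite_measure_lebesgue_on) simp
    ultimately have "u t - u s - (t - s) *\<^sub>R p = (\<integral>\<tau>. V \<tau> - p \<partial>lebesgue_on {s..t})"
      using uv[OF st] by (simp only: Bochner_Integration.integral_diff[OF Vs cI])
    also have "norm \<dots> \<le> (\<integral>\<tau>. norm (V \<tau> - p) \<partial>lebesgue_on {s..t})" by simp
    also have "\<dots> \<le> (\<integral>\<tau>. norm (V \<tau> - q) + norm (p - q) \<partial>lebesgue_on {s..t})"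
    proof (rule Bochner_Integration.integral_mono)
      show "norm (V \<tau> - p) \<le> norm (V \<tau> - q) + norm (p - q)" for \<tau>
        using norm_triangle_ineq4[of "V \<tau> - q" "p - q"] by simp
    qed (intro Bochner_Integration.integrable_add integrable_norm Bochner_Integration.integrable_diff Vs cI Lebesgue_Measure.integrable_const_ivl)+
    also have "\<dots> = (t - s) * norm (p - q) + (\<integral>\<tau>. norm (V \<tau> - q) \<partial>lebesgue_on {s..t})"
      using st integral_const_lebesgue_on_Icc[OF st(2), of "norm (p - q)"]
      by (subst Bochner_Integration.integral_add[OF Vq Lebesgue_Measure.integrable_const_ivl]) simp
    finally show ?thesis .
  qed
  have "(u has_vector_derivative v t) (at t)" if t: "t \<in> {0..1}" "t \<notin> M" for t
    unfolding has_vector_derivative_def has_derivative_at_alt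
  proof (intro conjI allI impI)
    show "bounded_linear (\<lambda>x. x *\<^sub>R v t)" by (rule bounded_linear_scaleR_left)
    fix e :: real assume e: "e > 0"
    have t01: "0 < t" "t < 1" using t by (auto simp: M_def less_le)
    have Vt: "V t = v t" using t by (simp add: V_def)
    obtain q where q: "q \<in> D" "norm (v t - q) < e / 3"
      using D(2)[of "ball (v t) (e/3)"] e by (auto simp: dist_norm)
    have "t \<notin> N q" using t(2) q(1) by (auto simp: M_def)
    then obtain d where d: "d > 0" "\<And>h. 0 < h \<Longrightarrow> h < d \<Longrightarrow>
        \<bar>integral {t..t+h} (\<lambda>\<tau>. norm (V \<tau> - q)) - h * norm (V t - q)\<bar> \<le> e/3 * h \<and>
        \<bar>integral {t-h..t} (\<lambda>\<tau>. norm (V \<tau> - q)) - h * norm (V t - q)\<bar> \<le> e/3 * h"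
      using N(2)[of t q "e/3"] e by auto
    show "\<exists>d>0. \<forall>y. norm (y - t) < d \<longrightarrow> norm (u y - u t - (y - t) *\<^sub>R v t) \<le> e * norm (y - t)"
    proof (intro exI[of _ "min d (min t (1 - t))"] conjI allI impI)
      show "0 < min d (min t (1 - t))" using d t01 by auto
      fix y assume y: "norm (y - t) < min d (min t (1 - t))"
      consider "y = t" | "y > t" | "y < t" by linarith
      then show "norm (u y - u t - (y - t) *\<^sub>R v t) \<le> e * norm (y - t)"
      proof cases
        case 2
        define h where "h = y - t"
        have h: "0 < h" "h < d" "y = t + h" "y \<le> 1" using y 2 by (auto simp: h_def)
        have "norm (u y - u t - (y - t) *\<^sub>R v t) \<le> h * norm (v t - q) + (\<integral>\<tau>. norm (V \<tau> - q) \<partial>lebesgue_on {t..y})"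
          using key[of t y "v t" q] h t01 by simp
        also have "\<dots> \<le> h * norm (v t - q) + (h * norm (v t - q) + e/3 * h)"
          using d(2)[OF h(1,2)] unfolding iq Vt h(3) abs_le_iff by linarith
        also have "\<dots> \<le> h * (e/3) + (h * (e/3) + e/3 * h)"
          using q(2) h(1) by (intro add_mono mult_left_mono order_refl) auto
        finally show ?thesis using h by simp
      next
        case 3
        define h where "h = t - y"
        have h: "0 < h" "h < d" "y = t - h" "0 \<le> y" using y 3 by (auto simp: h_def)
        have "norm (u y - u t - (y - t) *\<^sub>R v t) = norm (u t - u y - (t - y) *\<^sub>R v t)"
          by (subst norm_minus_commute[of "u y - u t"]) (simp add: algebra_simps)
        also have "\<dots> \<le> h * norm (v t - q) + (\<integral>\<tau>. norm (V \<tau> - q) \<partial>lebesgue_on {y..t})"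
          using key[of y t "v t" q] h t01 by simp
        also have "\<dots> \<le> h * norm (v t - q) + (h * norm (v t - q) + e/3 * h)"
          using d(2)[OF h(1,2)] unfolding iq Vt h(3) abs_le_iff by linarith
        also have "\<dots> \<le> h * (e/3) + (h * (e/3) + e/3 * h)"
          using q(2) h(1) by (intro add_mono mult_left_mono order_refl) auto
        finally show ?thesis using h by simp
      qed simp
    qed
  qed
  then show ?thesis using M by (auto simp: AE_lebesgue_on_iff_negligible)
qed

section \<open>Null sets, restrictions and difference quotients\<close>

lemma borel_measurable_lebesgue_AE:
  fixes f g :: "'a::euclidean_space \<Rightarrow> 'b::topological_space"
  assumes f: "f \<in> borel_measurable lebesgue" and ae: "AE x in lebesgue. f x = g x"
  shows "g \<in> borel_measurable lebesgue"
proof (rule measurableI)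
  fix A :: "'b set" assume A: "A \<in> sets borel"
  have "g -` A \<in> sets lebesgue"
  \<comment> \<open>Preimages under \<open>f\<close> and \<open>g\<close> differ by a null set, and
    the measure is complete.\<close>
  proof (rule completion.in_sets_AE)
    show "AE x in lebesgue. x \<in> f -` A \<longleftrightarrow> x \<in> g -` A" using ae by eventually_elim auto
    show "f -` A \<in> sets lebesgue" using measurable_sets[OF f A] by simp
  qed simp
  then show "g -` A \<inter> space lebesgue \<in> sets lebesgue" by simp
qed simp

lemma borel_measurable_lebesgue_on_AE:
  fixes f g :: "'a::euclidean_space \<Rightarrow> 'b::real_normed_vector"
  assumes f: "f \<in> borel_measurable (lebesgue_on S)" and S: "S \<in> sets lebesgue"
    and ae: "AE x in lebesgue_on S. f x = g x"
  shows "g \<in> borel_measurable (lebesgue_on S)"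
proof -
  have "(\<lambda>x. indicator S x *\<^sub>R f x) \<in> borel_measurable lebesgue"
    using f S by (simp add: borel_measurable_restrict_space_iff)
  moreover have "AE x in lebesgue. indicator S x *\<^sub>R f x = indicator S x *\<^sub>R g x"
    using ae S by (auto simp: AE_restrict_space_iff indicator_def elim: eventually_mono)
  ultimately have "(\<lambda>x. indicator S x *\<^sub>R g x) \<in> borel_measurable lebesgue"
    by (rule borel_measurable_lebesgue_AE)
  then show ?thesis using S by (simp add: borel_measurable_restrict_space_iff)
qed

lemma AE_lebesgue_on_subset:
  assumes "AE x in lebesgue_on S. P x" "T \<subseteq> S" "S \<in> sets lebesgue" "T \<in> sets lebesgue"
  shows "AE x in lebesgue_on T. P x"
  using assms by (fastforce simp: AE_lebesgue_on_iff_negligible)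

text \<open>Cut off to the two sets, \<open>f\<close> gives functions that agree almost everywhere.
  Without measurability neither side is integrable, and both integrals take the default value
  0.\<close>

lemma lebesgue_on_null_diff:
  fixes f :: "real \<Rightarrow> 'h::{banach,second_countable_topology}"
  assumes ST: "T \<subseteq> S" "negligible (S - T)" "S \<in> sets lebesgue" "T \<in> sets lebesgue"
  shows borel_measurable_lebesgue_on_null_diff:
      "f \<in> borel_measurable (lebesgue_on S) \<longleftrightarrow> f \<in> borel_measurable (lebesgue_on T)"
    and integrable_lebesgue_on_null_diff:
      "integrable (lebesgue_on S) f \<longleftrightarrow> integrable (lebesgue_on T) f"
    and integral_lebesgue_on_null_diff:
      "(\<integral>x. f x \<partial>lebesgue_on S) = (\<integral>x. f x \<partial>lebesgue_on T)"
proof -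
  let ?fS = "\<lambda>x. indicator S x *\<^sub>R f x" and ?fT = "\<lambda>x. indicator T x *\<^sub>R f x"
  have ae: "AE x in lebesgue. ?fS x = ?fT x"
  proof -
    have "{x. ?fS x \<noteq> ?fT x} \<subseteq> S - T" using ST(1) by (auto simp: indicator_def split: if_splits)
    then show ?thesis using ST(2) by (auto simp: eventually_ae_filter_negligible)
  qed
  then have ae': "AE x in lebesgue. ?fT x = ?fS x" by (rule eventually_mono) (rule sym)
  have iff: "?fS \<in> borel_measurable lebesgue \<longleftrightarrow> ?fT \<in> borel_measurable lebesgue"
    using borel_measurable_lebesgue_AE[OF _ ae] borel_measurable_lebesgue_AE[OF _ ae'] by blast
  then show "f \<in> borel_measurable (lebesgue_on S) \<longleftrightarrow> f \<in> borel_measurable (lebesgue_on T)"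
    using ST by (simp add: borel_measurable_restrict_space_iff)
  have *: "integrable lebesgue ?fS \<longleftrightarrow> integrable lebesgue ?fT"
  proof (cases "?fS \<in> borel_measurable lebesgue")
    case True
    then show ?thesis using iff ae by (intro integrable_cong_AE) auto
  next
    case False
    then show ?thesis using iff by (auto dest: borel_measurable_integrable)
  qed
  then show "integrable (lebesgue_on S) f \<longleftrightarrow> integrable (lebesgue_on T) f"
    using ST by (simp add: integrable_restrict_space)
  have "integral\<^sup>L lebesgue ?fS = integral\<^sup>L lebesgue ?fT"
  proof (cases "?fS \<in> borel_measurable lebesgue")
    case True
    then show ?thesis using iff ae by (intro integral_cong_AE) auto
  next
    case False
    then have "\<not> integrable lebesgue ?fS" "\<not> integrable lebesgue ?fT" using * by auto
    then show ?thesis by (simp add: not_integrable_integral_eq)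
  qed
  then show "(\<integral>x. f x \<partial>lebesgue_on S) = (\<integral>x. f x \<partial>lebesgue_on T)"
    using ST by (simp add: integral_restrict_space)
qed

lemma negligible_Icc_diff [simp]:
  "negligible ({a..b::real} - {a<..<b})" "negligible ({a..b::real} - {a..<b})"
  by (rule negligible_subset[of "{a, b}"]; force)+

lemma integral_lebesgue_on_Un:
  fixes f :: "real \<Rightarrow> 'h::{banach,second_countable_topology}"
  assumes f: "integrable (lebesgue_on S) f" and S: "S = A \<union> B" "A \<inter> B = {}"
    and "A \<in> sets lebesgue" "B \<in> sets lebesgue"
  shows "(\<integral>x. f x \<partial>lebesgue_on S) = (\<integral>x. f x \<partial>lebesgue_on A) + (\<integral>x. f x \<partial>lebesgue_on B)"
proof -
  have "integrable (lebesgue_on A) f" "integrable (lebesgue_on B) f"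
    using assms by (auto intro!: integrable_lebesgue_on_subset[OF f])
  then have "set_integrable lebesgue A f" "set_integrable lebesgue B f"
    using assms by (auto simp: set_integrable_def integrable_restrict_space)
  from set_integral_Un[OF S(2) this] show ?thesis
    using assms by (simp add: set_lebesgue_integral_def integral_restrict_space)
qed

text \<open>Strong differentiability is phrased with difference quotients, the calculus of curves
  with \<open>has_vector_derivative\<close>; this translates between the two.\<close>

lemma has_vector_derivative_iff_quotient:
  "(f has_vector_derivative d) (at x within S) \<longleftrightarrow>
     ((\<lambda>y. (f y - f x) /\<^sub>R (y - x)) \<longlongrightarrow> d) (at x within S)"
proof -
  have eq: "norm ((1 / norm (y - x)) *\<^sub>R (f y - (f x + (y - x) *\<^sub>R d))) = norm ((f y - f x) /\<^sub>R (y - x) - d)"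
    if "y \<noteq> x" for y
  proof -
    have "(f y - f x) /\<^sub>R (y - x) - d = (f y - (f x + (y - x) *\<^sub>R d)) /\<^sub>R (y - x)"
      using that by (simp add: scaleR_diff_right diff_diff_eq[symmetric])
    then show ?thesis by (simp add: inverse_eq_divide)
  qed
  have "(f has_vector_derivative d) (at x within S) \<longleftrightarrow>
      ((\<lambda>y. norm ((1 / norm (y - x)) *\<^sub>R (f y - (f x + (y - x) *\<^sub>R d)))) \<longlongrightarrow> 0) (at x within S)"
    unfolding has_vector_derivative_def has_derivative_within tendsto_norm_zero_iff
    using bounded_linear_scaleR_left by blast
  also have "\<dots> \<longleftrightarrow> ((\<lambda>y. norm ((f y - f x) /\<^sub>R (y - x) - d)) \<longlongrightarrow> 0) (at x within S)"
    by (rule filterlim_cong[OF refl refl]) (use eq in \<open>auto simp only: eventually_at_filter intro!: always_eventually\<close>)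
  also have "\<dots> \<longleftrightarrow> ((\<lambda>y. (f y - f x) /\<^sub>R (y - x)) \<longlongrightarrow> d) (at x within S)"
    unfolding tendsto_norm_zero_iff by (rule Lim_null[symmetric])
  finally show ?thesis .
qed

lemma has_vector_derivative_quotient_within:
  "(f has_vector_derivative d) (at x) \<Longrightarrow> ((\<lambda>y. (f y - f x) /\<^sub>R (y - x)) \<longlongrightarrow> d) (at x within S)"
  unfolding has_vector_derivative_iff_quotient[symmetric] by (rule has_vector_derivative_at_within)

text \<open>At almost every point both \<open>u\<close> and the primitive of \<open>m\<close> are
  differentiable, and the inequality between their right difference quotients passes to the
  limit.\<close>

lemma primitive_on01_AE_bound:
  fixes u v :: "real \<Rightarrow> 'h::{banach,second_countable_topology}"
  assumes uv: "primitive_on01 u v" and m: "integrable (lebesgue_on {0..1}) m"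
    and bd: "\<And>s t. 0 \<le> s \<Longrightarrow> s \<le> t \<Longrightarrow> t \<le> 1 \<Longrightarrow> norm (u t - u s) \<le> (\<integral>\<tau>. m \<tau> \<partial>lebesgue_on {s..t})"
  shows "AE t in lebesgue_on {0..1}. norm (v t) \<le> m t"
proof -
  define M where "M t = (\<integral>\<tau>. m \<tau> \<partial>lebesgue_on {0<..t})" for t :: real
  have ms: "integrable (lebesgue_on A) m" if "A \<subseteq> {0..1}" "A \<in> sets lebesgue" for A
    using integrable_lebesgue_on_subset[OF m] that by simp
  have M: "M t - M s = (\<integral>\<tau>. m \<tau> \<partial>lebesgue_on {s..t})" if st: "0 \<le> s" "s \<le> t" "t \<le> 1" for s t
  proof -
    have "M t = M s + (\<integral>\<tau>. m \<tau> \<partial>lebesgue_on {s<..t})"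
      unfolding M_def using st by (intro integral_lebesgue_on_Un ms) auto
    moreover have "(\<integral>\<tau>. m \<tau> \<partial>lebesgue_on {s..t}) = (\<integral>\<tau>. m \<tau> \<partial>lebesgue_on {s<..t})"
    proof (rule integral_lebesgue_on_null_diff)
      show "negligible ({s..t} - {s<..t})" by (rule negligible_subset[of "{s}"]) auto
    qed auto
    ultimately show ?thesis by simp
  qed
  have "primitive_on01 M m" using M m by (simp add: primitive_on01_def)
  note this[THEN primitive_on01_AE_derivative] uv[THEN primitive_on01_AE_derivative]
  moreover have "AE t in lebesgue_on {0..1::real}. t \<noteq> 1"
    using negligible_sing[of "1::real"] by (auto simp: AE_lebesgue_on_iff_negligible simp del: negligible_sing)
  moreover have "AE t in lebesgue_on {0..1::real}. t \<in> {0..1}"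
    by (auto simp: AE_lebesgue_on_iff_negligible)
  ultimately show ?thesis
  proof eventually_elim
    case (elim t)
    have t: "0 \<le> t" "t < 1" using elim by auto
    have "((\<lambda>y. norm ((u y - u t) /\<^sub>R (y - t))) \<longlongrightarrow> norm (v t)) (at_right t)"
      by (rule tendsto_norm[OF has_vector_derivative_quotient_within[OF elim(2)]])
    moreover have "((\<lambda>y. (M y - M t) /\<^sub>R (y - t)) \<longlongrightarrow> m t) (at_right t)"
      by (rule has_vector_derivative_quotient_within[OF elim(1)])
    moreover have "eventually (\<lambda>y. norm ((u y - u t) /\<^sub>R (y - t)) \<le> (M y - M t) /\<^sub>R (y - t)) (at_right t)"
      using eventually_at_right_real[OF t(2)]
    proof eventually_elim
      case (elim y)
      then have "norm (u y - u t) \<le> M y - M t" using bd[of t y] M[of t y] t by simp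
      moreover have "norm ((u y - u t) /\<^sub>R (y - t)) = inverse (y - t) * norm (u y - u t)"
        using elim by simp
      moreover have "0 \<le> inverse (y - t)" using elim by simp
      ultimately show ?case by (simp only: real_scaleR_def mult_left_mono)
    qed
    ultimately show ?case by (intro tendsto_le[of "at_right t"]) auto
  qed
qed

text \<open>Integrability comes from 2 r \<le> r^2 + 1. The inequality is Cauchy-Schwarz against the
  constant 1, read off from the integral of the square of
  \<open>(t - s) * norm (f x) - A\<close>.\<close>

lemma integral_norm_le_sqrt:
  fixes f :: "real \<Rightarrow> 'h::{banach,second_countable_topology}"
  assumes st: "s \<le> t" and [measurable]: "f \<in> borel_measurable (lebesgue_on {s..t})"
    and f2: "integrable (lebesgue_on {s..t}) (\<lambda>x. (norm (f x))\<^sup>2)"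
  shows "integrable (lebesgue_on {s..t}) f"
    and "(\<integral>x. norm (f x) \<partial>lebesgue_on {s..t})\<^sup>2 \<le> (t - s) * (\<integral>x. (norm (f x))\<^sup>2 \<partial>lebesgue_on {s..t})"
proof -
  have c: "integrable (lebesgue_on {s..t}) (\<lambda>x. c)" for c :: real
    by (rule Lebesgue_Measure.integrable_const_ivl)
  show f: "integrable (lebesgue_on {s..t}) f"
  proof (rule Bochner_Integration.integrable_bound[OF Bochner_Integration.integrable_add[OF f2 c[of 1]]])
    show "AE x in lebesgue_on {s..t}. norm (f x) \<le> norm ((norm (f x))\<^sup>2 + 1)"
    proof (rule AE_I2)
      fix x
      have "0 \<le> (norm (f x) - 1)\<^sup>2" by (rule zero_le_power2)
      then have "2 * norm (f x) \<le> (norm (f x))\<^sup>2 + 1" by (simp add: power2_diff)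
      moreover have "0 \<le> norm (f x)" by (rule norm_ge_zero)
      ultimately have "norm (f x) \<le> (norm (f x))\<^sup>2 + 1" by linarith
      then show "norm (f x) \<le> norm ((norm (f x))\<^sup>2 + 1)" unfolding real_norm_def by linarith
    qed
  qed simp
  define A where "A = (\<integral>x. norm (f x) \<partial>lebesgue_on {s..t})"
  define Q where "Q = (\<integral>x. (norm (f x))\<^sup>2 \<partial>lebesgue_on {s..t})"
  have "0 \<le> (\<integral>x. ((t - s) * norm (f x) - A)\<^sup>2 \<partial>lebesgue_on {s..t})"
    by (rule Bochner_Integration.integral_nonneg) simp
  also have "\<dots> = (\<integral>x. (t-s)\<^sup>2 * (norm (f x))\<^sup>2 - 2 * A * (t-s) * norm (f x) + A\<^sup>2 \<partial>lebesgue_on {s..t})"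
    by (intro Bochner_Integration.integral_cong refl) (simp add: power2_eq_square algebra_simps)
  also have "\<dots> = (t-s)\<^sup>2 * Q - 2 * A * (t-s) * A + (t-s) * A\<^sup>2"
    using f f2 c integral_const_lebesgue_on_Icc[OF st, of "A\<^sup>2"]
    by (simp add: A_def Q_def)
  finally have "0 \<le> (t-s) * ((t - s) * Q - A\<^sup>2)" by (simp add: power2_eq_square algebra_simps)
  then have "A\<^sup>2 \<le> (t - s) * Q" if "s \<noteq> t" using that st by (simp add: zero_le_mult_iff)
  \<comment> \<open>Here the factor \<open>t - s\<close> cannot be cancelled, but the interval is a
    null set.\<close>
  moreover have "A\<^sup>2 \<le> (t - s) * Q" if "s = t"
  proof -
    have "A = (\<integral>x. norm (f x) \<partial>lebesgue_on {})"
      unfolding A_def that by (intro integral_lebesgue_on_null_diff) auto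
    then show ?thesis using that by (simp add: integral_restrict_space)
  qed
  ultimately show "A\<^sup>2 \<le> (t - s) * Q" by blast
qed

section \<open>Primitives from square integrable bounds on increments\<close>

lemma integral_Icc_eq_Ico:
  "(\<integral>x. (f x :: 'h::{banach,second_countable_topology}) \<partial>lebesgue_on {a..b::real}) = (\<integral>x. f x \<partial>lebesgue_on {a..<b})"
  by (rule integral_lebesgue_on_null_diff) auto

text \<open>By monotone convergence the series of norms has a finite integral, and a function with
  finite integral is finite almost everywhere.\<close>

lemma AE_summable_norm:
  fixes f :: "nat \<Rightarrow> 'a \<Rightarrow> 'h::{banach,second_countable_topology}"
  assumes f: "\<And>i. integrable M (f i)" and s: "summable (\<lambda>i. \<integral>x. norm (f i x) \<partial>M)"
  shows "AE x in M. summable (\<lambda>i. norm (f i x))"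
proof -
  have [measurable]: "f i \<in> borel_measurable M" for i using f by auto
  have "(\<integral>\<^sup>+x. (\<Sum>i. ennreal (norm (f i x))) \<partial>M) = (\<Sum>i. \<integral>\<^sup>+x. ennreal (norm (f i x)) \<partial>M)"
    by (rule nn_integral_suminf) measurable
  also have "\<dots> = (\<Sum>i. ennreal (\<integral>x. norm (f i x) \<partial>M))"
    using f by (intro arg_cong[where f = suminf] ext nn_integral_eq_integral integrable_norm) auto
  also have "\<dots> \<noteq> \<infinity>"
    using s by (simp add: ennreal_suminf_neq_top)
  finally have "AE x in M. (\<Sum>i. ennreal (norm (f i x))) \<noteq> \<infinity>"
    by (intro nn_integral_PInf_AE) measurable
  then show ?thesis
    by eventually_elim (auto intro!: summable_suminf_not_top)
qed

lemma integral_Ico_sum_dyadic: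
  fixes f :: "real \<Rightarrow> 'h::{banach,second_countable_topology}"
  assumes f: "integrable (lebesgue_on {0..<1}) f" and K: "K \<le> 2 ^ n"
  shows "(\<integral>x. f x \<partial>lebesgue_on {0..<real K / 2 ^ n}) = (\<Sum>k<K. \<integral>x. f x \<partial>lebesgue_on {real k / 2 ^ n..<real (Suc k) / 2 ^ n})"
  using K
proof (induction K)
  case 0
  then show ?case by (simp add: integral_restrict_space)
next
  case (Suc K)
  have le: "real (Suc K) / 2 ^ n \<le> 1"
    using Suc.prems by (simp add: divide_simps flip: of_nat_Suc of_nat_power)
  have "(\<integral>x. f x \<partial>lebesgue_on {0..<real (Suc K) / 2 ^ n}) = (\<integral>x. f x \<partial>lebesgue_on {0..<real K / 2 ^ n}) +
     (\<integral>x. f x \<partial>lebesgue_on {real K / 2 ^ n..<real (Suc K) / 2 ^ n})"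
  proof (rule integral_lebesgue_on_Un)
    show "integrable (lebesgue_on {0..<real (Suc K) / 2 ^ n}) f"
      using le by (intro integrable_lebesgue_on_subset[OF f]) auto
    have "real K / 2 ^ n \<le> real (Suc K) / 2 ^ n" by (intro divide_right_mono) auto
    then show "{0..<real (Suc K) / 2 ^ n} = {0..<real K / 2 ^ n} \<union> {real K / 2 ^ n..<real (Suc K) / 2 ^ n}"
      by (auto simp: ivl_disj_un_two(3))
  qed auto
  then show ?case using Suc by simp
qed

lemma integrable_Icc_iff_Ico:
  "integrable (lebesgue_on {a..b::real}) (f :: real \<Rightarrow> 'h::{banach,second_countable_topology}) \<longleftrightarrow> integrable (lebesgue_on {a..<b}) f"
  by (rule integrable_lebesgue_on_null_diff) auto

text \<open>The difference quotients of \<open>u\<close> over dyadic intervals form a martingale bounded in \<open>L\<^sup>2\<close>.\<close>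
lemma dyadic_primitive:
  fixes u :: "real \<Rightarrow> 'h::{real_inner,banach,second_countable_topology}" and m :: "real \<Rightarrow> real"
  assumes m: "m \<in> borel_measurable (lebesgue_on {0..1})" "integrable (lebesgue_on {0..1}) (\<lambda>t. (m t)\<^sup>2)"
    and bd: "\<And>s t. 0 \<le> s \<Longrightarrow> s \<le> t \<Longrightarrow> t \<le> 1 \<Longrightarrow> norm (u t - u s) \<le> (\<integral>\<tau>. m \<tau> \<partial>lebesgue_on {s..t})"
  shows "\<exists>v. primitive_on01 u v"
proof -
  let ?L = "lebesgue_on {0..<1::real}"
  define l where "l n k = real k / 2 ^ n" for n k :: nat
  define D where "D n k = {l n k..<l n (Suc k)}" for n k
  \<comment> \<open>The mean slope of \<open>u\<close> over the dyadic interval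
    \<open>D n k\<close>; \<open>V n\<close> is the step function of these slopes.\<close>
  define c where "c n k = (2 ^ n :: real) *\<^sub>R (u (l n (Suc k)) - u (l n k))" for n k
  define V where "V n t = c n (nat \<lfloor>2 ^ n * t\<rfloor>)" for n and t :: real
  have l01: "0 \<le> l n k" "k \<le> 2 ^ n \<Longrightarrow> l n k \<le> 1" "l n k < l n (Suc k)" for n k
  proof -
    assume "k \<le> 2 ^ n"
    then have "real k \<le> real (2 ^ n)" by (simp only: of_nat_le_iff)
    then show "l n k \<le> 1" by (simp add: l_def)
  qed (auto simp: l_def divide_strict_right_mono)
  have lS: "l n (Suc k) - l n k = 1 / 2 ^ n" for n k by (simp add: l_def diff_divide_distrib[symmetric])
  have l2: "l (Suc n) (2 * k) = l n k" for n k by (simp add: l_def)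
  have D01: "D n k \<subseteq> {0..<1}" if "k < 2 ^ n" for n k
    using l01(1)[of n k] l01(2)[of "Suc k" n] that by (auto simp: D_def)
  have Dsets: "D n k \<in> sets lebesgue" for n k by (simp add: D_def)
  have Vc: "V n t = c n k" if "t \<in> D n k" for n k t
  proof -
    have "real k \<le> 2 ^ n * t" "2 ^ n * t < real k + 1" using that by (auto simp: D_def l_def field_simps)
    then have "\<lfloor>2 ^ n * t\<rfloor> = int k" by (intro floor_unique) auto
    then show ?thesis by (simp add: V_def)
  qed
  have cover: "\<exists>k<2^n. t \<in> D n k" if "t \<in> {0..<1}" for n t
  proof -
    let ?k = "nat \<lfloor>2 ^ n * t\<rfloor>"
    have t0: "0 \<le> 2 ^ n * t" "2 ^ n * t < 2 ^ n" using that by auto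
    then have a: "real ?k \<le> 2 ^ n * t" "2 ^ n * t < real ?k + 1"
      by (auto simp: of_nat_nat)
    have "real ?k < 2 ^ n" by (rule le_less_trans[OF a(1) t0(2)])
    then have "?k < 2 ^ n" by (metis of_nat_less_iff of_nat_numeral of_nat_power)
    moreover have "t \<in> D n ?k"
      using a unfolding D_def l_def atLeastLessThan_iff
      by (simp only: pos_divide_le_eq pos_less_divide_eq zero_less_power zero_less_numeral of_nat_Suc mult.commute[of t] add.commute[of 1])
    ultimately show ?thesis by blast
  qed
  have V_meas [measurable]: "V n \<in> borel_measurable borel" for n
    unfolding V_def[abs_def] by measurable
  have V_meas_L [measurable]: "V n \<in> borel_measurable (lebesgue_on A)" for n A
    using V_meas by (intro measurable_restrict_space1 measurable_completion) simp
  have fin: "finite_measure ?L" by (intro finite_measure_lebesgue_on bounded_set_imp_lmeasurable) auto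
  have V_int: "integrable ?L (V n)" for n
  proof (rule finite_measure.integrable_const_bound[OF fin, of _ "Max ((\<lambda>k. norm (c n k)) ` {..<2^n})"])
    show "AE t in ?L. norm (V n t) \<le> Max ((\<lambda>k. norm (c n k)) ` {..<2^n})"
    proof (rule AE_I2)
      fix t assume "t \<in> space ?L"
      then obtain k where k: "k < 2 ^ n" "t \<in> D n k" using cover[of t n] by auto
      then show "norm (V n t) \<le> Max ((\<lambda>k. norm (c n k)) ` {..<2^n})"
        by (simp add: Vc Max_ge_iff)
    qed
  qed measurable
  have V_int_D: "integrable (lebesgue_on (D n k)) (V N)" if "k < 2 ^ n" for n k N
    using D01[OF that] by (intro integrable_lebesgue_on_subset[OF V_int] Dsets) auto
  have meas_D: "(\<integral>x. p \<partial>lebesgue_on (D n k)) = (1 / 2 ^ n) *\<^sub>R p" for p :: 'h and n k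
    using integral_const_lebesgue_on_Icc[of "l n k" "l n (Suc k)" p] l01(3)[of n k] lS[of n k]
    unfolding D_def integral_Icc_eq_Ico by simp
  \<comment> \<open>The martingale property: every finer step function has the same integral over a
    dyadic interval, because the increments of \<open>u\<close> telescope. The induction halves the
    interval.\<close>
  have int_V: "(\<integral>t. V (n + d) t \<partial>lebesgue_on (D n k)) = u (l n (Suc k)) - u (l n k)"
    if "k < 2 ^ n" for n k d
    using that
  proof (induction d arbitrary: n k)
    case 0
    have "(\<integral>t. V n t \<partial>lebesgue_on (D n k)) = (\<integral>t. c n k \<partial>lebesgue_on (D n k))"
      by (intro Bochner_Integration.integral_cong) (auto simp: Vc)
    also have "\<dots> = u (l n (Suc k)) - u (l n k)" unfolding meas_D c_def by simp
    finally show ?case by simp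
  next
    case (Suc d)
    have k2: "2 * k < 2 ^ Suc n" "Suc (2 * k) < 2 ^ Suc n" using Suc.prems by auto
    have mid: "l n k < l (Suc n) (Suc (2 * k))" "l (Suc n) (Suc (2 * k)) < l n (Suc k)"
      using l01(3)[of "Suc n" "2 * k"] l01(3)[of "Suc n" "Suc (2 * k)"] l2[of n k] l2[of n "Suc k"] by auto
    have DD: "D n k = D (Suc n) (2 * k) \<union> D (Suc n) (Suc (2 * k))"
      using mid l2[of n k] l2[of n "Suc k"] by (auto simp: D_def)
    have "(\<integral>t. V (n + Suc d) t \<partial>lebesgue_on (D n k)) =
       (\<integral>t. V (n + Suc d) t \<partial>lebesgue_on (D (Suc n) (2 * k))) + (\<integral>t. V (n + Suc d) t \<partial>lebesgue_on (D (Suc n) (Suc (2 * k))))"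
      by (rule integral_lebesgue_on_Un[OF V_int_D[OF Suc.prems] DD _ Dsets Dsets]) (auto simp: D_def)
    also have "\<dots> = (u (l (Suc n) (Suc (2 * k))) - u (l (Suc n) (2 * k))) +
        (u (l (Suc n) (Suc (Suc (2 * k)))) - u (l (Suc n) (Suc (2 * k))))"
      using Suc.IH[OF k2(1)] Suc.IH[OF k2(2)] by simp
    also have "\<dots> = u (l n (Suc k)) - u (l n k)"
      using l2[of n k] l2[of n "Suc k"] by simp
    finally show ?case .
  qed
  have V_bdd: "\<exists>B. \<forall>t\<in>{0..<1}. norm (V n t) \<le> B" for n
  proof (intro exI[of _ "Max ((\<lambda>k. norm (c n k)) ` {..<2^n})"] ballI)
    fix t :: real assume "t \<in> {0..<1}"
    then obtain k where k: "k < 2 ^ n" "t \<in> D n k" using cover by blast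
    then show "norm (V n t) \<le> Max ((\<lambda>k. norm (c n k)) ` {..<2^n})"
      by (simp add: Vc Max_ge_iff)
  qed
  have VV_int: "integrable ?L (\<lambda>t. V n t \<bullet> V N t)" for n N
  proof -
    obtain B where B: "\<And>t. t \<in> {0..<1} \<Longrightarrow> norm (V n t) \<le> B" using V_bdd[of n] by blast
    have "AE t in ?L. norm (V n t \<bullet> V N t) \<le> norm (B * norm (V N t))"
    proof (rule AE_I2)
      fix t assume "t \<in> space ?L"
      then have "norm (V n t) * norm (V N t) \<le> B * norm (V N t)"
        using B by (intro mult_right_mono) auto
      moreover have "norm (V n t \<bullet> V N t) \<le> norm (V n t) * norm (V N t)"
        by (simp add: Cauchy_Schwarz_ineq2)
      ultimately show "norm (V n t \<bullet> V N t) \<le> norm (B * norm (V N t))" unfolding real_norm_def by linarith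
    qed
    then show ?thesis
      by (rule Bochner_Integration.integrable_bound[where f = "\<lambda>t. B * norm (V N t)", rotated 2])
        (intro integrable_mult_right integrable_norm V_int, measurable)
  qed
  have sum01: "(\<integral>t. f t \<partial>?L) = (\<Sum>k<2^n. \<integral>t. f t \<partial>lebesgue_on (D n k))"
    if "integrable ?L f" for f :: "real \<Rightarrow> real" and n
    using integral_Ico_sum_dyadic[OF that, of "2^n" n] by (simp add: D_def l_def)
  \<comment> \<open>The squared L^2 norm of \<open>V n\<close>. By the martingale property it is
    also the inner product of \<open>V n\<close> with every finer \<open>V N\<close>, which makes
    the martingale increments orthogonal.\<close>
  define E where "E n = (\<Sum>k<2^n. c n k \<bullet> (u (l n (Suc k)) - u (l n k)))" for n
  have VV: "(\<integral>t. V n t \<bullet> V N t \<partial>?L) = E n" if "n \<le> N" for n N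
  proof -
    have "(\<integral>t. V n t \<bullet> V N t \<partial>lebesgue_on (D n k)) = c n k \<bullet> (u (l n (Suc k)) - u (l n k))"
      if k: "k < 2 ^ n" for k
    proof -
      have "(\<integral>t. V n t \<bullet> V N t \<partial>lebesgue_on (D n k)) = (\<integral>t. c n k \<bullet> V N t \<partial>lebesgue_on (D n k))"
        by (intro Bochner_Integration.integral_cong) (auto simp: Vc)
      also have "\<dots> = c n k \<bullet> (\<integral>t. V N t \<partial>lebesgue_on (D n k))"
        by (intro integral_inner_right V_int_D k)
      finally show ?thesis using int_V[OF k, of "N - n"] \<open>n \<le> N\<close> by simp
    qed
    then show ?thesis unfolding E_def sum01[OF VV_int, where n = n] by (intro sum.cong) auto
  qed
  have V_diff: "(\<integral>t. (norm (V N t - V n t))\<^sup>2 \<partial>?L) = E N - E n" if "n \<le> N" for n N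
  proof -
    have "(\<integral>t. (norm (V N t - V n t))\<^sup>2 \<partial>?L) = (\<integral>t. V N t \<bullet> V N t - 2 * (V n t \<bullet> V N t) + V n t \<bullet> V n t \<partial>?L)"
      by (intro Bochner_Integration.integral_cong refl)
        (simp add: power2_norm_eq_inner inner_diff_left inner_diff_right inner_commute)
    also have "\<dots> = E N - 2 * E n + E n"
      using VV_int by (simp add: VV that)
    finally show ?thesis by simp
  qed
  have m2: "integrable ?L (\<lambda>t. (m t)\<^sup>2)"
    by (rule integrable_lebesgue_on_subset[OF m(2)]) auto
  \<comment> \<open>Cauchy-Schwarz on each dyadic interval turns the bound by \<open>m\<close> into
    one uniform in \<open>n\<close>; being also increasing, \<open>E\<close> converges.\<close>
  have E_le: "E n \<le> (\<integral>t. (m t)\<^sup>2 \<partial>?L)" for n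
    unfolding E_def sum01[OF m2, where n = n]
  proof (rule sum_mono)
    fix k assume "k \<in> {..<(2::nat)^n}"
    then have k: "k < 2 ^ n" "Suc k \<le> 2 ^ n" by auto
    let ?I = "{l n k..l n (Suc k)}"
    have sub: "?I \<subseteq> {0..1}" using l01(1)[of n k] l01(2)[OF k(2)] by auto
    have le: "l n k \<le> l n (Suc k)" using l01(3)[of n k] by simp
    have mm: "m \<in> borel_measurable (lebesgue_on ?I)" "integrable (lebesgue_on ?I) (\<lambda>t. (norm (m t))\<^sup>2)"
      using sub measurable_restrict_mono[OF m(1)] integrable_lebesgue_on_subset[OF m(2), of ?I]
      by (auto simp: measurable_restrict_mono)
    note CS = integral_norm_le_sqrt[OF le mm]
    have "norm (u (l n (Suc k)) - u (l n k)) \<le> (\<integral>t. m t \<partial>lebesgue_on ?I)"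
      using bd[OF l01(1) le l01(2)[OF k(2)]] .
    also have "\<dots> \<le> (\<integral>t. norm (m t) \<partial>lebesgue_on ?I)"
      using CS(1) by (intro Bochner_Integration.integral_mono integrable_norm) auto
    finally have "(norm (u (l n (Suc k)) - u (l n k)))\<^sup>2 \<le> (\<integral>t. norm (m t) \<partial>lebesgue_on ?I)\<^sup>2"
      by (intro power_mono) auto
    also have "\<dots> \<le> (1 / 2 ^ n) * (\<integral>t. (norm (m t))\<^sup>2 \<partial>lebesgue_on ?I)"
      using CS(2) by (simp only: lS)
    also have "(\<integral>t. (norm (m t))\<^sup>2 \<partial>lebesgue_on ?I) = (\<integral>t. (m t)\<^sup>2 \<partial>lebesgue_on (D n k))"
      by (simp add: D_def integral_Icc_eq_Ico)
    finally have *: "(norm (u (l n (Suc k)) - u (l n k)))\<^sup>2 \<le> 1 / 2 ^ n * (\<integral>t. (m t)\<^sup>2 \<partial>lebesgue_on (D n k))" .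
    show "c n k \<bullet> (u (l n (Suc k)) - u (l n k)) \<le> (\<integral>t. (m t)\<^sup>2 \<partial>lebesgue_on (D n k))"
    proof -
      have "2 ^ n * (norm (u (l n (Suc k)) - u (l n k)))\<^sup>2 \<le> (\<integral>t. (m t)\<^sup>2 \<partial>lebesgue_on (D n k))"
        using * by (simp add: field_simps)
      then show ?thesis by (simp only: c_def power2_norm_eq_inner inner_scaleR_left)
    qed
  qed
  have E_mono: "E n \<le> E N" if "n \<le> N" for n N
  proof -
    have "0 \<le> (\<integral>t. (norm (V N t - V n t))\<^sup>2 \<partial>?L)" by (rule Bochner_Integration.integral_nonneg) simp
    then show ?thesis using V_diff[OF that] by simp
  qed
  obtain e where e: "E \<longlonglongrightarrow> e" "\<And>n. E n \<le> e"
    using incseq_convergent[of E] E_mono E_le by (auto simp: incseq_def)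
  \<comment> \<open>A subsequence with rate 1/4 for the squared L^2 norm: the L^1 norms of its
    increments are then at most (1/2)^j, hence summable, and the series defining \<open>v\<close>
    converges absolutely almost everywhere.\<close>
  have "\<exists>r. \<forall>j. e - E (r j) \<le> (1/4) ^ j \<and> r j < r (Suc j)"
  proof (rule dependent_nat_choice)
    have ev: "\<exists>y>x. e - E y \<le> (1/4) ^ j" for j x
    proof -
      have "eventually (\<lambda>n. \<bar>E n - e\<bar> < (1/4) ^ j) sequentially"
        using e(1) by (auto simp: tendsto_iff dist_real_def)
      then have "eventually (\<lambda>n. x < n \<and> e - E n \<le> (1/4) ^ j) sequentially"
        using eventually_gt_at_top[of x] by eventually_elim auto
      then obtain y where "x < y \<and> e - E y \<le> (1/4) ^ j"
        using eventually_happens'[OF sequentially_bot] by blast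
      then show ?thesis by (intro exI[of _ y])
    qed
    show "\<exists>x. e - E x \<le> (1/4) ^ 0" using ev[of 0 0] by (elim exE conjE) (rule exI)
    show "\<exists>y. e - E y \<le> (1/4) ^ Suc j \<and> x < y" for x j using ev[of x "Suc j"] by (elim exE conjE) (intro exI conjI)
  qed
  then obtain r where "\<forall>j. e - E (r j) \<le> (1/4) ^ j \<and> r j < r (Suc j)" by (elim exE)
  then have r: "e - E (r j) \<le> (1/4) ^ j" "r j < r (Suc j)" for j by simp_all
  then have rm: "strict_mono r" by (simp add: strict_mono_Suc_iff)
  define W where "W j t = V (r (Suc j)) t - V (r j) t" for j t
  have W_int: "integrable ?L (W j)" for j unfolding W_def[abs_def] using V_int by simp
  have W2_int: "integrable ?L (\<lambda>t. (norm (W j t))\<^sup>2)" for j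
  proof -
    have "(norm (W j t))\<^sup>2 = V (r (Suc j)) t \<bullet> V (r (Suc j)) t - 2 * (V (r j) t \<bullet> V (r (Suc j)) t) + V (r j) t \<bullet> V (r j) t" for t
      by (simp add: W_def power2_norm_eq_inner inner_diff_left inner_diff_right inner_commute)
    then show ?thesis using VV_int by simp
  qed
  have W_bd: "(\<integral>t. norm (W j t) \<partial>?L) \<le> (1/2) ^ j" for j
  proof (rule power2_le_imp_le)
    have "W j \<in> borel_measurable (lebesgue_on {0..1})" unfolding W_def[abs_def] by measurable
    moreover have "integrable (lebesgue_on {0..1}) (\<lambda>t. (norm (W j t))\<^sup>2)"
      unfolding integrable_Icc_iff_Ico by (rule W2_int)
    ultimately have "(\<integral>t. norm (W j t) \<partial>lebesgue_on {0..1})\<^sup>2 \<le> (1 - 0) * (\<integral>t. (norm (W j t))\<^sup>2 \<partial>lebesgue_on {0..1})"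
      by (rule integral_norm_le_sqrt(2)[OF zero_le_one])
    then have "(\<integral>t. norm (W j t) \<partial>?L)\<^sup>2 \<le> (\<integral>t. (norm (W j t))\<^sup>2 \<partial>?L)"
      unfolding integral_Icc_eq_Ico by simp
    also have "\<dots> = E (r (Suc j)) - E (r j)"
      unfolding W_def using r(2)[of j] by (intro V_diff) simp
    also have "\<dots> \<le> (1/4) ^ j" using r(1)[of j] e(2)[of "r (Suc j)"] by linarith
    also have "\<dots> = ((1/2) ^ j)\<^sup>2" by (simp add: power2_eq_square flip: power_mult_distrib)
    finally show "(\<integral>t. norm (W j t) \<partial>?L)\<^sup>2 \<le> ((1/2) ^ j)\<^sup>2" .
  qed simp
  have W_sum: "summable (\<lambda>j. \<integral>t. norm (W j t) \<partial>?L)"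
    by (rule summable_comparison_test'[OF summable_geometric[of "1/2::real"], of 0])
      (use W_bd in \<open>auto simp: abs_of_nonneg\<close>)
  have W_AE: "AE t in ?L. summable (\<lambda>j. norm (W j t))"
    by (rule AE_summable_norm[OF W_int W_sum])
  define v where "v t = V (r 0) t + (\<Sum>j. W j t)" for t
  have v_int: "integrable ?L v"
    unfolding v_def[abs_def]
    by (rule Bochner_Integration.integrable_add[OF V_int integrable_suminf[OF W_int W_AE W_sum]])
  \<comment> \<open>Along the subsequence the integral over a fixed dyadic interval is eventually
    constant by \<open>int_V\<close>; summability allows the exchange of sum and integral.\<close>
  have v_D: "(\<integral>t. v t \<partial>lebesgue_on (D n k)) = u (l n (Suc k)) - u (l n k)" if k: "k < 2 ^ n" for n k
  proof -
    note sub = D01[OF k]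
    have Wi: "integrable (lebesgue_on (D n k)) (W j)" for j
      by (rule integrable_lebesgue_on_subset[OF W_int sub _ Dsets]) simp
    have Wa: "AE t in lebesgue_on (D n k). summable (\<lambda>j. norm (W j t))"
      by (rule AE_lebesgue_on_subset[OF W_AE sub _ Dsets]) simp
    have "(\<integral>t. norm (W j t) \<partial>lebesgue_on (D n k)) \<le> (1/2) ^ j" for j
    proof -
      have "(\<integral>t. norm (W j t) \<partial>lebesgue_on (D n k)) = (\<integral>t. indicator (D n k) t *\<^sub>R norm (W j t) \<partial>?L)"
        by (rule integral_lebesgue_on_indicator[OF sub _ Dsets]) simp
      also have "\<dots> \<le> (\<integral>t. norm (W j t) \<partial>?L)"
      proof (rule integral_mono')
        show "integrable ?L (\<lambda>t. norm (W j t))" by (intro integrable_norm W_int)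
      qed (auto simp: indicator_def)
      also have "\<dots> \<le> (1/2) ^ j" by (rule W_bd)
      finally show ?thesis .
    qed
    then have Ws: "summable (\<lambda>j. \<integral>t. norm (W j t) \<partial>lebesgue_on (D n k))"
      by (intro summable_comparison_test'[OF summable_geometric[of "1/2::real"], of 0]) (auto simp: abs_of_nonneg)
    have S: "(\<lambda>j. \<integral>t. W j t \<partial>lebesgue_on (D n k)) sums (\<integral>t. (\<Sum>j. W j t) \<partial>lebesgue_on (D n k))"
      by (rule sums_integral[OF Wi Wa Ws])
    have part: "(\<Sum>j<J. \<integral>t. W j t \<partial>lebesgue_on (D n k)) =
        (\<integral>t. V (r J) t \<partial>lebesgue_on (D n k)) - (\<integral>t. V (r 0) t \<partial>lebesgue_on (D n k))" for J
      unfolding W_def by (simp add: Bochner_Integration.integral_diff[OF V_int_D[OF k] V_int_D[OF k]]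
          sum_lessThan_telescope[where f = "\<lambda>J. \<integral>t. V (r J) t \<partial>lebesgue_on (D n k)"])
    have "eventually (\<lambda>J. (\<integral>t. V (r J) t \<partial>lebesgue_on (D n k)) = u (l n (Suc k)) - u (l n k)) sequentially"
      using eventually_ge_at_top[of n]
    proof eventually_elim
      case (elim J)
      then have "n \<le> r J" using seq_suble[OF rm, of J] by simp
      then show ?case using int_V[OF k, of "r J - n"] by simp
    qed
    then have "(\<lambda>J. \<integral>t. V (r J) t \<partial>lebesgue_on (D n k)) \<longlonglongrightarrow> u (l n (Suc k)) - u (l n k)"
      by (rule tendsto_eventually)
    then have "(\<lambda>J. \<Sum>j<J. \<integral>t. W j t \<partial>lebesgue_on (D n k)) \<longlonglongrightarrow>
        (u (l n (Suc k)) - u (l n k)) - (\<integral>t. V (r 0) t \<partial>lebesgue_on (D n k))"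
      unfolding part by (intro tendsto_diff tendsto_const)
    with S have "(\<integral>t. (\<Sum>j. W j t) \<partial>lebesgue_on (D n k)) =
        (u (l n (Suc k)) - u (l n k)) - (\<integral>t. V (r 0) t \<partial>lebesgue_on (D n k))"
      unfolding sums_def by (rule LIMSEQ_unique)
    then show ?thesis
      unfolding v_def by (subst Bochner_Integration.integral_add[OF V_int_D[OF k] integrable_suminf[OF Wi Wa Ws]]) simp
  qed
  have v_l: "(\<integral>t. v t \<partial>lebesgue_on {0..<l n K}) = u (l n K) - u 0" if "K \<le> 2 ^ n" for n K
  proof -
    have "(\<integral>t. v t \<partial>lebesgue_on {0..<l n K}) = (\<Sum>k<K. u (l n (Suc k)) - u (l n k))"
      using integral_Ico_sum_dyadic[OF v_int that] v_D that unfolding l_def[symmetric] D_def by simp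
    also have "\<dots> = u (l n K) - u (l n 0)" by (rule sum_lessThan_telescope[where f = "\<lambda>k. u (l n k)"])
    finally show ?thesis by (simp add: l_def)
  qed
  have v_int1: "integrable (lebesgue_on {0..1}) v"
    unfolding integrable_Icc_iff_Ico by (rule v_int)
  have m_int: "integrable (lebesgue_on {0..1}) m"
    using integral_norm_le_sqrt(1)[of 0 1 m] m by simp
  \<comment> \<open>Dominates the increments of both \<open>u\<close> and the candidate primitive,
    and so carries the identity from dyadic points to all times.\<close>
  define g where "g t = m t + norm (v t)" for t
  have g_int: "integrable (lebesgue_on {0..1}) g"
    unfolding g_def[abs_def] using m_int v_int1 by simp
  have Ico: "integral\<^sup>L (lebesgue_on {0..<t}) f = integral\<^sup>L (lebesgue_on {0..<s}) f + integral\<^sup>L (lebesgue_on {s..t}) f"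
    if "integrable (lebesgue_on {0..1}) f" "0 \<le> s" "s \<le> t" "t \<le> 1" for s t and f :: "real \<Rightarrow> 'b::{banach,second_countable_topology}"
    unfolding integral_Icc_eq_Ico
    using that by (intro integral_lebesgue_on_Un integrable_lebesgue_on_subset[OF that(1)]) auto
  have key: "norm ((u t - u 0) - (\<integral>x. v x \<partial>lebesgue_on {0..<t})) = 0" if t: "0 \<le> t" "t \<le> 1" for t
  proof -
    define F where "F t = (u t - u 0) - (\<integral>x. v x \<partial>lebesgue_on {0..<t})" for t
    define G where "G t = (\<integral>x. g x \<partial>lebesgue_on {0..<t})" for t
    \<comment> \<open>The dyadic point of level \<open>n\<close> just below \<open>t\<close>: the
      identity holds there, and the error up to \<open>t\<close> is at most an increment of the
      continuous function \<open>G\<close>.\<close>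
    define q where "q n = l n (nat \<lfloor>2 ^ n * t\<rfloor>)" for n
    have q: "0 \<le> q n" "q n \<le> t" "t - q n \<le> (1/2) ^ n" "F (q n) = 0" for n
    proof -
      have "real (nat \<lfloor>2 ^ n * t\<rfloor>) \<le> 2 ^ n * t" "2 ^ n * t \<le> real (nat \<lfloor>2 ^ n * t\<rfloor>) + 1"
        using t by (auto simp: of_nat_nat)
      then show "q n \<le> t" "t - q n \<le> (1/2) ^ n"
        by (auto simp only: q_def l_def pos_divide_le_eq pos_le_divide_eq power_one_over diff_le_eq mult.commute[of t]
             mult.commute[of _ "2 ^ n :: real"] add_divide_distrib[symmetric] zero_less_power zero_less_numeral add.commute)
      show "0 \<le> q n" by (simp add: q_def l01)
      have "2 ^ n * t \<le> 2 ^ n" using t by simp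
      then have "\<lfloor>2 ^ n * t\<rfloor> \<le> \<lfloor>2 ^ n :: real\<rfloor>" by (rule floor_mono)
      then have "\<lfloor>2 ^ n * t\<rfloor> \<le> int (2 ^ n)" by simp
      then have "nat \<lfloor>2 ^ n * t\<rfloor> \<le> 2 ^ n" by linarith
      then show "F (q n) = 0" unfolding F_def q_def by (simp add: v_l)
    qed
    have "norm (F t) \<le> G t - G (q n)" for n
    proof -
      let ?s = "q n"
      have st: "0 \<le> ?s" "?s \<le> t" "t \<le> 1" using q t by auto
      have "F t = (u t - u ?s) - (\<integral>x. v x \<partial>lebesgue_on {?s..t})"
        using q(4)[of n] Ico[OF v_int1 st] by (simp add: F_def algebra_simps)
      also have "norm \<dots> \<le> (\<integral>x. m x \<partial>lebesgue_on {?s..t}) + (\<integral>x. norm (v x) \<partial>lebesgue_on {?s..t})"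
        by (rule order_trans[OF norm_triangle_ineq4 add_mono[OF bd[OF st] integral_norm_bound]])
      also have "\<dots> = (\<integral>x. g x \<partial>lebesgue_on {?s..t})"
        unfolding g_def using st
        by (intro Bochner_Integration.integral_add[symmetric] integrable_norm
            integrable_lebesgue_on_subset[OF m_int] integrable_lebesgue_on_subset[OF v_int1]) auto
      finally show ?thesis using Ico[OF g_int st] by (simp add: G_def)
    qed
    moreover have "(\<lambda>n. G t - G (q n)) \<longlonglongrightarrow> G t - G t"
    proof (intro tendsto_diff tendsto_const)
      have cG: "continuous_on {0..1} G"
        unfolding G_def integral_Icc_eq_Ico[symmetric] by (rule indefinite_integral_continuous_real[OF g_int])
      have "(\<lambda>n. t - q n) \<longlonglongrightarrow> 0"
        by (rule tendsto_sandwich[OF _ _ tendsto_const LIMSEQ_power_zero[of "1/2::real"]]) (use q in auto)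
      from tendsto_diff[OF tendsto_const[of t] this] have "q \<longlonglongrightarrow> t" by simp
      then show "(\<lambda>n. G (q n)) \<longlonglongrightarrow> G t"
        by (rule continuous_on_tendsto_compose[OF cG]) (use t in \<open>auto intro!: always_eventually q order_trans[OF q(2)]\<close>)
    qed
    ultimately have "norm (F t) \<le> G t - G t"
      by (intro LIMSEQ_le_const) auto
    then show ?thesis by (simp add: F_def)
  qed
  show ?thesis
    unfolding primitive_on01_def
  proof (intro exI[of _ v] conjI allI impI v_int1)
    fix s t :: real assume st: "0 \<le> s" "s \<le> t" "t \<le> 1"
    show "u t - u s = (\<integral>\<tau>. v \<tau> \<partial>lebesgue_on {s..t})"
      using key[of t] key[of s] Ico[OF v_int1 st] st by (simp add: algebra_simps)
  qed
qed

section \<open>Calculus of primitives\<close>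

lemma primitive_on01_subset:
  fixes u v :: "real \<Rightarrow> 'h::{banach,second_countable_topology}"
  assumes "primitive_on01 u v" "A \<subseteq> {0..1}" "A \<in> sets lebesgue"
  shows "integrable (lebesgue_on A) v"
  using assms by (auto simp: primitive_on01_def intro: integrable_lebesgue_on_subset)

lemma primitive_on01_diff:
  "primitive_on01 u v \<Longrightarrow> 0 \<le> s \<Longrightarrow> s \<le> t \<Longrightarrow> t \<le> 1 \<Longrightarrow> u t - u s = (\<integral>\<tau>. v \<tau> \<partial>lebesgue_on {s..t})"
  by (simp add: primitive_on01_def)

lemma primitive_on01_norm_le:
  fixes u v :: "real \<Rightarrow> 'h::{banach,second_countable_topology}"
  assumes "primitive_on01 u v" "0 \<le> s" "s \<le> t" "t \<le> 1"
  shows "norm (u t - u s) \<le> (\<integral>\<tau>. norm (v \<tau>) \<partial>lebesgue_on {s..t})"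
  using assms by (simp add: primitive_on01_diff)

lemma primitive_on01_indefinite:
  fixes v :: "real \<Rightarrow> 'h::{banach,second_countable_topology}"
  assumes "integrable (lebesgue_on {0..1}) v"
  shows "primitive_on01 (\<lambda>t. \<integral>\<tau>. v \<tau> \<partial>lebesgue_on {0..t}) v"
  unfolding primitive_on01_def
proof (intro conjI allI impI assms)
  fix s t :: real assume st: "0 \<le> s" "s \<le> t" "t \<le> 1"
  have "(\<integral>\<tau>. v \<tau> \<partial>lebesgue_on {0..<t}) = (\<integral>\<tau>. v \<tau> \<partial>lebesgue_on {0..<s}) + (\<integral>\<tau>. v \<tau> \<partial>lebesgue_on {s..<t})"
    using st by (intro integral_lebesgue_on_Un integrable_lebesgue_on_subset[OF assms]) auto
  then show "(\<integral>\<tau>. v \<tau> \<partial>lebesgue_on {0..t}) - (\<integral>\<tau>. v \<tau> \<partial>lebesgue_on {0..s}) = (\<integral>\<tau>. v \<tau> \<partial>lebesgue_on {s..t})"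
    by (simp add: integral_Icc_eq_Ico)
qed

text \<open>The increments of \<open>u\<close> are dominated by those of the scalar primitive of the
  norm of \<open>v\<close>, from which continuity is inherited.\<close>

lemma primitive_on01_continuous:
  fixes u v :: "real \<Rightarrow> 'h::{banach,second_countable_topology}"
  assumes uv: "primitive_on01 u v"
  shows "continuous_on {0..1} u"
proof -
  have v: "integrable (lebesgue_on {0..1}) (\<lambda>t. norm (v t))"
    using uv by (auto simp: primitive_on01_def)
  define G where "G t = (\<integral>\<tau>. norm (v \<tau>) \<partial>lebesgue_on {0..t})" for t
  have cG: "continuous_on {0..1} G"
    unfolding G_def by (rule indefinite_integral_continuous_real[OF v])
  have G: "primitive_on01 G (\<lambda>t. norm (v t))"
    unfolding G_def[abs_def] by (rule primitive_on01_indefinite[OF v])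
  have le: "norm (u t - u s) \<le> \<bar>G t - G s\<bar>" if "s \<le> t" "s \<in> {0..1}" "t \<in> {0..1}" for s t
    using primitive_on01_norm_le[OF uv, of s t] primitive_on01_diff[OF G, of s t] that by auto
  have le': "dist (u t) (u s) \<le> dist (G t) (G s)" if "s \<in> {0..1}" "t \<in> {0..1}" for s t
    using le[of s t] le[of t s] that by (cases "s \<le> t") (auto simp: dist_norm norm_minus_commute dist_real_def abs_minus_commute)
  show ?thesis
    unfolding continuous_on_iff
  proof (intro ballI allI impI)
    fix x e :: real assume x: "x \<in> {0..1}" "0 < e"
    obtain d where "d > 0" "\<forall>y\<in>{0..1}. dist y x < d \<longrightarrow> dist (G y) (G x) < e"
      using cG x unfolding continuous_on_iff by meson
    then show "\<exists>d>0. \<forall>y\<in>{0..1}. dist y x < d \<longrightarrow> dist (u y) (u x) < e"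
      using x by (intro exI[of _ d] conjI ballI impI le_less_trans[OF le']) auto
  qed
qed

text \<open>Splitting an increment of the product bounds it by an integral, so that
  \<open>primitive_on01I_AC\<close> applies. This product rule serves the weak derivative (scalar
  multiplication) and the integration by parts formula (inner product).\<close>

lemma primitive_on01_bilinear:
  fixes u v :: "real \<Rightarrow> 'h::{real_inner,banach,second_countable_topology}"
    and f :: "real \<Rightarrow> 'a::{banach,second_countable_topology}"
    and B :: "'a \<Rightarrow> 'h \<Rightarrow> 'c::{real_inner,banach,second_countable_topology}"
  assumes B: "bounded_bilinear B" and uv: "primitive_on01 u v"
    and f: "\<And>t. (f has_vector_derivative f' t) (at t)" and f': "continuous_on {0..1} f'"
  shows "primitive_on01 (\<lambda>t. B (f t) (u t)) (\<lambda>t. B (f t) (v t) + B (f' t) (u t))"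
proof -
  interpret bounded_bilinear B by (rule B)
  obtain K where K: "K > 0" "\<And>a b. norm (B a b) \<le> norm a * norm b * K"
    using pos_bounded by auto
  have cu: "continuous_on {0..1} u" by (rule primitive_on01_continuous[OF uv])
  have cf: "continuous_on {0..1} f"
    using f by (intro continuous_at_imp_continuous_on ballI has_vector_derivative_continuous)
  have bdd: "\<exists>C\<ge>0. \<forall>t\<in>{0..1}. norm (h t) \<le> C" if "continuous_on {0..1} h" for h :: "real \<Rightarrow> 'z::real_normed_vector"
    using compact_imp_bounded[OF compact_continuous_image[OF that compact_Icc]]
    by (auto simp: bounded_pos intro: less_imp_le)
  obtain Cu Cf Cf' where C: "Cu \<ge> 0" "Cf \<ge> 0" "Cf' \<ge> 0" "\<And>t. t \<in> {0..1} \<Longrightarrow> norm (u t) \<le> Cu"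
      "\<And>t. t \<in> {0..1} \<Longrightarrow> norm (f t) \<le> Cf" "\<And>t. t \<in> {0..1} \<Longrightarrow> norm (f' t) \<le> Cf'"
  proof -
    obtain Cu where "Cu \<ge> 0" "\<forall>t\<in>{0..1}. norm (u t) \<le> Cu" using bdd[OF cu] by (elim exE conjE)
    moreover obtain Cf where "Cf \<ge> 0" "\<forall>t\<in>{0..1}. norm (f t) \<le> Cf" using bdd[OF cf] by (elim exE conjE)
    moreover obtain Cf' where "Cf' \<ge> 0" "\<forall>t\<in>{0..1}. norm (f' t) \<le> Cf'" using bdd[OF f'] by (elim exE conjE)
    ultimately show ?thesis by (intro that[of Cu Cf Cf']; blast)
  qed
  have v: "integrable (lebesgue_on {0..1}) v" using uv by (simp add: primitive_on01_def)
  have mu: "u \<in> borel_measurable (lebesgue_on {0..1})" "f \<in> borel_measurable (lebesgue_on {0..1})"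
      "f' \<in> borel_measurable (lebesgue_on {0..1})"
    using cu cf f' by (auto intro!: continuous_imp_measurable_on_sets_lebesgue)
  have contB: "continuous_on UNIV (\<lambda>x. B (fst x) (snd x))"
    by (intro continuous_on continuous_on_fst continuous_on_snd continuous_on_id)
  have mB: "(\<lambda>t. B (g t) (h t)) \<in> borel_measurable (lebesgue_on {0..1})"
    if "g \<in> borel_measurable (lebesgue_on {0..1})" "h \<in> borel_measurable (lebesgue_on {0..1})" for g h
    by (rule borel_measurable_continuous_Pair[OF that contB])
  define m where "m t = K * (Cf * norm (v t) + Cf' * Cu)" for t
  have m: "integrable (lebesgue_on {0..1}) m"
    unfolding m_def[abs_def] using integrable_norm[OF v] by simp
  have lip: "norm (f t - f s) \<le> Cf' * (t - s)" if st: "0 \<le> s" "s \<le> t" "t \<le> 1" for s t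
  proof -
    have "(f' has_integral (f t - f s)) {s..t}"
      by (intro fundamental_theorem_of_calculus st) (rule has_vector_derivative_at_within[OF f])
    from has_integral_bound_real[OF C(3) finite.emptyI this] C(6) st show ?thesis by auto
  qed
  show ?thesis
  proof (rule primitive_on01I_AC[OF _ m])
    show "integrable (lebesgue_on {0..1}) (\<lambda>t. B (f t) (v t) + B (f' t) (u t))"
    proof (rule Bochner_Integration.integrable_bound[OF m])
      show "(\<lambda>t. B (f t) (v t) + B (f' t) (u t)) \<in> borel_measurable (lebesgue_on {0..1})"
        using mu v by (intro borel_measurable_add mB) auto
      show "AE t in lebesgue_on {0..1}. norm (B (f t) (v t) + B (f' t) (u t)) \<le> norm (m t)"
      proof (rule AE_I2)
        fix t assume t: "t \<in> space (lebesgue_on {0..1::real})"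
        have "norm (B (f t) (v t)) \<le> Cf * norm (v t) * K"
          using C(5)[of t] t K(1) by (intro order_trans[OF K(2)] mult_right_mono) auto
        moreover have "norm (B (f' t) (u t)) \<le> Cf' * Cu * K"
          using C(4,6)[of t] C(1-3) t K(1) by (intro order_trans[OF K(2)] mult_right_mono mult_mono) auto
        ultimately have "norm (B (f t) (v t) + B (f' t) (u t)) \<le> m t"
          using norm_triangle_ineq[of "B (f t) (v t)" "B (f' t) (u t)"] by (simp add: m_def algebra_simps)
        then show "norm (B (f t) (v t) + B (f' t) (u t)) \<le> norm (m t)" by simp
      qed
    qed
    show "norm (B (f t) (u t) - B (f s) (u s)) \<le> (\<integral>\<tau>. m \<tau> \<partial>lebesgue_on {s..t})"
      if st: "0 \<le> s" "s \<le> t" "t \<le> 1" for s t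
    proof -
      have vi: "integrable (lebesgue_on {s..t}) (\<lambda>\<tau>. norm (v \<tau>))"
        using primitive_on01_subset[OF uv, of "{s..t}"] st by auto
      have "B (f t) (u t) - B (f s) (u s) = B (f t) (u t - u s) + B (f t - f s) (u s)"
        by (simp add: diff_left diff_right)
      also have "norm \<dots> \<le> norm (f t) * norm (u t - u s) * K + norm (f t - f s) * norm (u s) * K"
        by (rule order_trans[OF norm_triangle_ineq add_mono[OF K(2) K(2)]])
      also have "\<dots> \<le> Cf * (\<integral>\<tau>. norm (v \<tau>) \<partial>lebesgue_on {s..t}) * K + (Cf' * (t - s)) * Cu * K"
        using C st K(1) lip[OF st] primitive_on01_norm_le[OF uv st]
        by (intro add_mono mult_right_mono mult_mono) auto
      also have "\<dots> = K * (Cf * (\<integral>\<tau>. norm (v \<tau>) \<partial>lebesgue_on {s..t}) + (t - s) * (Cf' * Cu))"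
        by (simp add: algebra_simps)
      also have "\<dots> = (\<integral>\<tau>. m \<tau> \<partial>lebesgue_on {s..t})"
      proof -
        have "(\<integral>\<tau>. Cf * norm (v \<tau>) + Cf' * Cu \<partial>lebesgue_on {s..t}) =
            (\<integral>\<tau>. Cf * norm (v \<tau>) \<partial>lebesgue_on {s..t}) + (\<integral>\<tau>. Cf' * Cu \<partial>lebesgue_on {s..t})"
          using vi by (intro Bochner_Integration.integral_add) simp_all
        moreover have "(\<integral>\<tau>. Cf' * Cu \<partial>lebesgue_on {s..t}) = (t - s) *\<^sub>R (Cf' * Cu)"
          by (rule integral_const_lebesgue_on_Icc[OF st(2)])
        ultimately show ?thesis unfolding m_def by (simp only: integral_mult_right_zero real_scaleR_def)
      qed
      finally show ?thesis .
    qed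
    show "AE t in lebesgue_on {0..1}. ((\<lambda>t. B (f t) (u t)) has_vector_derivative B (f t) (v t) + B (f' t) (u t)) (at t)"
      using primitive_on01_AE_derivative[OF uv]
      by eventually_elim (rule has_vector_derivative[OF f])
  qed
qed

section \<open>Smooth steps\<close>

text \<open>The shape of all derivatives of exp(-1/x) extended by 0; the polynomial parameter makes
  the family closed under differentiation.\<close>

definition flat_exp :: "real poly \<Rightarrow> real \<Rightarrow> real" where
  "flat_exp p x = (if x \<le> 0 then 0 else poly p (inverse x) * exp (- inverse x))"

lemma poly_times_exp_tendsto_0: "((\<lambda>y. poly p y * exp (- y)) \<longlongrightarrow> (0::real)) at_top"
proof -
  have "((\<lambda>y. \<Sum>i\<le>degree p. coeff p i * (y ^ i / exp y)) \<longlongrightarrow> (\<Sum>i\<le>degree p. coeff p i * 0)) at_top"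
    by (intro tendsto_intros tendsto_power_div_exp_0)
  then show ?thesis by (simp add: poly_altdef exp_minus divide_inverse sum_distrib_right mult.assoc)
qed

text \<open>With y = 1/x, the derivative of p(y) e^(-y) in y is (p' - p)(y) e^(-y), and dy/dx =
  -y^2; hence the polynomial y^2 (p - p'). At 0 the exponential decay beats every power.\<close>

lemma flat_exp_has_derivative:
  "(flat_exp p has_real_derivative flat_exp ([:0, 0, 1:] * (p - pderiv p)) x) (at x)"
proof -
  consider "x < 0" | "x > 0" | "x = 0" by linarith
  then show ?thesis
  proof cases
    case 1
    have "((\<lambda>x. 0) has_real_derivative 0) (at x)" by simp
    then have "(flat_exp p has_real_derivative 0) (at x)"
      by (rule has_field_derivative_transform_within_open[of _ _ _ "{..<0}"]) (use 1 in \<open>auto simp: flat_exp_def\<close>)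
    then show ?thesis using 1 by (simp add: flat_exp_def)
  next
    case 2
    have "((\<lambda>x. poly p (inverse x) * exp (- inverse x)) has_real_derivative
        poly ([:0, 0, 1:] * (p - pderiv p)) (inverse x) * exp (- inverse x)) (at x)"
    proof -
      have i: "(inverse has_real_derivative - (inverse x * inverse x)) (at x)"
        using DERIV_inverse[of x UNIV] 2 by (simp only: power2_eq_square power_Suc power_0 mult_1_right numeral_2_eq_2 less_imp_neq[symmetric] not_False_eq_True simp_thms inverse_mult_distrib)
      have "((\<lambda>x. poly p (inverse x) * exp (- inverse x)) has_real_derivative
          poly p (inverse x) * (exp (- inverse x) * - (- (inverse x * inverse x)))
          + poly (pderiv p) (inverse x) * (- (inverse x * inverse x)) * exp (- inverse x)) (at x)"
        by (rule DERIV_mult' DERIV_chain2[OF poly_DERIV i] DERIV_chain2[OF DERIV_exp] DERIV_minus i)+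
      then show ?thesis by (simp add: algebra_simps)
    qed
    then have "(flat_exp p has_real_derivative
        poly ([:0, 0, 1:] * (p - pderiv p)) (inverse x) * exp (- inverse x)) (at x)"
      by (rule has_field_derivative_transform_within_open[of _ _ _ "{0<..}"]) (use 2 in \<open>auto simp: flat_exp_def\<close>)
    then show ?thesis using 2 by (simp add: flat_exp_def)
  next
    case 3
    have "((\<lambda>h. flat_exp p h / h) \<longlongrightarrow> 0) (at 0)"
    proof (rule filterlim_split_at)
      show "((\<lambda>h. flat_exp p h / h) \<longlongrightarrow> 0) (at_left 0)"
        by (rule tendsto_eventually) (auto simp: flat_exp_def eventually_at_filter)
      \<comment> \<open>Dividing by \<open>h\<close> multiplies the polynomial by its
        variable.\<close>
      have "((\<lambda>h. poly (pCons 0 p) (inverse h) * exp (- inverse h)) \<longlongrightarrow> 0) (at_right 0)"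
        by (rule filterlim_compose[OF poly_times_exp_tendsto_0 filterlim_inverse_at_top_right])
      then show "((\<lambda>h. flat_exp p h / h) \<longlongrightarrow> 0) (at_right 0)"
        by (rule Lim_transform_eventually)
          (auto simp: flat_exp_def eventually_at_filter divide_inverse)
    qed
    then show ?thesis using 3 by (simp add: DERIV_def flat_exp_def)
  qed
qed

text \<open>Smoothness by closure: each function of the class has its derivative in the class, so
  derivatives of all orders exist without formulas for them. The reciprocal is a generator because
  its derivative is its own square times a function of the class.\<close>

inductive step_class :: "(real \<Rightarrow> real) \<Rightarrow> bool" where
  flat: "step_class (flat_exp p)"
| reflected: "step_class (\<lambda>x. flat_exp p (1 - x))"
| denom: "step_class (\<lambda>x. inverse (flat_exp 1 x + flat_exp 1 (1 - x)))"
| plus: "step_class f \<Longrightarrow> step_class g \<Longrightarrow> step_class (\<lambda>x. f x + g x)"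
| times: "step_class f \<Longrightarrow> step_class g \<Longrightarrow> step_class (\<lambda>x. f x * g x)"

lemma step_denom_pos: "flat_exp 1 x + flat_exp 1 (1 - x) > 0"
  by (auto simp: flat_exp_def add_pos_pos)

lemma flat_exp_uminus: "flat_exp (- p) x = - flat_exp p x"
  by (simp add: flat_exp_def)

lemma flat_exp_reflected_derivative:
  "((\<lambda>x. flat_exp p (1 - x)) has_real_derivative - flat_exp ([:0, 0, 1:] * (p - pderiv p)) (1 - x)) (at x)"
proof -
  have "((\<lambda>x. 1 - x) has_real_derivative - 1) (at x)" by (auto intro!: derivative_eq_intros)
  from DERIV_chain2[OF flat_exp_has_derivative this] show ?thesis by (simp only: mult_minus1_right)
qed

lemma step_class_has_derivative:
  "step_class f \<Longrightarrow> \<exists>g. step_class g \<and> (\<forall>x. (f has_real_derivative g x) (at x))"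
proof (induction rule: step_class.induct)
  case (flat p)
  then show ?case using flat_exp_has_derivative step_class.flat by blast
next
  case (reflected p)
  have "((\<lambda>x. flat_exp p (1 - x)) has_real_derivative flat_exp (- ([:0, 0, 1:] * (p - pderiv p))) (1 - x)) (at x)" for x
    unfolding flat_exp_uminus by (rule flat_exp_reflected_derivative)
  then show ?case using step_class.reflected by blast
next
  case denom
  let ?p = "[:0, 0, 1:] * (1 - pderiv 1) :: real poly"
  let ?d = "\<lambda>x. flat_exp 1 x + flat_exp 1 (1 - x)"
  let ?d' = "\<lambda>x. flat_exp (- ?p) x + flat_exp ?p (1 - x)"
  have "((\<lambda>x. inverse (?d x)) has_real_derivative ?d' x * (inverse (?d x) * inverse (?d x))) (at x)" for x
  proof -
    have "(?d has_real_derivative flat_exp ?p x + - flat_exp ?p (1 - x)) (at x)"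
      by (rule DERIV_add[OF flat_exp_has_derivative flat_exp_reflected_derivative])
    moreover have "?d x \<noteq> 0" using step_denom_pos[of x] by linarith
    ultimately have "((\<lambda>x. inverse (?d x)) has_real_derivative
        - (inverse (?d x) * (flat_exp ?p x + - flat_exp ?p (1 - x)) * inverse (?d x))) (at x)"
      by (rule DERIV_inverse')
    moreover have "- (i * (a + - b) * i) = (- a + b) * (i * i)" for i a b :: real
      by (simp add: algebra_simps)
    ultimately show ?thesis by (simp only: flat_exp_uminus)
  qed
  moreover have "step_class (\<lambda>x. ?d' x * (inverse (?d x) * inverse (?d x)))"
    by (intro step_class.intros)
  ultimately show ?case by (intro exI conjI allI)
next
  case (plus f g)
  obtain f' where f': "step_class f'" "\<forall>x. (f has_real_derivative f' x) (at x)" using plus.IH(1) by (elim exE conjE)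
  obtain g' where g': "step_class g'" "\<forall>x. (g has_real_derivative g' x) (at x)" using plus.IH(2) by (elim exE conjE)
  have "\<forall>x. ((\<lambda>x. f x + g x) has_real_derivative f' x + g' x) (at x)"
    using f'(2) g'(2) by (intro allI DERIV_add) (erule spec)+
  then show ?case using step_class.plus[OF f'(1) g'(1)] by (intro exI conjI)
next
  case (times f g)
  obtain f' where f': "step_class f'" "\<forall>x. (f has_real_derivative f' x) (at x)" using times.IH(1) by (elim exE conjE)
  obtain g' where g': "step_class g'" "\<forall>x. (g has_real_derivative g' x) (at x)" using times.IH(2) by (elim exE conjE)
  have "\<forall>x. ((\<lambda>x. f x * g x) has_real_derivative f x * g' x + f' x * g x) (at x)"
    using f'(2) g'(2) by (intro allI DERIV_mult') (erule spec)+
  moreover have "step_class (\<lambda>x. f x * g' x + f' x * g x)"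
    using f'(1) g'(1) times.hyps by (intro step_class.plus step_class.times)
  ultimately show ?case by (intro exI conjI)
qed

text \<open>A quotient of flat functions: on the left its numerator vanishes, on the right the
  second summand of its denominator. Dependent choice lists its successive derivatives in the form
  that \<open>test_functions\<close> demands.\<close>

lemma smooth_step:
  obtains D :: "nat \<Rightarrow> real \<Rightarrow> real"
  where "\<And>n t. (D n has_real_derivative D (Suc n) t) (at t)"
    "\<And>x. x \<le> 0 \<Longrightarrow> D 0 x = 0" "\<And>x. x \<ge> 1 \<Longrightarrow> D 0 x = 1" "\<And>x. 0 \<le> D 0 x" "\<And>x. D 0 x \<le> 1"
proof -
  define H where "H x = flat_exp 1 x * inverse (flat_exp 1 x + flat_exp 1 (1 - x))" for x
  have "step_class H" unfolding H_def[abs_def] by (intro step_class.intros)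
  have "\<exists>D. \<forall>n. (step_class (D n) \<and> (n = 0 \<longrightarrow> D n = H)) \<and> (\<forall>x. (D n has_real_derivative D (Suc n) x) (at x))"
  proof (rule dependent_nat_choice)
    show "\<exists>f. step_class f \<and> (0 = 0 \<longrightarrow> f = H)" using \<open>step_class H\<close> by blast
    show "\<exists>g. (step_class g \<and> (Suc n = 0 \<longrightarrow> g = H)) \<and> (\<forall>x. (f has_real_derivative g x) (at x))"
      if "step_class f \<and> (n = 0 \<longrightarrow> f = H)" for f n
      using step_class_has_derivative[of f] that by auto
  qed
  then obtain D where D0: "\<forall>n. (step_class (D n) \<and> (n = 0 \<longrightarrow> D n = H)) \<and> (\<forall>x. (D n has_real_derivative D (Suc n) x) (at x))"
    by (elim exE)
  then have D: "(D n has_real_derivative D (Suc n) x) (at x)" "D 0 = H" for n x by simp_all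
  have pos: "flat_exp 1 x \<ge> 0" for x by (simp add: flat_exp_def)
  show ?thesis
  proof (rule that[of D, OF D(1)])
    show "D 0 x = 0" if "x \<le> 0" for x using that by (simp add: D H_def flat_exp_def)
    show "D 0 x = 1" if "x \<ge> 1" for x using that by (simp add: D H_def flat_exp_def)
    show "0 \<le> D 0 x" for x using pos by (simp add: D H_def)
    show "D 0 x \<le> 1" for x using step_denom_pos[of x] pos[of "1 - x"]
      by (simp add: D H_def divide_inverse[symmetric])
  qed
qed

section \<open>Sobolev functions and absolutely continuous representatives\<close>

lemma lebesgue_on_Icc_Ioo:
  fixes f :: "real \<Rightarrow> 'h::{banach,second_countable_topology}"
  shows borel_measurable_Icc_iff_Ioo: "f \<in> borel_measurable (lebesgue_on {a..b}) \<longleftrightarrow> f \<in> borel_measurable (lebesgue_on {a<..<b})"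
    and integrable_Icc_iff_Ioo: "integrable (lebesgue_on {a..b}) f \<longleftrightarrow> integrable (lebesgue_on {a<..<b}) f"
    and integral_Icc_eq_Ioo: "(\<integral>x. f x \<partial>lebesgue_on {a..b}) = (\<integral>x. f x \<partial>lebesgue_on {a<..<b})"
  by (rule borel_measurable_lebesgue_on_null_diff integrable_lebesgue_on_null_diff integral_lebesgue_on_null_diff; auto)+

lemma square_integrable_on_Ioo_iff:
  "square_integrable_on f {a<..<b} \<longleftrightarrow>
     f \<in> borel_measurable (lebesgue_on {a..b}) \<and> integrable (lebesgue_on {a..b}) (\<lambda>t. (norm (f t))\<^sup>2)"
  by (simp add: square_integrable_on_def borel_measurable_Icc_iff_Ioo integrable_Icc_iff_Ioo)

lemma continuous_square_integrable_on:
  assumes "continuous_on {a..b} u"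
  shows "square_integrable_on u {a<..<b}"
  unfolding square_integrable_on_Ioo_iff
proof
  show "u \<in> borel_measurable (lebesgue_on {a..b})"
    using assms by (intro continuous_imp_measurable_on_sets_lebesgue) auto
  show "integrable (lebesgue_on {a..b}) (\<lambda>t. (norm (u t))\<^sup>2)"
    using assms by (intro continuous_imp_integrable_real continuous_intros)
qed

lemma test_function_boundary:
  assumes "\<phi> \<in> test_functions {0<..<1}"
  obtains D where "\<phi> = D 0" "\<And>n t. (D n has_vector_derivative D (Suc n) t) (at t)"
    "\<And>t. t \<notin> {0<..<1} \<Longrightarrow> \<phi> t = 0" "\<And>t. vector_derivative \<phi> (at t) = D 1 t"
proof -
  obtain D C where D: "D 0 = \<phi>" "\<And>n t. (D n has_vector_derivative D (Suc n) t) (at t)"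
      and C: "C \<subseteq> {0<..<1}" "\<And>t. t \<notin> C \<Longrightarrow> \<phi> t = 0"
    using assms unfolding test_functions_def by auto
  show ?thesis
  proof (rule that[of D])
    show "\<phi> t = 0" if "t \<notin> {0<..<1}" for t using C that by blast
    show "vector_derivative \<phi> (at t) = D 1 t" for t
      using vector_derivative_at[OF D(2)[of 0 t]] D(1) by simp
  qed (use D in auto)
qed

text \<open>The product of a test function with \<open>u\<close> is again a primitive and vanishes
  at both end points, so the integral of its derivative is 0.\<close>

lemma sobolev_H1_derivativeI:
  fixes u v :: "real \<Rightarrow> 'h::{real_inner,banach,second_countable_topology}"
  assumes uv: "primitive_on01 u v" and v2: "integrable (lebesgue_on {0..1}) (\<lambda>t. (norm (v t))\<^sup>2)"
  shows "sobolev_H1_derivative u v {0<..<1}"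
  unfolding sobolev_H1_derivative_def
proof (intro conjI)
  have v: "integrable (lebesgue_on {0..1}) v" using uv by (simp add: primitive_on01_def)
  have cu: "continuous_on {0..1} u" by (rule primitive_on01_continuous[OF uv])
  show "square_integrable_on u {0<..<1}" by (rule continuous_square_integrable_on[OF cu])
  show "square_integrable_on v {0<..<1}" using v v2 by (auto simp: square_integrable_on_Ioo_iff)
  show "weak_derivative_on u v {0<..<1}"
    unfolding weak_derivative_on_def
  proof
    fix \<phi> :: "real \<Rightarrow> real" assume "\<phi> \<in> test_functions {0<..<1}"
    then obtain D where D: "\<phi> = D 0" "\<And>n t. (D n has_vector_derivative D (Suc n) t) (at t)"
      "\<And>t. t \<notin> {0<..<1} \<Longrightarrow> \<phi> t = 0" "\<And>t. vector_derivative \<phi> (at t) = D 1 t"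
      by (rule test_function_boundary) (rule that)
    have d\<phi>: "(\<phi> has_vector_derivative D 1 t) (at t)" for t using D(1) D(2)[of 0 t] by simp
    have cD: "continuous_on {0..1} (D n)" for n
      by (intro continuous_at_imp_continuous_on ballI has_vector_derivative_continuous[OF D(2)])
    have P: "primitive_on01 (\<lambda>t. \<phi> t *\<^sub>R u t) (\<lambda>t. \<phi> t *\<^sub>R v t + D 1 t *\<^sub>R u t)"
      by (rule primitive_on01_bilinear[OF bounded_bilinear_scaleR uv d\<phi> cD])
    have I2: "integrable (lebesgue_on {0..1}) (\<lambda>t. D 1 t *\<^sub>R u t)"
    proof (rule Bochner_Integration.integrable_bound)
      show "(\<lambda>t. D 1 t *\<^sub>R u t) \<in> borel_measurable (lebesgue_on {0..1})"
        using cD cu by (intro continuous_imp_measurable_on_sets_lebesgue continuous_intros) auto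
      show "integrable (lebesgue_on {0..1}) (\<lambda>t. norm (D 1 t *\<^sub>R u t))"
        by (rule continuous_imp_integrable_real) (intro continuous_intros cD cu)
    qed simp
    have I1: "integrable (lebesgue_on {0..1}) (\<lambda>t. \<phi> t *\<^sub>R v t)"
      using Bochner_Integration.integrable_diff[OF primitive_on01_subset[OF P order_refl] I2] by simp
    have "0 = (\<integral>t. \<phi> t *\<^sub>R v t + D 1 t *\<^sub>R u t \<partial>lebesgue_on {0..1})"
      using primitive_on01_diff[OF P, of 0 1] D(3)[of 0] D(3)[of 1] by simp
    also have "\<dots> = (\<integral>t. \<phi> t *\<^sub>R v t \<partial>lebesgue_on {0..1}) + (\<integral>t. D 1 t *\<^sub>R u t \<partial>lebesgue_on {0..1})"
      by (rule Bochner_Integration.integral_add[OF I1 I2])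
    finally show "(\<integral>t. vector_derivative \<phi> (at t) *\<^sub>R u t \<partial>lebesgue_on {0<..<1}) = - (\<integral>t. \<phi> t *\<^sub>R v t \<partial>lebesgue_on {0<..<1})"
      unfolding D(4) integral_Icc_eq_Ioo[symmetric] by (simp add: eq_neg_iff_add_eq_0 add.commute)
  qed
qed

text \<open>Inside the interval \<open>u\<close> differs from the indefinite integral of
  \<open>v\<close> by a constant, and continuity carries this to the end points.\<close>

lemma primitive_on01_if_interior:
  fixes u v :: "real \<Rightarrow> 'h::{banach,second_countable_topology}"
  assumes u: "continuous_on {0..1} u" and v: "integrable (lebesgue_on {0..1}) v"
    and uv: "\<And>s t. 0 < s \<Longrightarrow> s < t \<Longrightarrow> t < 1 \<Longrightarrow> u t - u s = (\<integral>\<tau>. v \<tau> \<partial>lebesgue_on {s..t})"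
  shows "primitive_on01 u v"
proof -
  define w where "w t = (\<integral>\<tau>. v \<tau> \<partial>lebesgue_on {0..t})" for t
  have w: "primitive_on01 w v" unfolding w_def[abs_def] by (rule primitive_on01_indefinite[OF v])
  have cw: "continuous_on {0..1} (\<lambda>t. u t - w t)"
    by (intro continuous_on_diff u primitive_on01_continuous[OF w])
  define c where "c = u (1/2) - w (1/2)"
  have eq: "u t - w t = c" if "t \<in> {0<..<1}" for t
  proof -
    consider "t < 1/2" | "t = 1/2" | "t > 1/2" by linarith
    then show ?thesis
    proof cases
      case 1
      then show ?thesis using uv[of t "1/2"] that primitive_on01_diff[OF w, of t "1/2"]
        unfolding c_def by (simp add: algebra_simps)
    next
      case 3
      then show ?thesis using uv[of "1/2" t] that primitive_on01_diff[OF w, of "1/2" t]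
        unfolding c_def by (simp add: algebra_simps)
    qed (simp only: c_def)
  qed
  have "u t - w t = c" if "t \<in> {0..1}" for t
    by (rule continuous_constant_on_closure[of "{0<..<1::real}"]) (use cw eq that in auto)
  then have "u t = c + w t" if "t \<in> {0..1}" for t
    using that by (simp add: diff_eq_eq)
  then have "u t - u s = w t - w s" if "s \<in> {0..1}" "t \<in> {0..1}" for s t
    using that by (simp only: add_diff_add diff_self add_0)
  then show ?thesis using w by (simp add: primitive_on01_def)
qed

text \<open>Tested with smoothed indicators of \<open>{s<..t}\<close>.\<close>
lemma sobolev_H1_derivativeD:
  fixes u v :: "real \<Rightarrow> 'h::{real_inner,banach,second_countable_topology}"
  assumes S: "sobolev_H1_derivative u v {0<..<1}" and cu: "continuous_on {0..1} u"
  shows "primitive_on01 u v" and "integrable (lebesgue_on {0..1}) (\<lambda>t. (norm (v t))\<^sup>2)"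
proof -
  have vm: "v \<in> borel_measurable (lebesgue_on {0..1})"
    and v2: "integrable (lebesgue_on {0..1}) (\<lambda>t. (norm (v t))\<^sup>2)"
    using S by (auto simp: sobolev_H1_derivative_def square_integrable_on_Ioo_iff)
  show "integrable (lebesgue_on {0..1}) (\<lambda>t. (norm (v t))\<^sup>2)" by (rule v2)
  have v: "integrable (lebesgue_on {0..1}) v" by (rule integral_norm_le_sqrt(1)[OF zero_le_one vm v2])
  have weak: "(\<integral>t. vector_derivative \<phi> (at t) *\<^sub>R u t \<partial>lebesgue_on {0..1}) = - (\<integral>t. \<phi> t *\<^sub>R v t \<partial>lebesgue_on {0..1})"
    if "\<phi> \<in> test_functions {0<..<1}" for \<phi> :: "real \<Rightarrow> real"
    using S that by (simp add: sobolev_H1_derivative_def weak_derivative_on_def integral_Icc_eq_Ioo)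
  obtain D :: "nat \<Rightarrow> real \<Rightarrow> real" where D: "\<And>n t. (D n has_real_derivative D (Suc n) t) (at t)"
    "\<And>x. x \<le> 0 \<Longrightarrow> D 0 x = 0" "\<And>x. x \<ge> 1 \<Longrightarrow> D 0 x = 1" "\<And>x. 0 \<le> D 0 x" "\<And>x. D 0 x \<le> 1"
    using smooth_step by blast
  have cD1: "continuous_on A (D (Suc 0))" for A
    by (intro continuous_at_imp_continuous_on ballI DERIV_isCont[OF D(1)])
  have D1_0: "D (Suc 0) x = 0" if "x < 0 \<or> x > 1" for x
  proof -
    have "(D 0 has_real_derivative 0) (at x)"
    proof (cases "x < 0")
      case True
      then show ?thesis
        by (intro has_field_derivative_transform_within_open[OF DERIV_const[of 0], where S = "{..<0}"]) (auto simp: D)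
    next
      case False
      then show ?thesis using that
        by (intro has_field_derivative_transform_within_open[OF DERIV_const[of 1], where S = "{1<..}"]) (auto simp: D)
    qed
    with D(1)[of 0 x] show ?thesis by (rule DERIV_unique)
  qed
  obtain L where L: "L \<ge> 0" "\<And>x. \<bar>D (Suc 0) x\<bar> \<le> L"
  proof -
    have "bounded (D (Suc 0) ` {0..1})"
      by (intro compact_imp_bounded compact_continuous_image cD1 compact_Icc)
    then obtain L where L: "L > 0" "\<And>x. x \<in> {0..1} \<Longrightarrow> \<bar>D (Suc 0) x\<bar> \<le> L"
      by (auto simp: bounded_pos)
    have "\<bar>D (Suc 0) x\<bar> \<le> L" for x
      using L(1) L(2)[of x] D1_0[of x] by (cases "x \<in> {0..1}") auto
    then show ?thesis using that[of L] L(1) by simp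
  qed
  \<comment> \<open>The derivative of a step of width \<open>h\<close> starting at \<open>a\<close>:
    it lives on [a, a + h] and has integral 1. Its sign is left open; the bound \<open>L / h\<close>
    serves instead.\<close>
  define \<rho> where "\<rho> h a \<tau> = D (Suc 0) ((\<tau> - a) / h) / h" for h a \<tau> :: real
  have c\<rho>: "continuous_on A (\<rho> h a)" if "h > 0" for A h a
    unfolding \<rho>_def using that by (intro continuous_intros continuous_on_compose2[OF cD1[of UNIV]]) auto
  have \<rho>u_int: "integrable (lebesgue_on {0..1}) (\<lambda>\<tau>. \<rho> h a \<tau> *\<^sub>R u \<tau>)" if "h > 0" for h a
  proof (rule Bochner_Integration.integrable_bound)
    show "(\<lambda>t. \<rho> h a t *\<^sub>R u t) \<in> borel_measurable (lebesgue_on {0..1})"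
      using c\<rho>[OF that] cu by (intro continuous_imp_measurable_on_sets_lebesgue continuous_intros) auto
    show "integrable (lebesgue_on {0..1}) (\<lambda>t. norm (\<rho> h a t *\<^sub>R u t))"
      by (rule continuous_imp_integrable_real) (intro continuous_intros c\<rho>[OF that] cu)
  qed simp
  have conc: "norm ((\<integral>\<tau>. \<rho> h a \<tau> *\<^sub>R u \<tau> \<partial>lebesgue_on {0..1}) - u a) \<le> L * e"
    if h: "h > 0" "0 \<le> a" "a + h \<le> 1" and e: "\<And>\<tau>. \<tau> \<in> {a..a+h} \<Longrightarrow> norm (u \<tau> - u a) \<le> e" for h a e
  proof -
    let ?I = "{a..a+h}"
    have "(\<rho> h a has_integral (D 0 ((a + h - a) / h) - D 0 ((a - a) / h))) ?I"
    proof (rule fundamental_theorem_of_calculus)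
      show "((\<lambda>\<tau>. D 0 ((\<tau> - a) / h)) has_vector_derivative \<rho> h a x) (at x within {a..a + h})" for x
      proof -
        have "((\<lambda>\<tau>. (\<tau> - a) / h) has_real_derivative 1 / h) (at x)"
          using h by (auto intro!: derivative_eq_intros)
        from DERIV_chain2[OF D(1) this] have "((\<lambda>\<tau>. D 0 ((\<tau> - a) / h)) has_vector_derivative \<rho> h a x) (at x)"
          by (simp add: has_real_derivative_iff_has_vector_derivative \<rho>_def)
        then show ?thesis by (rule has_vector_derivative_at_within)
      qed
    qed (use h in auto)
    then have "(\<rho> h a has_integral 1) ?I" using h D(2)[of 0] D(3)[of 1] by simp
    moreover have \<rho>i: "integrable (lebesgue_on ?I) (\<rho> h a)"
      using c\<rho>[OF h(1)] by (rule continuous_imp_integrable_real)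
    ultimately have one: "(\<integral>\<tau>. \<rho> h a \<tau> \<partial>lebesgue_on ?I) = 1"
      using has_integral_integral_lebesgue_on[OF \<rho>i] by (simp add: has_integral_unique)
    have sub: "?I \<subseteq> {0..1}" using h by auto
    have \<rho>uI: "integrable (lebesgue_on ?I) (\<lambda>\<tau>. \<rho> h a \<tau> *\<^sub>R u \<tau>)"
      using sub by (intro integrable_lebesgue_on_subset[OF \<rho>u_int[OF h(1)]]) auto
    have \<rho>aI: "integrable (lebesgue_on ?I) (\<lambda>\<tau>. \<rho> h a \<tau> *\<^sub>R u a)"
      using \<rho>i by simp
    have "(\<integral>\<tau>. \<rho> h a \<tau> *\<^sub>R u \<tau> \<partial>lebesgue_on {0..1}) = (\<integral>\<tau>. indicator ?I \<tau> *\<^sub>R \<rho> h a \<tau> *\<^sub>R u \<tau> \<partial>lebesgue_on {0..1})"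
    proof (intro Bochner_Integration.integral_cong refl)
      fix \<tau>
      show "\<rho> h a \<tau> *\<^sub>R u \<tau> = indicator ?I \<tau> *\<^sub>R \<rho> h a \<tau> *\<^sub>R u \<tau>"
      proof (cases "\<tau> \<in> ?I")
        case False
        then have "(\<tau> - a) / h < 0 \<or> (\<tau> - a) / h > 1" using h by (auto simp: divide_less_0_iff less_divide_eq)
        then show ?thesis using False D1_0 by (simp add: \<rho>_def)
      qed simp
    qed
    also have "\<dots> = (\<integral>\<tau>. \<rho> h a \<tau> *\<^sub>R u \<tau> \<partial>lebesgue_on ?I)"
      using sub by (intro integral_lebesgue_on_indicator[symmetric]) auto
    finally have "(\<integral>\<tau>. \<rho> h a \<tau> *\<^sub>R u \<tau> \<partial>lebesgue_on {0..1}) - u a =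
        (\<integral>\<tau>. \<rho> h a \<tau> *\<^sub>R u \<tau> \<partial>lebesgue_on ?I) - (\<integral>\<tau>. \<rho> h a \<tau> *\<^sub>R u a \<partial>lebesgue_on ?I)"
      using one \<rho>i by simp
    also have "\<dots> = (\<integral>\<tau>. \<rho> h a \<tau> *\<^sub>R u \<tau> - \<rho> h a \<tau> *\<^sub>R u a \<partial>lebesgue_on ?I)"
      by (rule Bochner_Integration.integral_diff[OF \<rho>uI \<rho>aI, symmetric])
    also have "norm \<dots> \<le> (\<integral>\<tau>. norm (\<rho> h a \<tau> *\<^sub>R u \<tau> - \<rho> h a \<tau> *\<^sub>R u a) \<partial>lebesgue_on ?I)"
      by (rule integral_norm_bound)
    also have "\<dots> \<le> (\<integral>\<tau>. L / h * e \<partial>lebesgue_on ?I)"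
    proof (rule Bochner_Integration.integral_mono)
      show "integrable (lebesgue_on ?I) (\<lambda>\<tau>. norm (\<rho> h a \<tau> *\<^sub>R u \<tau> - \<rho> h a \<tau> *\<^sub>R u a))"
        by (intro integrable_norm Bochner_Integration.integrable_diff \<rho>uI \<rho>aI)
      show "integrable (lebesgue_on ?I) (\<lambda>\<tau>. L / h * e)" by (rule Lebesgue_Measure.integrable_const_ivl)
      fix \<tau> assume "\<tau> \<in> space (lebesgue_on ?I)"
      then have \<tau>: "\<tau> \<in> ?I" by simp
      have "norm (\<rho> h a \<tau> *\<^sub>R u \<tau> - \<rho> h a \<tau> *\<^sub>R u a) = \<bar>\<rho> h a \<tau>\<bar> * norm (u \<tau> - u a)"
        by (simp only: scaleR_diff_right[symmetric] norm_scaleR)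
      also have "\<dots> \<le> L / h * e"
        using L h e[OF \<tau>] by (intro mult_mono) (auto simp: \<rho>_def divide_right_mono)
      finally show "norm (\<rho> h a \<tau> *\<^sub>R u \<tau> - \<rho> h a \<tau> *\<^sub>R u a) \<le> L / h * e" .
    qed
    also have "\<dots> = (a + h - a) *\<^sub>R (L / h * e)"
      using h by (intro integral_const_lebesgue_on_Icc) simp
    also have "\<dots> = L * e" using h by simp
    finally show ?thesis .
  qed
  show "primitive_on01 u v"
  proof (rule primitive_on01_if_interior[OF cu v])
    fix s t :: real assume st: "0 < s" "s < t" "t < 1"
    \<comment> \<open>A step up at \<open>s\<close> minus a step up at \<open>t\<close>: close to
      the indicator of {s<..t}, with derivative \<open>\<rho> h s - \<rho> h t\<close>.\<close>
    define \<phi> where "\<phi> h \<tau> = D 0 ((\<tau> - s) / h) - D 0 ((\<tau> - t) / h)" for h \<tau> :: real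
    have d\<phi>: "((\<lambda>\<tau>. (1/h)^n * (D n ((\<tau> - s) / h) - D n ((\<tau> - t) / h))) has_vector_derivative
        (1/h)^Suc n * (D (Suc n) ((x - s) / h) - D (Suc n) ((x - t) / h))) (at x)" if "h > 0" for h x n
    proof -
      have "((\<lambda>\<tau>. (\<tau> - a) / h) has_real_derivative 1 / h) (at x)" for a
        using that by (auto intro!: derivative_eq_intros)
      note * = DERIV_chain2[OF D(1) this]
      show ?thesis
        using DERIV_cmult[OF DERIV_diff[OF *[of n s] *[of n t]], of "(1/h)^n"]
        by (simp add: has_real_derivative_iff_has_vector_derivative algebra_simps)
    qed
    have \<phi>_test: "\<phi> h \<in> test_functions {0<..<1}" if h: "0 < h" "t + h < 1" for h
      unfolding test_functions_def mem_Collect_eq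
    proof
      show "\<exists>C. compact C \<and> C \<subseteq> {0<..<1} \<and> (\<forall>\<tau>. \<tau> \<notin> C \<longrightarrow> \<phi> h \<tau> = 0)"
      proof (intro exI[of _ "{s..t+h}"] conjI allI impI)
        fix \<tau> assume "\<tau> \<notin> {s..t+h}"
        then consider "\<tau> < s" | "\<tau> > t + h" by fastforce
        then show "\<phi> h \<tau> = 0"
        proof cases
          case 1
          then show ?thesis using D(2) st h by (simp add: \<phi>_def divide_nonpos_pos)
        next
          case 2
          then have "1 \<le> (\<tau> - s) / h" "1 \<le> (\<tau> - t) / h" using st h by (auto simp: le_divide_eq)
          then show ?thesis using D(3) by (simp add: \<phi>_def)
        qed
      qed (use st h in auto)
      show "\<exists>Da. Da 0 = \<phi> h \<and> (\<forall>n x. (Da n has_vector_derivative Da (Suc n) x) (at x))"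
        using d\<phi>[OF h(1)] by (intro exI[of _ "\<lambda>n \<tau>. (1/h)^n * (D n ((\<tau> - s) / h) - D n ((\<tau> - t) / h))"])
          (auto simp: \<phi>_def fun_eq_iff)
    qed
    have vd\<phi>: "vector_derivative (\<phi> h) (at \<tau>) = \<rho> h s \<tau> - \<rho> h t \<tau>" if "h > 0" for h \<tau>
      using vector_derivative_at[OF d\<phi>[OF that, of 0]] by (simp add: \<phi>_def[abs_def] \<rho>_def diff_divide_distrib)
    \<comment> \<open>Widths tending to 0 that keep the support [s, t + h] inside the open unit
      interval.\<close>
    define h where "h n = (1 - t) / 2 / real (Suc n)" for n
    have h: "h n > 0" "t + h n < 1" for n
    proof -
      show "h n > 0" using st by (simp add: h_def)
      have "h n \<le> (1 - t) / 2 / 1" unfolding h_def using st by (intro divide_left_mono) auto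
      then show "t + h n < 1" using st by (simp add: field_simps)
    qed
    have h0: "h \<longlonglongrightarrow> 0"
      unfolding h_def by (rule real_tendsto_divide_at_top[OF tendsto_const filterlim_compose[OF filterlim_real_sequentially filterlim_Suc]])
    have lim1: "(\<lambda>n. \<integral>\<tau>. \<rho> (h n) a \<tau> *\<^sub>R u \<tau> \<partial>lebesgue_on {0..1}) \<longlonglongrightarrow> u a" if a: "0 < a" "a \<le> t" for a
      unfolding tendsto_iff dist_norm
    proof (intro allI impI)
      fix e :: real assume "e > 0"
      \<comment> \<open>Division by \<open>L + 1\<close>, since only \<open>L \<ge> 0\<close> is
        recorded.\<close>
      define e' where "e' = e / (L + 1)"
      have e': "e' > 0" "L * e' < e" using \<open>e > 0\<close> L(1) by (auto simp: e'_def field_simps)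
      obtain d where d: "d > 0" "\<And>y. y \<in> {0..1} \<Longrightarrow> \<bar>y - a\<bar> < d \<Longrightarrow> norm (u y - u a) < e'"
      proof -
        have "a \<in> {0..1}" using a st by auto
        then show ?thesis using that cu e'(1) unfolding continuous_on_iff dist_norm real_norm_def by blast
      qed
      have "eventually (\<lambda>n. h n < d) sequentially" by (rule order_tendstoD(2)[OF h0 d(1)])
      then show "eventually (\<lambda>n. norm ((\<integral>\<tau>. \<rho> (h n) a \<tau> *\<^sub>R u \<tau> \<partial>lebesgue_on {0..1}) - u a) < e) sequentially"
      proof eventually_elim
        case (elim n)
        have "norm ((\<integral>\<tau>. \<rho> (h n) a \<tau> *\<^sub>R u \<tau> \<partial>lebesgue_on {0..1}) - u a) \<le> L * e'"
        proof (rule conc)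
          fix \<tau> assume "\<tau> \<in> {a..a + h n}"
          then show "norm (u \<tau> - u a) \<le> e'"
            using elim h(2)[of n] a st by (intro less_imp_le d(2)) auto
        qed (use h[of n] a in auto)
        then show ?case using e'(2) by simp
      qed
    qed
    have "(\<lambda>n. \<integral>\<tau>. vector_derivative (\<phi> (h n)) (at \<tau>) *\<^sub>R u \<tau> \<partial>lebesgue_on {0..1}) \<longlonglongrightarrow> u s - u t"
    proof -
      have "(\<integral>\<tau>. vector_derivative (\<phi> (h n)) (at \<tau>) *\<^sub>R u \<tau> \<partial>lebesgue_on {0..1}) =
         (\<integral>\<tau>. \<rho> (h n) s \<tau> *\<^sub>R u \<tau> \<partial>lebesgue_on {0..1}) - (\<integral>\<tau>. \<rho> (h n) t \<tau> *\<^sub>R u \<tau> \<partial>lebesgue_on {0..1})" for n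
        unfolding vd\<phi>[OF h(1)] scaleR_diff_left
        by (rule Bochner_Integration.integral_diff[OF \<rho>u_int[OF h(1)] \<rho>u_int[OF h(1)]])
      then show ?thesis using tendsto_diff[OF lim1[of s] lim1[of t]] st by simp
    qed
    then have l1: "(\<lambda>n. - (\<integral>\<tau>. \<phi> (h n) \<tau> *\<^sub>R v \<tau> \<partial>lebesgue_on {0..1})) \<longlonglongrightarrow> u s - u t"
      by (simp add: weak[OF \<phi>_test[OF h]])
    have l2: "(\<lambda>n. \<integral>\<tau>. \<phi> (h n) \<tau> *\<^sub>R v \<tau> \<partial>lebesgue_on {0..1}) \<longlonglongrightarrow> (\<integral>\<tau>. indicator {s<..t} \<tau> *\<^sub>R v \<tau> \<partial>lebesgue_on {0..1})"
    proof (rule integral_dominated_convergence)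
      show "(\<lambda>\<tau>. indicator {s<..t} \<tau> *\<^sub>R v \<tau>) \<in> borel_measurable (lebesgue_on {0..1})"
        using vm st by (intro borel_measurable_scaleR borel_measurable_indicator) (auto simp: sets_restrict_space_iff)
      show "(\<lambda>\<tau>. \<phi> (h n) \<tau> *\<^sub>R v \<tau>) \<in> borel_measurable (lebesgue_on {0..1})" for n
      proof -
        have "continuous_on {0..1} (\<phi> (h n))"
          using d\<phi>[OF h(1), of n 0] by (intro continuous_at_imp_continuous_on ballI)
            (auto simp: \<phi>_def[abs_def] dest!: has_vector_derivative_continuous)
        then have "\<phi> (h n) \<in> borel_measurable (lebesgue_on {0..1})"
          by (intro continuous_imp_measurable_on_sets_lebesgue) auto
        then show ?thesis using vm by (rule borel_measurable_scaleR)
      qed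
      show "integrable (lebesgue_on {0..1}) (\<lambda>\<tau>. norm (v \<tau>))" using v by simp
      \<comment> \<open>The step is 0 at its starting point, whence the half-open interval in the
        limit.\<close>
      have *: "(\<lambda>n. D 0 ((\<tau> - a) / h n)) \<longlonglongrightarrow> indicator {a<..} \<tau>" for \<tau> a
      proof (cases "\<tau> \<le> a")
        case True
        then show ?thesis using D(2) h(1) by (simp add: divide_nonpos_pos)
      next
        case False
        have "eventually (\<lambda>n. h n < \<tau> - a) sequentially"
          using False by (intro order_tendstoD(2)[OF h0]) simp
        then have "eventually (\<lambda>n. D 0 ((\<tau> - a) / h n) = 1) sequentially"
        proof eventually_elim
          case (elim n)
          then show ?case using h(1)[of n] by (intro D(3)) (simp add: le_divide_eq)
        qed
        then show ?thesis using False by (simp add: tendsto_eventually)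
      qed
      show "AE \<tau> in lebesgue_on {0..1}. (\<lambda>n. \<phi> (h n) \<tau> *\<^sub>R v \<tau>) \<longlonglongrightarrow> indicator {s<..t} \<tau> *\<^sub>R v \<tau>"
      proof (rule AE_I2)
        fix \<tau>
        have "indicator {s<..t} \<tau> = (indicator {s<..} \<tau> - indicator {t<..} \<tau> :: real)"
          using st by (auto simp: indicator_def)
        then show "(\<lambda>n. \<phi> (h n) \<tau> *\<^sub>R v \<tau>) \<longlonglongrightarrow> indicator {s<..t} \<tau> *\<^sub>R v \<tau>"
          unfolding \<phi>_def by (simp only:) (intro tendsto_intros *)
      qed
      show "AE \<tau> in lebesgue_on {0..1}. norm (\<phi> (h n) \<tau> *\<^sub>R v \<tau>) \<le> norm (v \<tau>)" for n
      proof (rule AE_I2)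
        fix \<tau>
        have "\<bar>\<phi> (h n) \<tau>\<bar> \<le> 1"
          using D(4,5)[of "(\<tau> - s) / h n"] D(4,5)[of "(\<tau> - t) / h n"] by (simp add: \<phi>_def abs_le_iff)
        then show "norm (\<phi> (h n) \<tau> *\<^sub>R v \<tau>) \<le> norm (v \<tau>)"
          by (simp add: mult_left_le_one_le)
      qed
    qed
    have "u s - u t = - (\<integral>\<tau>. indicator {s<..t} \<tau> *\<^sub>R v \<tau> \<partial>lebesgue_on {0..1})"
      by (rule LIMSEQ_unique[OF l1 tendsto_minus[OF l2]])
    also have "(\<integral>\<tau>. indicator {s<..t} \<tau> *\<^sub>R v \<tau> \<partial>lebesgue_on {0..1}) = (\<integral>\<tau>. v \<tau> \<partial>lebesgue_on {s<..t})"
      using st by (intro integral_lebesgue_on_indicator[symmetric]) auto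
    also have "\<dots> = (\<integral>\<tau>. v \<tau> \<partial>lebesgue_on {s..t})"
    proof (rule integral_lebesgue_on_null_diff[symmetric])
      show "negligible ({s..t} - {s<..t})" by (rule negligible_subset[of "{s}"]) auto
    qed auto
    finally have "u s - u t = - (\<integral>\<tau>. v \<tau> \<partial>lebesgue_on {s..t})" .
    then have "- (u s - u t) = (\<integral>\<tau>. v \<tau> \<partial>lebesgue_on {s..t})" by (simp only: minus_minus)
    then show "u t - u s = (\<integral>\<tau>. v \<tau> \<partial>lebesgue_on {s..t})" by (simp only: minus_diff_eq)
  qed
qed

section \<open>Self-transport potentials\<close>

text \<open>\<open>\<delta>\<close> is a parameter so that later constants are explicit and uniform
  in the measure; \<open>gibbs_kernel_lower_bound\<close> obtains it from compactness.\<close>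

locale gibbs_rkhs =
  fixes c :: "'a::metric_space \<Rightarrow> 'a \<Rightarrow> real" and \<epsilon> \<delta> :: real
    and ev :: "'h::{real_inner,banach,second_countable_topology} \<Rightarrow> 'a \<Rightarrow> real"
  assumes compact_space: "compact (UNIV :: 'a set)"
    and eps_pos: "\<epsilon> > 0"
    and cost_continuous: "continuous_on UNIV (\<lambda>(x, y). c x y)"
    and cost_nonneg: "c x y \<ge> 0"
    and cost_sym: "c x y = c y x"
    and rkhs: "is_rkhs (gibbs_kernel c \<epsilon>) ev"
    and delta_pos: "\<delta> > 0"
    and delta_le: "\<delta> \<le> gibbs_kernel c \<epsilon> x y"
begin

section \<open>Representers and embedded measures\<close>

abbreviation k :: "'a \<Rightarrow> 'a \<Rightarrow> real" where "k \<equiv> gibbs_kernel c \<epsilon>"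

definition e :: "'a \<Rightarrow> 'h" where "e y = inv ev (\<lambda>x. k x y)"

text \<open>The kernel mean embedding of the measure with density \<open>g\<close> with respect to
  \<open>\<nu>\<close>: pairing with it is integration against that measure
  (\<open>Phi_inner\<close>). Increments of measures thereby become vectors of one fixed Hilbert
  space.\<close>

definition Phi :: "'a measure \<Rightarrow> ('a \<Rightarrow> real) \<Rightarrow> 'h" where
  "Phi \<nu> g = (\<integral>x. g x *\<^sub>R e x \<partial>\<nu>)"

lemma k_sym: "k x y = k y x" by (simp add: gibbs_kernel_def cost_sym)
lemma k_le_1: "k x y \<le> 1" using cost_nonneg[of x y] eps_pos by (simp add: gibbs_kernel_def)
lemma delta_le_1: "\<delta> \<le> 1" using delta_le k_le_1 order_trans by blast

lemma ev_inner: "ev h y = h \<bullet> e y"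
  using rkhs unfolding is_rkhs_def e_def by blast

lemma ev_e: "ev (e y) x = k x y"
proof -
  have "(\<lambda>x. k x y) \<in> range ev" using rkhs unfolding is_rkhs_def by blast
  then have "ev (e y) = (\<lambda>x. k x y)" unfolding e_def by (rule f_inv_into_f)
  then show ?thesis by simp
qed

lemma e_inner: "e x \<bullet> e y = k x y"
  using ev_inner[of "e x" y] ev_e[of x y] k_sym[of x y] by simp

lemma ev_simps [simp]:
  "ev (h + h') x = ev h x + ev h' x" "ev (h - h') x = ev h x - ev h' x"
  "ev (r *\<^sub>R h) x = r * ev h x" "ev 0 x = 0" "ev (- h) x = - ev h x"
  by (simp_all add: ev_inner inner_add_left inner_diff_left)

lemma norm_e: "norm (e y) \<le> 1"
  using k_le_1[of y y] by (simp add: norm_eq_sqrt_inner e_inner)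

lemma ev_bound: "\<bar>ev h x\<bar> \<le> norm h"
proof -
  have "\<bar>ev h x\<bar> \<le> norm h * norm (e x)" using Cauchy_Schwarz_ineq2[of h "e x"] by (simp only: ev_inner)
  also have "\<dots> \<le> norm h * 1" by (rule mult_left_mono[OF norm_e norm_ge_zero])
  finally show ?thesis by simp
qed

lemma k_continuous: "continuous_on UNIV (\<lambda>p. k (fst p) (snd p))"
  using cost_continuous unfolding gibbs_kernel_def case_prod_beta
  by (intro continuous_intros) (use eps_pos in auto)

text \<open>The squared distance of two representers is k y y - 2 k y x + k x x, a continuous
  function of y that vanishes at x.\<close>

lemma e_continuous: "continuous_on UNIV e"
proof (intro continuous_at_imp_continuous_on ballI)
  fix x
  define q where "q y = k y y - 2 * k y x + k x x" for y
  have kc: "continuous_on UNIV (\<lambda>y. k (f y) (g y))" if "continuous_on UNIV f" "continuous_on UNIV g" for f g :: "'a \<Rightarrow> 'a"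
    using continuous_on_compose2[OF k_continuous continuous_on_Pair[OF that]] by simp
  have "continuous_on UNIV q"
    unfolding q_def by (intro continuous_intros kc)
  then have "isCont q x" by (simp add: continuous_on_eq_continuous_at)
  moreover have "q x = 0" by (simp add: q_def)
  ultimately have q0: "((\<lambda>y. sqrt (q y)) \<longlongrightarrow> 0) (at x)"
    using tendsto_real_sqrt[of q 0 "at x"] by (simp add: isCont_def)
  have "dist (e y) (e x) = sqrt (q y)" for y
    by (simp add: dist_norm norm_eq_sqrt_inner inner_diff_left inner_diff_right e_inner q_def k_sym[of x y])
  with q0 have "((\<lambda>y. dist (e y) (e x)) \<longlongrightarrow> 0) (at x)" by simp
  then show "isCont e x" unfolding isCont_def by (rule tendsto_dist_iff[THEN iffD2])
qed

lemma ev_continuous: "continuous_on UNIV (ev h)"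
proof -
  have "ev h = (\<lambda>y. h \<bullet> e y)" by (rule ext) (rule ev_inner)
  moreover have "continuous_on UNIV (\<lambda>y. h \<bullet> e y)" by (intro continuous_intros e_continuous)
  ultimately show ?thesis by simp
qed

lemma prob_measuresD: "\<nu> \<in> prob_measures \<Longrightarrow> prob_space \<nu>" "\<nu> \<in> prob_measures \<Longrightarrow> sets \<nu> = sets borel"
  "\<nu> \<in> prob_measures \<Longrightarrow> space \<nu> = (UNIV :: 'a set)"
  by (auto simp: prob_measures_def dest: sets_eq_imp_space_eq)

lemma measurable_continuous:
  fixes g :: "'a \<Rightarrow> 'z::topological_space"
  assumes "\<nu> \<in> prob_measures" "continuous_on UNIV g"
  shows "g \<in> borel_measurable \<nu>"
  using borel_measurable_continuous_onI[OF assms(2)] prob_measuresD(2)[OF assms(1)]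
  by (simp cong: measurable_cong_sets)

lemma continuous_bounded:
  fixes g :: "'a \<Rightarrow> 'z::real_normed_vector"
  assumes "continuous_on UNIV g"
  obtains C where "\<And>x. norm (g x) \<le> C"
  using compact_imp_bounded[OF compact_continuous_image[OF assms compact_space]]
  by (auto simp: bounded_iff)

lemma integrable_continuous_prob:
  fixes g :: "'a \<Rightarrow> 'z::{banach,second_countable_topology}"
  assumes "\<nu> \<in> prob_measures" "continuous_on UNIV g"
  shows "integrable \<nu> g"
proof -
  obtain C where "\<And>x. norm (g x) \<le> C" using continuous_bounded[OF assms(2)] by blast
  then show ?thesis
    using prob_measuresD(1)[OF assms(1)] measurable_continuous[OF assms]
    by (intro finite_measure.integrable_const_bound[where B = C]) (auto simp: prob_space_def)
qed

lemma prob_measure_1: "(\<nu> :: 'a measure) \<in> prob_measures \<Longrightarrow> (\<integral>x. (r::'z::{banach,second_countable_topology}) \<partial>\<nu>) = r"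
  by (drule prob_measuresD(1)) (simp add: prob_space.prob_space)

lemma Phi_integrable:
  assumes "\<nu> \<in> prob_measures" "integrable \<nu> g"
  shows "integrable \<nu> (\<lambda>x. g x *\<^sub>R e x)"
proof (rule Bochner_Integration.integrable_bound[OF assms(2)])
  show "(\<lambda>x. g x *\<^sub>R e x) \<in> borel_measurable \<nu>"
    using assms(2) measurable_continuous[OF assms(1) e_continuous] by auto
  show "AE x in \<nu>. norm (g x *\<^sub>R e x) \<le> norm (g x)"
    using norm_e by (auto intro!: AE_I2 mult_left_le)
qed

lemma Phi_inner:
  assumes "\<nu> \<in> prob_measures" "integrable \<nu> g"
  shows "Phi \<nu> g \<bullet> h = (\<integral>x. g x * ev h x \<partial>\<nu>)"
proof -
  have "(\<integral>x. g x * ev h x \<partial>\<nu>) = (\<integral>x. (g x *\<^sub>R e x) \<bullet> h \<partial>\<nu>)"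
    by (simp add: ev_inner inner_commute)
  also have "\<dots> = Phi \<nu> g \<bullet> h"
    unfolding Phi_def using Phi_integrable[OF assms] by (intro integral_inner_left) auto
  finally show ?thesis by simp
qed

lemma ev_Phi:
  assumes "\<nu> \<in> prob_measures" "integrable \<nu> g"
  shows "ev (Phi \<nu> g) y = (\<integral>x. g x * k x y \<partial>\<nu>)"
proof -
  have "ev (Phi \<nu> g) y = Phi \<nu> g \<bullet> e y" by (rule ev_inner)
  also have "\<dots> = (\<integral>x. g x * ev (e y) x \<partial>\<nu>)" by (rule Phi_inner[OF assms])
  finally show ?thesis by (simp only: ev_e)
qed

lemma Phi_diff:
  assumes "\<nu> \<in> prob_measures" "integrable \<nu> f" "integrable \<nu> g"
  shows "Phi \<nu> (\<lambda>x. f x - g x) = Phi \<nu> f - Phi \<nu> g"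
  unfolding Phi_def scaleR_diff_left
  by (rule Bochner_Integration.integral_diff[OF Phi_integrable[OF assms(1,2)] Phi_integrable[OF assms(1,3)]])

lemma Phi_scale: "Phi \<nu> (\<lambda>x. r * f x) = r *\<^sub>R Phi \<nu> f"
  unfolding Phi_def scaleR_scaleR[symmetric] by (rule integral_scaleR_right)

lemma Phi_norm_le:
  assumes \<nu>: "\<nu> \<in> prob_measures" and g: "continuous_on UNIV g" and C: "\<And>x. \<bar>g x\<bar> \<le> C"
  shows "norm (Phi \<nu> g) \<le> C"
proof -
  have i: "integrable \<nu> (\<lambda>x. norm (g x *\<^sub>R e x))"
    by (intro integrable_norm Phi_integrable[OF \<nu>] integrable_continuous_prob \<nu> g)
  have "norm (Phi \<nu> g) \<le> (\<integral>x. norm (g x *\<^sub>R e x) \<partial>\<nu>)" unfolding Phi_def by (rule integral_norm_bound)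
  also have "\<dots> \<le> (\<integral>x. C \<partial>\<nu>)"
  proof (rule Bochner_Integration.integral_mono[OF i])
    show "integrable \<nu> (\<lambda>x. C)" by (intro integrable_continuous_prob \<nu> continuous_intros)
    show "norm (g x *\<^sub>R e x) \<le> C" for x
      using mult_mono[OF C[of x] norm_e[of x]] C[of x] by simp
  qed
  also have "\<dots> = C" by (rule prob_measure_1[OF \<nu>])
  finally show ?thesis .
qed

text \<open>The two bounds become the Lipschitz property and the monotonicity on which the
  contraction in \<open>scaling_fixed_point\<close> rests.\<close>

lemma inverse_max_diff:
  assumes "(0::real) < m"
  shows "\<bar>1 / max a m - 1 / max b m\<bar> \<le> \<bar>a - b\<bar> / m\<^sup>2"
    and "(1 / max a m - 1 / max b m) * (a - b) \<le> 0"
proof -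
  have p: "max a m > 0" "max b m > 0" using assms by auto
  have eq: "1 / max a m - 1 / max b m = (max b m - max a m) / (max a m * max b m)"
    using p by (simp add: divide_simps)
  have "m * m \<le> max a m * max b m" using assms by (intro mult_mono) auto
  then have "\<bar>max b m - max a m\<bar> / (max a m * max b m) \<le> \<bar>a - b\<bar> / (m * m)"
    using assms by (intro frac_le) auto
  then show "\<bar>1 / max a m - 1 / max b m\<bar> \<le> \<bar>a - b\<bar> / m\<^sup>2"
    unfolding eq using p by (simp add: abs_divide power2_eq_square abs_mult)
  have "(max b m - max a m) * (a - b) \<le> 0"
    by (cases "a \<le> b") (auto simp: mult_le_0_iff)
  then show "(1 / max a m - 1 / max b m) * (a - b) \<le> 0"
    unfolding eq times_divide_eq_left using mult_pos_pos[OF p] by (rule divide_nonpos_pos)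
qed

text \<open>The map \<open>h \<mapsto> (1 - \<tau>) h + \<tau> G h\<close> is a contraction, \<open>-G\<close> being monotone and Lipschitz. The truncation at \<open>\<delta>\<close>
  makes \<open>G\<close> globally defined and is inactive at the fixed point.\<close>
lemma scaling_fixed_point:
  assumes \<mu>: "\<mu> \<in> prob_measures"
  obtains b where "\<And>x. \<delta> \<le> ev b x" "b = Phi \<mu> (\<lambda>x. 1 / ev b x)"
proof -
  define g where "g h x = 1 / max (ev h x) \<delta>" for h x
  define G where "G h = Phi \<mu> (g h)" for h
  have mpos: "max r \<delta> > 0" for r using delta_pos by simp
  have gc: "continuous_on UNIV (g h)" for h
    unfolding g_def using mpos by (intro continuous_intros ev_continuous) (auto simp: less_imp_neq[symmetric])
  have gi: "integrable \<mu> (g h)" for h by (rule integrable_continuous_prob[OF \<mu> gc])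
  have evi: "integrable \<mu> (\<lambda>x. f x * ev h x)" if "continuous_on UNIV f" for f h
    by (intro integrable_continuous_prob[OF \<mu>] continuous_intros that ev_continuous)
  define L where "L = 1 / \<delta>\<^sup>2"
  have L: "L > 0" using delta_pos by (simp add: L_def)
  have lip: "norm (G h - G h') \<le> L * norm (h - h')" for h h'
  proof -
    have "G h - G h' = Phi \<mu> (\<lambda>x. g h x - g h' x)"
      unfolding G_def by (rule Phi_diff[OF \<mu> gi gi, symmetric])
    also have "norm \<dots> \<le> L * norm (h - h')"
    proof (rule Phi_norm_le[OF \<mu>])
      fix x
      have "\<bar>g h x - g h' x\<bar> \<le> \<bar>ev h x - ev h' x\<bar> / \<delta>\<^sup>2"
        unfolding g_def by (rule inverse_max_diff[OF delta_pos])
      also have "\<dots> \<le> norm (h - h') / \<delta>\<^sup>2"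
        using ev_bound[of "h - h'" x] by (intro divide_right_mono) auto
      finally show "\<bar>g h x - g h' x\<bar> \<le> L * norm (h - h')" by (simp add: L_def)
    qed (intro continuous_intros gc)
    finally show ?thesis .
  qed
  have mono: "(G h - G h') \<bullet> (h - h') \<le> 0" for h h'
  proof -
    have "(G h - G h') \<bullet> (h - h') = (\<integral>x. (g h x - g h' x) * ev (h - h') x \<partial>\<mu>)"
      unfolding G_def Phi_diff[OF \<mu> gi gi, symmetric]
      by (rule Phi_inner[OF \<mu>]) (intro Bochner_Integration.integrable_diff gi)
    also have "\<dots> \<le> (\<integral>x. 0 \<partial>\<mu>)"
    proof (rule Bochner_Integration.integral_mono)
      show "(g h x - g h' x) * ev (h - h') x \<le> 0" for x
        unfolding g_def ev_simps by (rule inverse_max_diff[OF delta_pos])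
      show "integrable \<mu> (\<lambda>x. (g h x - g h' x) * ev (h - h') x)" by (intro evi continuous_intros gc)
    qed simp
    finally show ?thesis by simp
  qed
  \<comment> \<open>The minimizer of (1 - \<tau>)^2 + \<tau>^2 L^2; the minimum is 1 - \<tau>, the
    square of the contraction factor.\<close>
  define \<tau> where "\<tau> = 1 / (1 + L\<^sup>2)"
  have \<tau>: "0 < \<tau>" "\<tau> < 1" "\<tau> * (1 + L\<^sup>2) = 1"
    using L by (auto simp: \<tau>_def add_pos_pos add_nonneg_eq_0_iff)
  define T where "T h = (1 - \<tau>) *\<^sub>R h + \<tau> *\<^sub>R G h" for h
  have T_contr: "dist (T h) (T h') \<le> sqrt (1 - \<tau>) * dist h h'" for h h'
  proof -
    let ?d = "h - h'" and ?D = "G h - G h'"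
    have "T h - T h' = (1 - \<tau>) *\<^sub>R ?d + \<tau> *\<^sub>R ?D" by (simp add: T_def algebra_simps)
    then have "(norm (T h - T h'))\<^sup>2 = (1 - \<tau>)\<^sup>2 * (norm ?d)\<^sup>2 + 2 * (\<tau> * (1 - \<tau>)) * (?D \<bullet> ?d) + \<tau>\<^sup>2 * (norm ?D)\<^sup>2"
      by (simp only: power2_norm_eq_inner inner_add_left inner_add_right inner_scaleR_left inner_scaleR_right inner_commute[of ?d ?D])
        (simp add: power2_eq_square algebra_simps)
    also have "\<dots> \<le> (1 - \<tau>)\<^sup>2 * (norm ?d)\<^sup>2 + 0 + \<tau>\<^sup>2 * (L * norm ?d)\<^sup>2"
      using mono[of h h'] \<tau> lip[of h h'] by (intro add_mono mult_left_mono power_mono order_refl) (auto simp: mult_nonneg_nonpos)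
    also have "\<dots> = (1 - \<tau>) * (norm ?d)\<^sup>2"
    proof -
      have "(1 - \<tau>)\<^sup>2 + \<tau>\<^sup>2 * L\<^sup>2 = 1 - 2 * \<tau> + \<tau> * (\<tau> * (1 + L\<^sup>2))" by (simp add: power2_eq_square algebra_simps)
      then have "(1 - \<tau>)\<^sup>2 + \<tau>\<^sup>2 * L\<^sup>2 = 1 - \<tau>" using \<tau>(3) by simp
      then show ?thesis by (simp add: power_mult_distrib mult.assoc[symmetric] distrib_right[symmetric])
    qed
    finally have "norm (T h - T h') \<le> sqrt ((1 - \<tau>) * (norm ?d)\<^sup>2)" by (rule real_le_rsqrt)
    then show ?thesis by (simp add: dist_norm real_sqrt_mult)
  qed
  have "\<exists>!b. T b = b"
    by (rule banach_fix_type[of "sqrt (1 - \<tau>)"]) (use \<tau> T_contr in auto)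
  then obtain b where "T b = b" by blast
  then have "\<tau> *\<^sub>R (G b - b) = 0" by (simp add: T_def algebra_simps)
  then have b: "b = G b" using \<tau> by simp
  have evb: "ev b y = (\<integral>x. g b x * k x y \<partial>\<mu>)" for y
    by (subst b) (simp only: G_def ev_Phi[OF \<mu> gi])
  have g0: "0 < g b x" for x using mpos by (simp add: g_def)
  \<comment> \<open>The truncation is shown to be inactive: the norm of \<open>b\<close> is at most
    1, hence so are its values, hence \<open>g b\<close> is at least 1, and integrating the kernel
    against \<open>g b\<close> gives at least \<delta>.\<close>
  have "b \<bullet> b = (\<integral>x. g b x * ev b x \<partial>\<mu>)"
    by (subst (1) b) (simp only: G_def Phi_inner[OF \<mu> gi])
  also have "\<dots> \<le> (\<integral>x. 1 \<partial>\<mu>)"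
  proof (rule Bochner_Integration.integral_mono)
    show "g b x * ev b x \<le> 1" for x using mpos[of "ev b x"] by (simp add: g_def)
    show "integrable \<mu> (\<lambda>x. 1::real)" by (intro integrable_continuous_prob \<mu> continuous_intros)
  qed (intro evi gc)
  also have "\<dots> = 1" by (rule prob_measure_1[OF \<mu>])
  finally have "norm b \<le> 1" by (simp add: norm_eq_sqrt_inner)
  then have le1: "ev b x \<le> 1" for x using ev_bound[of b x] by linarith
  have ge: "\<delta> \<le> ev b y" for y
  proof -
    have "\<delta> = (\<integral>x. \<delta> \<partial>\<mu>)" by (rule prob_measure_1[OF \<mu>, symmetric])
    also have "\<dots> \<le> (\<integral>x. g b x * k x y \<partial>\<mu>)"
    proof (rule Bochner_Integration.integral_mono)
      show "integrable \<mu> (\<lambda>x. \<delta>)" by (intro integrable_continuous_prob \<mu> continuous_intros)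
      show "integrable \<mu> (\<lambda>x. g b x * k x y)"
        unfolding ev_e[symmetric] by (intro evi gc)
      fix x
      have "max (ev b x) \<delta> \<le> 1" using le1[of x] delta_le_1 by simp
      with mpos[of "ev b x"] have "1 \<le> g b x" unfolding g_def by (subst le_divide_eq_1_pos)
      then have "1 * \<delta> \<le> g b x * k x y" using delta_le[of x y] delta_pos by (intro mult_mono) auto
      then show "\<delta> \<le> g b x * k x y" by simp
    qed
    finally show ?thesis by (simp only: evb)
  qed
  have "g b = (\<lambda>x. 1 / ev b x)"
  proof
    show "g b x = 1 / ev b x" for x using ge[of x] by (simp add: g_def max_absorb1)
  qed
  then show ?thesis using that[of b] ge b by (simp add: G_def)
qed

end

section \<open>The scaling and the potential expressed through \<open>B\<close>\<close>

context gibbs_rkhs begin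

lemma Bcontfun_continuous:
  fixes g :: "'a \<Rightarrow> real"
  assumes "continuous_on UNIV g"
  shows "apply_bcontfun (Bcontfun g) = g"
proof (rule Bcontfun_inverse)
  show "g \<in> bcontfun"
    using assms compact_imp_bounded[OF compact_continuous_image[OF assms compact_space]]
    by (simp add: bcontfun_def)
qed

abbreviation B :: "'a measure \<Rightarrow> 'h" where "B \<equiv> B_embedding c \<epsilon> ev"
abbreviation a :: "'a measure \<Rightarrow> 'a \<Rightarrow> real" where "a \<equiv> scaling c \<epsilon>"

lemma B_eq_Phi: "B \<mu> = Phi \<mu> (a \<mu>)"
proof -
  have "inv ev (\<lambda>y. k x y) = e x" for x
    unfolding e_def by (rule arg_cong[where f = "inv ev"]) (rule ext, rule k_sym)
  then show ?thesis unfolding B_embedding_def Phi_def by simp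
qed

lemma potential_kernel:
  "exp (1 / \<epsilon> * (f x + f y - c x y)) = exp (f x / \<epsilon>) * exp (f y / \<epsilon>) * k x y"
  unfolding gibbs_kernel_def exp_add[symmetric] by (rule arg_cong[where f = exp]) (use eps_pos in \<open>simp add: field_simps\<close>)

text \<open>The factor exp (f y / \<epsilon>) comes out of the integral, and what remains is the
  embedding evaluated at \<open>y\<close>: the potential equation becomes a fixed point equation in
  the RKHS.\<close>

lemma potential_equation_iff:
  assumes \<mu>: "\<mu> \<in> prob_measures" and f: "continuous_on UNIV f"
  shows "(\<integral>x. exp (1 / \<epsilon> * (f x + f y - c x y)) \<partial>\<mu>) = 1 \<longleftrightarrow>
     ev (Phi \<mu> (\<lambda>x. exp (f x / \<epsilon>))) y = 1 / exp (f y / \<epsilon>)"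
proof -
  have fc: "continuous_on UNIV (\<lambda>x. exp (f x / \<epsilon>))" using eps_pos by (intro continuous_intros f) auto
  have "(\<integral>x. exp (1 / \<epsilon> * (f x + f y - c x y)) \<partial>\<mu>) = (\<integral>x. exp (f y / \<epsilon>) * (exp (f x / \<epsilon>) * k x y) \<partial>\<mu>)"
    unfolding potential_kernel by (simp only: mult.commute mult.left_commute)
  also have "\<dots> = exp (f y / \<epsilon>) * ev (Phi \<mu> (\<lambda>x. exp (f x / \<epsilon>))) y"
    by (simp add: ev_Phi[OF \<mu> integrable_continuous_prob[OF \<mu> fc]])
  finally show ?thesis by (simp add: field_simps)
qed

lemma reciprocal_diff_nonpos:
  assumes "(r::real) > 0" "s > 0"
  shows "(r - s) * (1 / r - 1 / s) \<le> 0"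
proof -
  have "(r - s) * (1 / r - 1 / s) = - ((r - s)\<^sup>2 / (r * s))"
    using assms by (simp add: field_simps power2_eq_square)
  also have "\<dots> \<le> 0" using assms by simp
  finally show ?thesis .
qed

text \<open>The squared distance of the two embeddings is an integral of (r - s)(1/r - 1/s) \<le> 0.
  Equal embeddings give equal potentials everywhere, not only on the support of the measure, because
  the equation holds at every point.\<close>

lemma potential_unique:
  assumes \<mu>: "\<mu> \<in> prob_measures" and f: "continuous_on UNIV f" "continuous_on UNIV g"
    and eq: "\<And>y. (\<integral>x. exp (1 / \<epsilon> * (f x + f y - c x y)) \<partial>\<mu>) = 1"
      "\<And>y. (\<integral>x. exp (1 / \<epsilon> * (g x + g y - c x y)) \<partial>\<mu>) = 1"
  shows "f = g"
proof -
  let ?f = "\<lambda>x. exp (f x / \<epsilon>)" and ?g = "\<lambda>x. exp (g x / \<epsilon>)"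
  have c: "continuous_on UNIV ?f" "continuous_on UNIV ?g" using eps_pos by (auto intro!: continuous_intros f)
  note i = integrable_continuous_prob[OF \<mu> c(1)] integrable_continuous_prob[OF \<mu> c(2)]
  have evf: "ev (Phi \<mu> ?f) y = 1 / ?f y" "ev (Phi \<mu> ?g) y = 1 / ?g y" for y
    using eq potential_equation_iff[OF \<mu>] f by auto
  let ?d = "Phi \<mu> ?f - Phi \<mu> ?g"
  have "?d \<bullet> ?d = (\<integral>x. (?f x - ?g x) * ev ?d x \<partial>\<mu>)"
    by (subst (1) Phi_diff[OF \<mu> i, symmetric]) (rule Phi_inner[OF \<mu> Bochner_Integration.integrable_diff[OF i]])
  also have "\<dots> \<le> (\<integral>x. 0 \<partial>\<mu>)"
  proof (rule Bochner_Integration.integral_mono)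
    show "integrable \<mu> (\<lambda>x. (?f x - ?g x) * ev ?d x)"
      by (intro integrable_continuous_prob[OF \<mu>] continuous_intros c ev_continuous)
    show "(?f x - ?g x) * ev ?d x \<le> 0" for x
      unfolding ev_simps evf by (rule reciprocal_diff_nonpos) auto
  qed simp
  finally have "?d = 0" using inner_gt_zero_iff[of ?d] by fastforce
  then have "Phi \<mu> ?f = Phi \<mu> ?g" by simp
  then have "ev (Phi \<mu> ?f) y = ev (Phi \<mu> ?g) y" for y by (simp only:)
  then have "1 / ?f y = 1 / ?g y" for y unfolding evf .
  then have "f y / \<epsilon> = g y / \<epsilon>" for y by simp
  then show "f = g" using eps_pos by auto
qed

text \<open>The fixed point yields a potential, and uniqueness identifies it with the one selected
  by \<open>THE\<close>. From here on potentials and scalings are handled through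
  \<open>B\<close>.\<close>

lemma
  assumes \<mu>: "\<mu> \<in> prob_measures"
  shows a_eq: "a \<mu> x = 1 / ev (B \<mu>) x"
    and B_ge: "\<delta> \<le> ev (B \<mu>) x"
    and potential_eq: "apply_bcontfun (self_potential c \<epsilon> \<mu>) x = - \<epsilon> * ln (ev (B \<mu>) x)"
proof -
  obtain b where b: "\<And>x. \<delta> \<le> ev b x" "b = Phi \<mu> (\<lambda>x. 1 / ev b x)" using scaling_fixed_point[OF \<mu>] by metis
  have bpos: "ev b x > 0" for x using b(1)[of x] delta_pos by linarith
  define f where "f x = - \<epsilon> * ln (ev b x)" for x
  have fc: "continuous_on UNIV f" unfolding f_def using bpos
    by (intro continuous_intros ev_continuous) (auto simp: less_imp_neq[symmetric])
  have expf: "exp (f x / \<epsilon>) = 1 / ev b x" for x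
    using eps_pos bpos[of x] by (simp add: f_def exp_minus inverse_eq_divide)
  have f_eq: "(\<integral>x. exp (1 / \<epsilon> * (f x + f y - c x y)) \<partial>\<mu>) = 1" for y
    unfolding potential_equation_iff[OF \<mu> fc] expf b(2)[symmetric] by simp
  have "self_potential c \<epsilon> \<mu> = Bcontfun f"
    unfolding self_potential_def
  proof (rule the_equality)
    show "\<forall>y. (\<integral>x. exp (1 / \<epsilon> * (apply_bcontfun (Bcontfun f) x + apply_bcontfun (Bcontfun f) y - c x y)) \<partial>\<mu>) = 1"
      unfolding Bcontfun_continuous[OF fc] using f_eq by blast
    fix g :: "'a \<Rightarrow>\<^sub>C real"
    assume "\<forall>y. (\<integral>x. exp (1 / \<epsilon> * (apply_bcontfun g x + apply_bcontfun g y - c x y)) \<partial>\<mu>) = 1"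
    then have "apply_bcontfun g = f"
      using f_eq by (intro potential_unique[OF \<mu> _ fc]) auto
    then show "g = Bcontfun f" by (metis apply_bcontfun_inverse)
  qed
  then have pot: "apply_bcontfun (self_potential c \<epsilon> \<mu>) = f" by (simp add: Bcontfun_continuous[OF fc])
  have "a \<mu> = (\<lambda>x. 1 / ev b x)" unfolding scaling_def pot expf ..
  then have "B \<mu> = b" unfolding B_eq_Phi using b(2) by simp
  then show "a \<mu> x = 1 / ev (B \<mu>) x" "\<delta> \<le> ev (B \<mu>) x" "apply_bcontfun (self_potential c \<epsilon> \<mu>) x = - \<epsilon> * ln (ev (B \<mu>) x)"
    using \<open>a \<mu> = _\<close> b(1) pot by (auto simp: f_def)
qed

context
  fixes \<mu> :: "'a measure" assumes \<mu>: "\<mu> \<in> prob_measures"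
begin

lemma B_pos: "0 < ev (B \<mu>) x" using B_ge[OF \<mu>, of x] delta_pos by linarith

lemma a_pos: "0 < a \<mu> x" by (simp add: scaling_def)

lemma ev_B: "ev (B \<mu>) x = 1 / a \<mu> x" using B_pos[of x] by (simp add: a_eq[OF \<mu>])

lemma a_continuous: "continuous_on UNIV (a \<mu>)"
proof -
  have "continuous_on UNIV (\<lambda>x. 1 / ev (B \<mu>) x)"
    using B_pos by (intro continuous_intros ev_continuous) (auto simp: less_imp_neq[symmetric])
  moreover have "a \<mu> = (\<lambda>x. 1 / ev (B \<mu>) x)" by (rule ext) (rule a_eq[OF \<mu>])
  ultimately show ?thesis by simp
qed

lemma a_integrable: "integrable \<mu> (a \<mu>)" by (rule integrable_continuous_prob[OF \<mu> a_continuous])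

text \<open>Pairing \<open>B \<mu>\<close> with itself integrates the scaling against its own
  reciprocal. So \<open>B\<close> takes values in the unit sphere, the source of the tangency
  condition.\<close>

lemma norm_B: "norm (B \<mu>) = 1"
proof -
  have "B \<mu> \<bullet> B \<mu> = (\<integral>x. a \<mu> x * ev (B \<mu>) x \<partial>\<mu>)"
    by (subst (1) B_eq_Phi) (rule Phi_inner[OF \<mu> a_integrable])
  also have "\<dots> = (\<integral>x. 1 \<partial>\<mu>)" using a_pos by (simp add: ev_B less_imp_neq[symmetric])
  also have "\<dots> = 1" by (rule prob_measure_1[OF \<mu>])
  finally show ?thesis by (simp add: norm_eq_sqrt_inner)
qed

lemma B_le_1: "ev (B \<mu>) x \<le> 1" using ev_bound[of "B \<mu>" x] norm_B by simp

lemma a_ge_1: "1 \<le> a \<mu> x" using B_le_1[of x] B_pos[of x] by (simp add: a_eq[OF \<mu>])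

lemma a_le: "a \<mu> x \<le> 1 / \<delta>"
  unfolding a_eq[OF \<mu>] using B_ge[OF \<mu>, of x] delta_pos by (intro divide_left_mono) auto

end

text \<open>When the difference of the two fixed point equations is tested with
  \<open>B \<nu> - B \<mu>\<close>, the term with the difference of the scalings is nonpositive, as
  the reciprocal is decreasing; Cauchy-Schwarz bounds the other one.\<close>

lemma B_diff_le:
  assumes \<mu>: "\<mu> \<in> prob_measures" and \<nu>: "\<nu> \<in> prob_measures"
  shows "norm (B \<nu> - B \<mu>) \<le> norm (Phi \<nu> (a \<mu>) - Phi \<mu> (a \<mu>))"
proof -
  let ?d = "B \<nu> - B \<mu>"
  have i: "integrable \<nu> (a \<nu>)" "integrable \<nu> (a \<mu>)"
    using a_continuous \<mu> \<nu> integrable_continuous_prob by auto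
  have "?d = Phi \<nu> (\<lambda>x. a \<nu> x - a \<mu> x) + (Phi \<nu> (a \<mu>) - Phi \<mu> (a \<mu>))"
    unfolding Phi_diff[OF \<nu> i] B_eq_Phi[of \<nu>] B_eq_Phi[of \<mu>] by simp
  from arg_cong[OF this, of "\<lambda>z. z \<bullet> ?d"]
  have "?d \<bullet> ?d = Phi \<nu> (\<lambda>x. a \<nu> x - a \<mu> x) \<bullet> ?d + (Phi \<nu> (a \<mu>) - Phi \<mu> (a \<mu>)) \<bullet> ?d"
    by (simp only: inner_add_left)
  also have "Phi \<nu> (\<lambda>x. a \<nu> x - a \<mu> x) \<bullet> ?d = (\<integral>x. (a \<nu> x - a \<mu> x) * ev ?d x \<partial>\<nu>)"
    by (rule Phi_inner[OF \<nu> Bochner_Integration.integrable_diff[OF i]])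
  also have "\<dots> \<le> (\<integral>x. 0 \<partial>\<nu>)"
  proof (rule Bochner_Integration.integral_mono)
    show "integrable \<nu> (\<lambda>x. (a \<nu> x - a \<mu> x) * ev ?d x)"
      by (intro integrable_continuous_prob[OF \<nu>] continuous_intros a_continuous \<mu> \<nu> ev_continuous)
    show "(a \<nu> x - a \<mu> x) * ev ?d x \<le> 0" for x
      unfolding ev_simps ev_B[OF \<mu>] ev_B[OF \<nu>] by (rule reciprocal_diff_nonpos) (simp_all add: a_pos \<mu> \<nu>)
  qed simp
  finally have "?d \<bullet> ?d \<le> (Phi \<nu> (a \<mu>) - Phi \<mu> (a \<mu>)) \<bullet> ?d" by simp
  also have "\<dots> \<le> norm (Phi \<nu> (a \<mu>) - Phi \<mu> (a \<mu>)) * norm ?d" by (rule norm_cauchy_schwarz)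
  finally have "norm ?d * norm ?d \<le> norm (Phi \<nu> (a \<mu>) - Phi \<mu> (a \<mu>)) * norm ?d"
    by (simp add: power2_eq_square flip: power2_norm_eq_inner)
  then show ?thesis by (cases "norm ?d = 0") (auto simp: mult_le_cancel_right)
qed

end

section \<open>The metric tensor\<close>

context gibbs_rkhs begin

context
  fixes \<mu> :: "'a measure" assumes \<mu>: "\<mu> \<in> prob_measures"
begin

lemma integrable_mult_continuous:
  assumes f: "integrable \<mu> f" and g: "continuous_on UNIV (g :: 'a \<Rightarrow> real)"
  shows "integrable \<mu> (\<lambda>x. g x * f x)" "integrable \<mu> (\<lambda>x. f x * g x)"
proof -
  obtain C where C: "\<And>x. norm (g x) \<le> C" using continuous_bounded[OF g] by blast
  show *: "integrable \<mu> (\<lambda>x. g x * f x)"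
  proof (rule Bochner_Integration.integrable_bound)
    show "integrable \<mu> (\<lambda>x. C * f x)" using f by simp
    show "(\<lambda>x. g x * f x) \<in> borel_measurable \<mu>"
      using measurable_continuous[OF \<mu> g] f by auto
    show "AE x in \<mu>. norm (g x * f x) \<le> norm (C * f x)"
    proof (rule AE_I2)
      fix x
      have "\<bar>g x\<bar> \<le> \<bar>C\<bar>" using C[of x] by simp
      then show "norm (g x * f x) \<le> norm (C * f x)" by (simp add: abs_mult mult_right_mono)
    qed
  qed
  then show "integrable \<mu> (\<lambda>x. f x * g x)" by (simp only: mult.commute)
qed

lemma a_mult_integrable: "integrable \<mu> f \<Longrightarrow> integrable \<mu> (\<lambda>x. a \<mu> x * f x)"
  by (rule integrable_mult_continuous(1)[OF _ a_continuous[OF \<mu>]])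

section \<open>The Markov operator of the self-kernel\<close>

definition K :: "('a \<Rightarrow> real) \<Rightarrow> 'a \<Rightarrow> real" where
  "K = kernel_op (self_kernel c \<epsilon> \<mu>) \<mu>"

lemma K_eq:
  assumes f: "integrable \<mu> f"
  shows "K f y = a \<mu> y * ev (Phi \<mu> (\<lambda>x. a \<mu> x * f x)) y"
proof -
  have "K f y = (\<integral>x. a \<mu> y * ((a \<mu> x * f x) * k x y) \<partial>\<mu>)"
    unfolding K_def kernel_op_def self_kernel_def
    by (intro Bochner_Integration.integral_cong refl) (simp only: mult_ac)
  also have "\<dots> = a \<mu> y * (\<integral>x. (a \<mu> x * f x) * k x y \<partial>\<mu>)" by (rule integral_mult_right_zero)
  finally show ?thesis by (simp only: ev_Phi[OF \<mu> a_mult_integrable[OF f]])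
qed

lemma K_continuous:
  assumes f: "integrable \<mu> f"
  shows "continuous_on UNIV (K f)"
proof -
  have "K f = (\<lambda>y. a \<mu> y * ev (Phi \<mu> (\<lambda>x. a \<mu> x * f x)) y)" by (rule ext) (rule K_eq[OF f])
  moreover have "continuous_on UNIV (\<lambda>y. a \<mu> y * ev (Phi \<mu> (\<lambda>x. a \<mu> x * f x)) y)"
    by (intro continuous_intros a_continuous[OF \<mu>] ev_continuous)
  ultimately show ?thesis by simp
qed

text \<open>The kernel factors through the representers, so the bilinear form of \<open>K\<close> is
  an inner product of embeddings, hence symmetric and positive.\<close>

lemma K_integral:
  assumes f: "integrable \<mu> f" and g: "integrable \<mu> g"
  shows "(\<integral>y. g y * K f y \<partial>\<mu>) = Phi \<mu> (\<lambda>x. a \<mu> x * g x) \<bullet> Phi \<mu> (\<lambda>x. a \<mu> x * f x)"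
  unfolding Phi_inner[OF \<mu> a_mult_integrable[OF g]] K_eq[OF f]
  by (intro Bochner_Integration.integral_cong refl) (simp only: mult_ac)

lemma const_integrable: "integrable \<mu> (\<lambda>x. r::real)"
  by (rule integrable_continuous_prob[OF \<mu> continuous_on_const])

text \<open>Testing \<open>K f\<close> with 1 produces the embedding \<open>B \<mu>\<close>, whose
  values cancel the scaling: the measure is invariant under \<open>K\<close>.\<close>

lemma integral_K:
  assumes f: "integrable \<mu> f"
  shows "(\<integral>y. K f y \<partial>\<mu>) = (\<integral>x. f x \<partial>\<mu>)"
proof -
  have "(\<integral>y. 1 * K f y \<partial>\<mu>) = Phi \<mu> (\<lambda>x. a \<mu> x * 1) \<bullet> Phi \<mu> (\<lambda>x. a \<mu> x * f x)"
    by (rule K_integral[OF f const_integrable])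
  also have "\<dots> = Phi \<mu> (\<lambda>x. a \<mu> x * f x) \<bullet> B \<mu>"
    by (simp add: inner_commute B_eq_Phi)
  also have "\<dots> = (\<integral>x. a \<mu> x * f x * ev (B \<mu>) x \<partial>\<mu>)"
    by (rule Phi_inner[OF \<mu> a_mult_integrable[OF f]])
  also have "\<dots> = (\<integral>x. f x \<partial>\<mu>)"
    using a_pos[OF \<mu>] by (intro Bochner_Integration.integral_cong refl) (simp add: ev_B[OF \<mu>] less_imp_neq[symmetric])
  finally show ?thesis by simp
qed

lemma K_const: "K (\<lambda>x. r) y = r"
proof -
  have "K (\<lambda>x. r) y = a \<mu> y * ev (Phi \<mu> (\<lambda>x. r * a \<mu> x)) y"
    by (subst K_eq[OF const_integrable]) (simp only: mult.commute)
  also have "\<dots> = a \<mu> y * (r * ev (B \<mu>) y)" by (simp add: Phi_scale B_eq_Phi)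
  also have "\<dots> = r" using a_pos[OF \<mu>, of y] by (simp add: ev_B[OF \<mu>])
  finally show ?thesis .
qed

lemma K_diff:
  assumes f: "integrable \<mu> f" and g: "integrable \<mu> g"
  shows "K (\<lambda>x. f x - g x) y = K f y - K g y"
proof -
  have "Phi \<mu> (\<lambda>x. a \<mu> x * (f x - g x)) = Phi \<mu> (\<lambda>x. a \<mu> x * f x) - Phi \<mu> (\<lambda>x. a \<mu> x * g x)"
    unfolding right_diff_distrib by (rule Phi_diff[OF \<mu> a_mult_integrable[OF f] a_mult_integrable[OF g]])
  then show ?thesis
    by (simp add: K_eq[OF f] K_eq[OF g] K_eq[OF Bochner_Integration.integrable_diff[OF f g]] right_diff_distrib)
qed

lemma square_integrable_prob:
  assumes "f \<in> borel_measurable \<mu>" "integrable \<mu> (\<lambda>x. (f x)\<^sup>2 :: real)"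
  shows "integrable \<mu> f"
proof (rule Bochner_Integration.integrable_bound[OF Bochner_Integration.integrable_add[OF assms(2) const_integrable[of 1]] assms(1)])
  show "AE x in \<mu>. norm (f x) \<le> norm ((f x)\<^sup>2 + 1)"
  proof (rule AE_I2)
    fix x
    have "0 \<le> (\<bar>f x\<bar> - 1)\<^sup>2" by (rule zero_le_power2)
    then have "2 * \<bar>f x\<bar> \<le> (f x)\<^sup>2 + 1" by (simp add: power2_diff)
    moreover have "0 \<le> \<bar>f x\<bar>" by simp
    ultimately show "norm (f x) \<le> norm ((f x)\<^sup>2 + 1)" unfolding real_norm_def by linarith
  qed
qed

text \<open>The self-kernel is a Markov density bounded below by \<open>\<delta>\<close>; subtracting \<open>\<delta>\<close> does not change \<open>K f\<close>
  for mean-zero \<open>f\<close> and leaves a nonnegative kernel of mass \<open>1 - \<delta>\<close>.\<close>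
lemma spectral_gap:
  assumes f: "f \<in> borel_measurable \<mu>" and f2: "integrable \<mu> (\<lambda>x. (f x)\<^sup>2)" and mean: "(\<integral>x. f x \<partial>\<mu>) = 0"
  shows "(\<integral>y. f y * K f y \<partial>\<mu>) \<le> (1 - \<delta>) * (\<integral>x. (f x)\<^sup>2 \<partial>\<mu>)"
proof -
  note fi = square_integrable_prob[OF f f2]
  let ?k = "self_kernel c \<epsilon> \<mu>"
  define Q where "Q = (\<integral>x. (f x)\<^sup>2 \<partial>\<mu>)"
  \<comment> \<open>The scalings are at least 1, so the self-kernel inherits the lower bound of the
    Gibbs kernel.\<close>
  have kge: "\<delta> \<le> ?k x y" for x y
  proof -
    have "1 * 1 \<le> a \<mu> x * a \<mu> y" using a_ge_1[OF \<mu>] by (intro mult_mono) (auto intro: order_trans[OF zero_le_one])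
    then have "1 * \<delta> \<le> a \<mu> x * a \<mu> y * k x y"
      using delta_le[of x y] delta_pos by (intro mult_mono) auto
    then show ?thesis by (simp add: self_kernel_def)
  qed
  have kc: "continuous_on UNIV (\<lambda>x. ?k x y)" for y
    unfolding self_kernel_def ev_e[symmetric]
    by (intro continuous_intros a_continuous[OF \<mu>] ev_continuous)
  have ki: "integrable \<mu> (\<lambda>x. g x * ?k x y)" if "integrable \<mu> g" for g y
    by (rule integrable_mult_continuous(2)[OF that kc])
  have each: "f y * K f y \<le> ((K (\<lambda>x. (f x)\<^sup>2) y - \<delta> * Q) + (1 - \<delta>) * (f y)\<^sup>2) / 2" for y
  proof -
    have K1: "(\<integral>x. 1 * ?k x y \<partial>\<mu>) = 1" using K_const[of 1 y] by (simp add: K_def kernel_op_def)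
    have "f y * K f y = f y * (\<integral>x. f x * ?k x y - \<delta> * f x \<partial>\<mu>)"
      using mean ki[OF fi] fi by (simp add: K_def kernel_op_def)
    also have "\<dots> = (\<integral>x. f y * (f x * ?k x y - \<delta> * f x) \<partial>\<mu>)" by (rule integral_mult_right_zero[symmetric])
    also have "\<dots> \<le> (\<integral>x. (((f x)\<^sup>2 * ?k x y - \<delta> * (f x)\<^sup>2) + (f y)\<^sup>2 * (1 * ?k x y - \<delta>)) / 2 \<partial>\<mu>)"
    proof (rule Bochner_Integration.integral_mono)
      show "integrable \<mu> (\<lambda>x. f y * (f x * ?k x y - \<delta> * f x))" using ki[OF fi] fi by simp
      show "integrable \<mu> (\<lambda>x. (((f x)\<^sup>2 * ?k x y - \<delta> * (f x)\<^sup>2) + (f y)\<^sup>2 * (1 * ?k x y - \<delta>)) / 2)"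
        using ki[OF f2] f2 ki[OF const_integrable[of 1], of y] const_integrable[of \<delta>] by simp
      fix x
      \<comment> \<open>This is 2 p q \<le> p^2 + q^2, weighted by the nonnegative kernel that is
        left after \<delta> is subtracted.\<close>
      have "0 \<le> (f x - f y)\<^sup>2 * (?k x y - \<delta>)" using kge[of x y] by simp
      then show "f y * (f x * ?k x y - \<delta> * f x) \<le> (((f x)\<^sup>2 * ?k x y - \<delta> * (f x)\<^sup>2) + (f y)\<^sup>2 * (1 * ?k x y - \<delta>)) / 2"
        by (simp add: power2_eq_square algebra_simps)
    qed
    also have "\<dots> = ((K (\<lambda>x. (f x)\<^sup>2) y - \<delta> * Q) + (f y)\<^sup>2 * (1 - \<delta>)) / 2"
      using ki[OF f2] f2 ki[OF const_integrable[of 1], of y] const_integrable[of \<delta>] K1 prob_measure_1[OF \<mu>, of \<delta>]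
      by (simp add: K_def kernel_op_def Q_def)
    finally show ?thesis by (simp only: mult.commute[of "(f y)\<^sup>2"])
  qed
  have Kf2: "integrable \<mu> (K (\<lambda>x. (f x)\<^sup>2))"
    by (rule integrable_continuous_prob[OF \<mu> K_continuous[OF f2]])
  have "(\<integral>y. f y * K f y \<partial>\<mu>) \<le> (\<integral>y. ((K (\<lambda>x. (f x)\<^sup>2) y - \<delta> * Q) + (1 - \<delta>) * (f y)\<^sup>2) / 2 \<partial>\<mu>)"
  proof (rule Bochner_Integration.integral_mono[OF _ _ each])
    show "integrable \<mu> (\<lambda>y. f y * K f y)"
      by (rule integrable_mult_continuous(2)[OF fi K_continuous[OF fi]])
  qed (use Kf2 f2 const_integrable[of "\<delta> * Q"] in simp)
  also have "\<dots> = ((Q - \<delta> * Q) + (1 - \<delta>) * Q) / 2"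
    using Kf2 f2 const_integrable[of "\<delta> * Q"] prob_measure_1[OF \<mu>, of "\<delta> * Q"]
    by (simp add: integral_K[OF f2] Q_def[symmetric])
  finally show ?thesis by (simp add: Q_def algebra_simps)
qed

section \<open>The operator on the fixed Hilbert space\<close>

definition E :: "'h \<Rightarrow> 'a \<Rightarrow> real" where "E = self_ev c \<epsilon> ev \<mu>"

lemma E_eq: "E h x = a \<mu> x * ev h x" by (simp add: E_def self_ev_def)

lemma E_continuous: "continuous_on UNIV (E h)"
proof -
  have "E h = (\<lambda>x. a \<mu> x * ev h x)" by (rule ext) (rule E_eq)
  moreover have "continuous_on UNIV (\<lambda>x. a \<mu> x * ev h x)" by (intro continuous_intros a_continuous[OF \<mu>] ev_continuous)
  ultimately show ?thesis by simp
qed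

lemma E_integrable: "integrable \<mu> (E h)" by (rule integrable_continuous_prob[OF \<mu> E_continuous])

lemma E_B: "E (B \<mu>) x = 1"
  using a_pos[OF \<mu>, of x] by (simp add: E_eq ev_B[OF \<mu>])

lemma inner_B: "B \<mu> \<bullet> h = (\<integral>x. E h x \<partial>\<mu>)"
  unfolding E_eq by (subst B_eq_Phi) (rule Phi_inner[OF \<mu> a_integrable[OF \<mu>]])

text \<open>The operator \<open>K\<close>, conjugated from \<open>\<H>\<^sub>\<mu>\<close> to \<open>\<H>\<^sub>c\<close>.\<close>
definition A :: "'h \<Rightarrow> 'h" where "A h = Phi \<mu> (\<lambda>x. a \<mu> x * E h x)"

lemma E_A: "E (A h) y = K (E h) y"
  unfolding K_eq[OF E_integrable] A_def by (rule E_eq)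

lemma A_inner: "A h \<bullet> g = (\<integral>x. E h x * E g x \<partial>\<mu>)"
  unfolding A_def Phi_inner[OF \<mu> a_mult_integrable[OF E_integrable]] E_eq[of g]
  by (intro Bochner_Integration.integral_cong refl) (simp only: mult_ac)

lemma A_sym: "A h \<bullet> g = h \<bullet> A g"
  using A_inner[of h g] A_inner[of g h] by (simp add: inner_commute mult.commute)

lemma A_nonneg: "0 \<le> A h \<bullet> h"
  unfolding A_inner by (rule Bochner_Integration.integral_nonneg) simp

lemma A_B: "A (B \<mu>) = B \<mu>"
  unfolding A_def E_B by (simp add: B_eq_Phi)

lemma A_diff: "A (h - g) = A h - A g"
proof -
  have "A (h - g) = Phi \<mu> (\<lambda>x. a \<mu> x * E h x - a \<mu> x * E g x)"
    unfolding A_def by (simp add: E_eq right_diff_distrib)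
  then show ?thesis
    unfolding A_def by (simp add: Phi_diff[OF \<mu> a_mult_integrable[OF E_integrable] a_mult_integrable[OF E_integrable]])
qed

lemma A_scale: "A (r *\<^sub>R h) = r *\<^sub>R A h"
  unfolding A_def Phi_scale[symmetric] by (simp add: E_eq mult_ac)

lemma A_add: "A (h + g) = A h + A g"
  using A_diff[of h "- g"] A_scale[of "-1" g] by simp

lemma B_A: "B \<mu> \<bullet> A h = B \<mu> \<bullet> h"
  using A_sym[of "B \<mu>" h] by (simp add: A_B)

text \<open>\<open>A h\<close> embeds the scaling times \<open>E h\<close>, so its squared norm is
  the quadratic form of \<open>K\<close> at \<open>E h\<close>; orthogonality to
  \<open>B \<mu>\<close> says that \<open>E h\<close> has mean zero. Thus the gap in L^2 becomes a
  gap in the RKHS.\<close>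

lemma A_gap:
  assumes "B \<mu> \<bullet> h = 0"
  shows "(norm (A h))\<^sup>2 \<le> (1 - \<delta>) * (A h \<bullet> h)" and "norm (A h) \<le> (1 - \<delta>) * norm h"
proof -
  have E2: "integrable \<mu> (\<lambda>x. (E h x)\<^sup>2)"
    by (intro integrable_continuous_prob[OF \<mu>] continuous_intros E_continuous)
  have "(norm (A h))\<^sup>2 = (\<integral>y. E h y * K (E h) y \<partial>\<mu>)"
    unfolding power2_norm_eq_inner A_def K_integral[OF E_integrable E_integrable] ..
  also have "\<dots> \<le> (1 - \<delta>) * (\<integral>x. (E h x)\<^sup>2 \<partial>\<mu>)"
    using assms inner_B[of h] by (intro spectral_gap E2 measurable_continuous[OF \<mu> E_continuous]) simp
  also have "(\<integral>x. (E h x)\<^sup>2 \<partial>\<mu>) = A h \<bullet> h" by (simp add: A_inner power2_eq_square)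
  finally show 1: "(norm (A h))\<^sup>2 \<le> (1 - \<delta>) * (A h \<bullet> h)" .
  also have "\<dots> \<le> (1 - \<delta>) * (norm (A h) * norm h)"
    using delta_le_1 by (intro mult_left_mono norm_cauchy_schwarz) simp
  finally have "norm (A h) * norm (A h) \<le> norm (A h) * ((1 - \<delta>) * norm h)"
    by (simp add: power2_eq_square mult_ac)
  then show "norm (A h) \<le> (1 - \<delta>) * norm h"
    using delta_le_1 by (cases "norm (A h) = 0") (auto simp: mult_le_cancel_left)
qed

text \<open>On the complement of \<open>B \<mu>\<close> the operator \<open>A\<close> contracts by 1
  - \<delta>; the projection \<open>p\<close> lets the fixed point argument run on the whole space.
  \<theta> = 1 inverts id - A, and \<theta> = -1 inverts id + A.\<close>

lemma A_solve:
  assumes S: "B \<mu> \<bullet> S = 0" and \<theta>: "\<bar>\<theta>\<bar> = 1"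
  obtains h where "B \<mu> \<bullet> h = 0" "h - \<theta> *\<^sub>R A h = S"
proof -
  define p where "p h = h - (B \<mu> \<bullet> h) *\<^sub>R B \<mu>" for h
  have BB: "B \<mu> \<bullet> B \<mu> = 1" using norm_B[OF \<mu>] by (simp add: norm_eq_1)
  have Bp: "B \<mu> \<bullet> p h = 0" for h by (simp add: p_def inner_diff_right BB)
  have p_le: "norm (p h) \<le> norm h" for h
  proof (rule power2_le_imp_le)
    have "(norm (p h))\<^sup>2 = (norm h)\<^sup>2 - (B \<mu> \<bullet> h)\<^sup>2"
      unfolding power2_norm_eq_inner p_def
      by (simp only: inner_diff_left inner_diff_right inner_scaleR_left inner_scaleR_right BB inner_commute[of h "B \<mu>"])
        (simp add: power2_eq_square)
    then show "(norm (p h))\<^sup>2 \<le> (norm h)\<^sup>2" by simp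
  qed simp
  have p_diff: "p (h - g) = p h - p g" for h g by (simp add: p_def inner_diff_right algebra_simps)
  define T where "T h = S + \<theta> *\<^sub>R A (p h)" for h
  have "\<exists>!h. T h = h"
  proof (rule banach_fix_type[of "1 - \<delta>"])
    show "0 \<le> 1 - \<delta>" "1 - \<delta> < 1" using delta_pos delta_le_1 by auto
    show "\<forall>h g. dist (T h) (T g) \<le> (1 - \<delta>) * dist h g"
    proof (intro allI)
      fix h g
      have "T h - T g = \<theta> *\<^sub>R A (p (h - g))" by (simp add: T_def p_diff A_diff scaleR_diff_right)
      then have "dist (T h) (T g) = norm (A (p (h - g)))" using \<theta> by (simp add: dist_norm)
      also have "\<dots> \<le> (1 - \<delta>) * norm (p (h - g))" by (rule A_gap(2)[OF Bp])
      also have "\<dots> \<le> (1 - \<delta>) * dist h g"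
        unfolding dist_norm using delta_le_1 by (intro mult_left_mono p_le) simp
      finally show "dist (T h) (T g) \<le> (1 - \<delta>) * dist h g" .
    qed
  qed
  then obtain h where h: "T h = h" by blast
  have "B \<mu> \<bullet> T h = 0" unfolding T_def by (simp add: inner_add_right S B_A Bp)
  then have Bh: "B \<mu> \<bullet> h = 0" by (simp only: h)
  then have "p h = h" by (simp add: p_def)
  then have "h - \<theta> *\<^sub>R A h = S" using h by (simp add: T_def algebra_simps)
  then show ?thesis using that Bh by blast
qed

text \<open>The pairing is \<open>A h \<bullet> h\<close> minus the squared norm of
  \<open>A h\<close>, nonnegative by the gap. The gap also gives
  \<open>norm h \<le> norm v / \<delta>\<close>, whence the upper bound.\<close>

lemma A_energy:
  assumes "B \<mu> \<bullet> h = 0" "h - A h = v"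
  shows "0 \<le> v \<bullet> A h" and "v \<bullet> A h \<le> (norm v)\<^sup>2 / \<delta>"
proof -
  have "(norm (A h))\<^sup>2 \<le> (1 - \<delta>) * (A h \<bullet> h)" by (rule A_gap[OF assms(1)])
  also have "\<dots> \<le> 1 * (A h \<bullet> h)" using A_nonneg[of h] delta_pos by (intro mult_right_mono) auto
  finally have "(norm (A h))\<^sup>2 \<le> 1 * (A h \<bullet> h)" .
  show "0 \<le> v \<bullet> A h"
  proof -
    have "v \<bullet> A h = A h \<bullet> h - (norm (A h))\<^sup>2"
      by (simp only: assms(2)[symmetric] inner_diff_left power2_norm_eq_inner inner_commute[of h "A h"])
    then show ?thesis using \<open>(norm (A h))\<^sup>2 \<le> 1 * (A h \<bullet> h)\<close> by simp
  qed
  have gap: "norm (A h) \<le> (1 - \<delta>) * norm h" by (rule A_gap[OF assms(1)])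
  have "norm h \<le> norm v + norm (A h)" using norm_triangle_ineq[of v "A h"] assms(2) by auto
  with gap have "norm h * \<delta> \<le> norm v" by (simp add: algebra_simps)
  then have hv: "norm h \<le> norm v / \<delta>" using delta_pos by (simp add: pos_le_divide_eq)
  have "norm (A h) \<le> 1 * norm h"
    using gap delta_pos by (elim order_trans) (intro mult_right_mono, auto)
  have "v \<bullet> A h \<le> norm v * norm (A h)" by (rule norm_cauchy_schwarz)
  also have "\<dots> \<le> norm v * (norm v / \<delta>)"
    using \<open>norm (A h) \<le> 1 * norm h\<close> hv by (intro mult_left_mono) auto
  finally show "v \<bullet> A h \<le> (norm v)\<^sup>2 / \<delta>" by (simp add: power2_eq_square)
qed

text \<open>The solution selected by \<open>SOME\<close> is only known to be square integrable, so
  the estimates are made for any solution. After centring, w = (id - K) q, and the gap makes the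
  pairing of w with q at least \<delta> times the squared L^2 norm of q.\<close>

lemma metric_g_tilde_bounds:
  assumes v: "B \<mu> \<bullet> v = 0"
  shows "\<epsilon> / 2 * (norm v)\<^sup>2 \<le> metric_g_tilde c \<epsilon> ev \<mu> v"
    and "metric_g_tilde c \<epsilon> ev \<mu> v \<le> \<epsilon> / 2 * (1 + 2 / \<delta>) * (norm v)\<^sup>2"
proof -
  let ?w = "E v"
  define P where "P f \<longleftrightarrow> f \<in> borel_measurable \<mu> \<and> integrable \<mu> (\<lambda>x. (f x)\<^sup>2) \<and>
      (\<exists>C. AE x in \<mu>. f x - K f x = ?w x + C)" for f
  define f where "f = (SOME f. P f)"
  \<comment> \<open>Some solution exists, so the one selected by \<open>SOME\<close> has the
    required property.\<close>
  obtain h where h: "B \<mu> \<bullet> h = 0" "h - 1 *\<^sub>R A h = v" using A_solve[OF v, of 1] by auto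
  have "E h x - K (E h) x = E v x + 0" for x
    unfolding E_A[symmetric] h(2)[symmetric] by (simp add: E_eq algebra_simps)
  then have "AE x in \<mu>. E h x - K (E h) x = E v x + 0" by (intro AE_I2)
  moreover have "E h \<in> borel_measurable \<mu>" by (rule measurable_continuous[OF \<mu> E_continuous])
  moreover have "integrable \<mu> (\<lambda>x. (E h x)\<^sup>2)"
    by (intro integrable_continuous_prob[OF \<mu>] continuous_intros E_continuous)
  ultimately have "P (E h)" unfolding P_def by (intro conjI exI)
  then have "P f" unfolding f_def by (rule someI[of P])
  then obtain C where fm: "f \<in> borel_measurable \<mu>" and f2: "integrable \<mu> (\<lambda>x. (f x)\<^sup>2)"
    and C: "AE x in \<mu>. f x - K f x = ?w x + C" unfolding P_def by (elim conjE exE)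
  note fi = square_integrable_prob[OF fm f2]
  have Kfi: "integrable \<mu> (K f)" by (rule integrable_continuous_prob[OF \<mu> K_continuous[OF fi]])
  have w0: "(\<integral>x. ?w x \<partial>\<mu>) = 0" using v inner_B[of v] by simp
  \<comment> \<open>Integrate the equation: \<open>K\<close> preserves means and \<open>w\<close>
    has mean zero, so the free constant vanishes.\<close>
  have "(\<integral>x. f x - K f x \<partial>\<mu>) = (\<integral>x. ?w x + C \<partial>\<mu>)"
    using C fi Kfi E_integrable[of v] const_integrable[of C] by (intro integral_cong_AE) auto
  then have C0: "C = 0"
    using fi Kfi E_integrable[of v] const_integrable[of C] w0
      prob_space.prob_space[OF prob_measuresD(1)[OF \<mu>]] by (simp add: integral_K[OF fi])
  define m where "m = (\<integral>x. f x \<partial>\<mu>)"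
  define q where "q x = f x - m" for x
  have qm: "q \<in> borel_measurable \<mu>" unfolding q_def using fm by simp
  have qi: "integrable \<mu> q" unfolding q_def using fi const_integrable[of m] by simp
  have q2: "integrable \<mu> (\<lambda>x. (q x)\<^sup>2)"
  proof -
    have "(q x)\<^sup>2 = (f x)\<^sup>2 - 2 * m * f x + m\<^sup>2" for x by (simp add: q_def power2_eq_square algebra_simps)
    then show ?thesis using f2 fi const_integrable[of "m\<^sup>2"] by simp
  qed
  have q0: "(\<integral>x. q x \<partial>\<mu>) = 0"
    unfolding q_def using fi const_integrable[of m] prob_measure_1[OF \<mu>, of m] by (simp add: m_def[symmetric])
  have Kq: "K q y = K f y - m" for y
    unfolding q_def by (simp add: K_diff[OF fi const_integrable] K_const)
  have wq: "AE x in \<mu>. ?w x * q x = (q x)\<^sup>2 - q x * K q x"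
    using C
  proof eventually_elim
    case (elim x)
    then have eq: "?w x = q x - K q x" by (simp add: C0 Kq q_def)
    show ?case unfolding eq by (simp add: power2_eq_square algebra_simps)
  qed
  define D where "D = (\<integral>x. ?w x * f x \<partial>\<mu>)"
  define Q where "Q = (\<integral>x. (q x)\<^sup>2 \<partial>\<mu>)"
  have wqi: "integrable \<mu> (\<lambda>x. ?w x * q x)" by (rule integrable_mult_continuous(1)[OF qi E_continuous])
  have qKi: "integrable \<mu> (\<lambda>x. q x * K q x)" by (rule integrable_mult_continuous(2)[OF qi K_continuous[OF qi]])
  have "D = (\<integral>x. ?w x * q x + m * ?w x \<partial>\<mu>)"
    unfolding D_def q_def by (simp add: algebra_simps)
  also have "\<dots> = (\<integral>x. ?w x * q x \<partial>\<mu>)"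
    using wqi E_integrable[of v] w0 by simp
  finally have Dq: "D = (\<integral>x. ?w x * q x \<partial>\<mu>)" .
  also have "\<dots> = (\<integral>x. (q x)\<^sup>2 - q x * K q x \<partial>\<mu>)"
    using wq wqi q2 qKi by (intro integral_cong_AE) auto
  also have "\<dots> = Q - (\<integral>x. q x * K q x \<partial>\<mu>)" using q2 qKi by (simp add: Q_def)
  finally have DQ: "\<delta> * Q \<le> D" using spectral_gap[OF qm q2 q0] by (simp add: Q_def algebra_simps)
  have Q0: "0 \<le> Q" unfolding Q_def by (rule Bochner_Integration.integral_nonneg) simp
  then have D0: "0 \<le> D" using DQ delta_pos by (meson mult_nonneg_nonneg less_imp_le order_trans)
  have w2i: "integrable \<mu> (\<lambda>x. (?w x)\<^sup>2)" by (intro integrable_continuous_prob[OF \<mu>] continuous_intros E_continuous)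
  have w2: "(\<integral>x. (?w x)\<^sup>2 \<partial>\<mu>) \<le> (norm v)\<^sup>2"
  proof -
    have "(\<integral>x. (?w x)\<^sup>2 \<partial>\<mu>) = A v \<bullet> v" by (simp add: A_inner power2_eq_square)
    also have "\<dots> \<le> norm (A v) * norm v" by (rule norm_cauchy_schwarz)
    also have "\<dots> \<le> (1 - \<delta>) * norm v * norm v" by (intro mult_right_mono A_gap(2)[OF v]) simp
    also have "\<dots> \<le> 1 * norm v * norm v" using delta_pos by (intro mult_right_mono) auto
    finally show ?thesis by (simp add: power2_eq_square)
  qed
  \<comment> \<open>Young's inequality with weight \<delta>, so that the term in \<open>q\<close> is
    absorbed by \<open>\<delta> * Q \<le> D\<close>.\<close>
  have "D \<le> (\<integral>x. ((?w x)\<^sup>2 / \<delta> + \<delta> * (q x)\<^sup>2) / 2 \<partial>\<mu>)"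
    unfolding Dq
  proof (rule Bochner_Integration.integral_mono[OF wqi])
    show "integrable \<mu> (\<lambda>x. ((?w x)\<^sup>2 / \<delta> + \<delta> * (q x)\<^sup>2) / 2)" using w2i q2 by simp
    fix x
    have "0 \<le> (?w x - \<delta> * q x)\<^sup>2 / \<delta>" using delta_pos by simp
    also have "\<dots> = (?w x)\<^sup>2 / \<delta> + \<delta> * (q x)\<^sup>2 - 2 * (?w x * q x)"
      using delta_pos by (simp add: field_simps power2_eq_square)
    finally show "?w x * q x \<le> ((?w x)\<^sup>2 / \<delta> + \<delta> * (q x)\<^sup>2) / 2" by simp
  qed
  also have "\<dots> = ((\<integral>x. (?w x)\<^sup>2 \<partial>\<mu>) / \<delta> + \<delta> * Q) / 2" using w2i q2 by (simp add: Q_def)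
  also have "\<dots> \<le> ((norm v)\<^sup>2 / \<delta> + D) / 2"
    using DQ w2 delta_pos by (intro divide_right_mono add_mono) auto
  finally have Dle: "D \<le> (norm v)\<^sup>2 / \<delta>" by simp
  have g: "metric_g_tilde c \<epsilon> ev \<mu> v = \<epsilon> / 2 * ((norm v)\<^sup>2 + 2 * D)"
    unfolding metric_g_tilde_def Let_def D_def f_def P_def K_def E_def self_ev_def ..
  show "\<epsilon> / 2 * (norm v)\<^sup>2 \<le> metric_g_tilde c \<epsilon> ev \<mu> v"
    unfolding g using D0 eps_pos by (intro mult_left_mono) auto
  have "\<epsilon> / 2 * ((norm v)\<^sup>2 + 2 * D) \<le> \<epsilon> / 2 * ((norm v)\<^sup>2 + 2 * ((norm v)\<^sup>2 / \<delta>))"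
    using Dle eps_pos by (intro mult_left_mono) auto
  then show "metric_g_tilde c \<epsilon> ev \<mu> v \<le> \<epsilon> / 2 * (1 + 2 / \<delta>) * (norm v)\<^sup>2"
    unfolding g by (simp add: algebra_simps)
qed

lemma inj_E: "inj E"
  using is_rkhs_self_kernel[OF rkhs, of \<mu>] unfolding E_def is_rkhs_def by blast

lemma riesz_eq:
  assumes "\<And>h. blinfun_apply \<sigma> h = S \<bullet> h"
  shows "riesz_op (self_kernel c \<epsilon> \<mu>) E \<sigma> y = E S y"
proof -
  have "E (a \<mu> y *\<^sub>R e y) = (\<lambda>x. self_kernel c \<epsilon> \<mu> x y)"
    by (rule ext) (simp add: E_eq self_kernel_def ev_e)
  then have "inv E (\<lambda>x. self_kernel c \<epsilon> \<mu> x y) = a \<mu> y *\<^sub>R e y"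
    by (metis inv_f_f[OF inj_E])
  then show ?thesis
    by (simp add: riesz_op_def pairing_def assms E_eq ev_inner)
qed

text \<open>Modulo \<open>B \<mu>\<close>, the equation (id - A^2) h = (id + A) v reduces to (id -
  A) h = v, since id + A is injective by positivity. The energy is then the squared norm of
  \<open>v\<close> plus twice \<open>v \<bullet> A h\<close>, as in the other tensor.\<close>

lemma metric_g_bounds:
  assumes v: "B \<mu> \<bullet> v = 0" and \<sigma>: "\<And>h. blinfun_apply \<sigma> h = (v + A v) \<bullet> h"
  shows "\<epsilon> / 2 * (norm v)\<^sup>2 \<le> metric_g c \<epsilon> ev \<mu> \<sigma>"
    and "metric_g c \<epsilon> ev \<mu> \<sigma> \<le> \<epsilon> / 2 * (1 + 2 / \<delta>) * (norm v)\<^sup>2"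
proof -
  let ?S = "v + A v"
  define P where "P f \<longleftrightarrow> f \<in> range E \<and> (\<exists>C. \<forall>y. f y - K (K f) y = riesz_op (self_kernel c \<epsilon> \<mu>) E \<sigma> y + C)" for f
  define f where "f = (SOME f. P f)"
  have KKE: "K (K (E h)) y = E (A (A h)) y" for h y
  proof -
    have "K (E h) = E (A h)" by (rule ext) (rule E_A[symmetric])
    then show ?thesis by (simp only: E_A)
  qed
  have E_lin: "E (h - g) y = E h y - E g y" "E (h + g) y = E h y + E g y" "E (r *\<^sub>R h) y = r * E h y" for h g y r
    by (simp_all add: E_eq algebra_simps)
  \<comment> \<open>For existence it suffices to invert id - A, by the factorization id - A^2 = (id
    + A)(id - A).\<close>
  obtain h' where h': "B \<mu> \<bullet> h' = 0" "h' - 1 *\<^sub>R A h' = v" using A_solve[OF v, of 1] by auto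
  have S': "h' - A (A h') = ?S"
    unfolding h'(2)[symmetric] by (simp add: A_diff)
  have "E h' y - K (K (E h')) y = riesz_op (self_kernel c \<epsilon> \<mu>) E \<sigma> y + 0" for y
    unfolding KKE riesz_eq[OF \<sigma>] S'[symmetric] by (simp only: E_lin)
  then have "P (E h')" unfolding P_def by (intro conjI rangeI exI allI)
  then have "P f" unfolding f_def by (rule someI[of P])
  then obtain h C where h: "f = E h" "\<forall>y. f y - K (K f) y = riesz_op (self_kernel c \<epsilon> \<mu>) E \<sigma> y + C"
    unfolding P_def by (elim conjE rangeE exE)
  have "E (h - A (A h)) y = E (?S + C *\<^sub>R B \<mu>) y" for y
    using h(2)[rule_format, of y] unfolding h(1) KKE riesz_eq[OF \<sigma>] by (simp only: E_lin E_B mult_1_right)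
  then have "E (h - A (A h)) = E (?S + C *\<^sub>R B \<mu>)" by (rule ext)
  then have hS: "h - A (A h) = ?S + C *\<^sub>R B \<mu>" using inj_E by (simp only: inj_eq)
  have BB: "B \<mu> \<bullet> B \<mu> = 1" using norm_B[OF \<mu>] by (simp add: norm_eq_1)
  have BS: "B \<mu> \<bullet> ?S = 0" using v by (simp add: inner_add_right B_A)
  \<comment> \<open>Pairing with \<open>B \<mu>\<close>, a fixed vector of \<open>A\<close>, removes
    the free constant.\<close>
  have "B \<mu> \<bullet> (h - A (A h)) = B \<mu> \<bullet> (?S + C *\<^sub>R B \<mu>)" by (simp only: hS)
  then have C0: "C = 0" using BS by (simp add: inner_diff_right inner_add_right B_A BB)
  define h1 where "h1 = h - (B \<mu> \<bullet> h) *\<^sub>R B \<mu>"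
  have Bh1: "B \<mu> \<bullet> h1 = 0" by (simp add: h1_def inner_diff_right BB)
  have h1S: "h1 - A (A h1) = ?S"
    using hS C0 by (simp add: h1_def A_diff A_scale A_B)
  \<comment> \<open>\<open>u\<close> will lie in the kernel of id + A, which is trivial because
    \<open>A\<close> is positive.\<close>
  define u where "u = h1 - A h1 - v"
  have "u + A u = (h1 - A (A h1)) - ?S" by (simp add: u_def A_diff A_add algebra_simps)
  then have "u + A u = 0" by (simp only: h1S diff_self)
  then have "(u + A u) \<bullet> u = 0" by simp
  then have "u \<bullet> u \<le> 0" using A_nonneg[of u] by (simp add: inner_add_left)
  then have "u \<bullet> u = 0" using inner_ge_zero[of u] by (rule order_antisym)
  then have "u = 0" by (rule inner_eq_zero_iff[THEN iffD1])
  then have h1: "h1 - A h1 = v" by (simp add: u_def)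
  have "?S \<bullet> h = ?S \<bullet> h1"
    using BS by (simp add: h1_def inner_diff_right inner_commute)
  also have "\<dots> = v \<bullet> h1 + v \<bullet> A h1" by (simp add: inner_add_left A_sym)
  also have "\<dots> = (norm v)\<^sup>2 + 2 * (v \<bullet> A h1)"
  proof -
    have "h1 = v + A h1" using h1 by (simp add: algebra_simps)
    then have "v \<bullet> h1 = v \<bullet> v + v \<bullet> A h1" by (metis inner_add_right)
    then show ?thesis by (simp add: power2_norm_eq_inner)
  qed
  finally have Sh: "?S \<bullet> h = (norm v)\<^sup>2 + 2 * (v \<bullet> A h1)" .
  have "metric_g c \<epsilon> ev \<mu> \<sigma> = \<epsilon> / 2 * pairing E \<sigma> f"
    unfolding metric_g_def Let_def f_def P_def K_def E_def ..
  also have "pairing E \<sigma> f = ?S \<bullet> h"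
    unfolding pairing_def h(1) inv_f_f[OF inj_E] by (rule \<sigma>)
  finally have g: "metric_g c \<epsilon> ev \<mu> \<sigma> = \<epsilon> / 2 * ((norm v)\<^sup>2 + 2 * (v \<bullet> A h1))" by (simp only: Sh)
  note en = A_energy[OF Bh1 h1]
  show "\<epsilon> / 2 * (norm v)\<^sup>2 \<le> metric_g c \<epsilon> ev \<mu> \<sigma>"
    unfolding g using en(1) eps_pos by (intro mult_left_mono) auto
  have "\<epsilon> / 2 * ((norm v)\<^sup>2 + 2 * (v \<bullet> A h1)) \<le> \<epsilon> / 2 * ((norm v)\<^sup>2 + 2 * ((norm v)\<^sup>2 / \<delta>))"
    using en(2) eps_pos by (intro mult_left_mono) auto
  then show "metric_g c \<epsilon> ev \<mu> \<sigma> \<le> \<epsilon> / 2 * (1 + 2 / \<delta>) * (norm v)\<^sup>2"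
    unfolding g by (simp add: algebra_simps)
qed

end

end

section \<open>Weak-star continuous paths\<close>

context gibbs_rkhs begin

text \<open>The representers form a compact set. Such a net turns convergence at finitely many
  points into convergence uniform over the space.\<close>

lemma finite_net:
  assumes "\<eta> > 0"
  obtains Y where "finite Y" "\<And>y. \<exists>z\<in>Y. norm (e y - e z) < \<eta>"
proof -
  have "compact (range e)" by (rule compact_continuous_image[OF e_continuous compact_space])
  from seq_compact_imp_totally_bounded[OF compact_imp_seq_compact[OF this]] assms
  have "\<exists>k. finite k \<and> k \<subseteq> range e \<and> range e \<subseteq> (\<Union>x\<in>k. ball x \<eta>)" by blast
  then obtain k where k: "finite k" "k \<subseteq> range e" "range e \<subseteq> (\<Union>x\<in>k. ball x \<eta>)" by (elim exE conjE)
  obtain Y where Y: "finite Y" "k = e ` Y" using finite_subset_image[OF k(1,2)] by blast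
  show ?thesis
  proof (rule that[OF Y(1)])
    fix y
    have "e y \<in> (\<Union>x\<in>k. ball x \<eta>)" using k(3) by blast
    then show "\<exists>z\<in>Y. norm (e y - e z) < \<eta>"
      by (auto simp: Y(2) dist_norm norm_minus_commute)
  qed
qed

lemma Phi_scaled_diff_le:
  assumes \<nu>: "\<nu> \<in> prob_measures" and f: "continuous_on UNIV f" and g: "continuous_on UNIV g"
    and C: "\<And>x. \<bar>f x - g x\<bar> \<le> C"
  shows "norm (Phi \<nu> f - Phi \<nu> g) \<le> C"
  unfolding Phi_diff[OF \<nu> integrable_continuous_prob[OF \<nu> f] integrable_continuous_prob[OF \<nu> g], symmetric]
  by (rule Phi_norm_le[OF \<nu> continuous_on_diff[OF f g] C])

lemma a_diff:
  assumes "\<mu> \<in> prob_measures" "\<nu> \<in> prob_measures"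
  shows "a \<mu> x - a \<nu> x = - (a \<mu> x * a \<nu> x * ev (B \<mu> - B \<nu>) x)"
  using a_pos[OF assms(1), of x] a_pos[OF assms(2), of x]
  by (simp add: ev_B[OF assms(1)] ev_B[OF assms(2)] field_simps)

lemma a_mult_bounds:
  assumes "\<mu> \<in> prob_measures" "\<nu> \<in> prob_measures"
  shows "0 \<le> a \<mu> x * a \<nu> x" "a \<mu> x * a \<nu> x \<le> 1 / \<delta>\<^sup>2"
proof -
  show "0 \<le> a \<mu> x * a \<nu> x" using a_pos assms by (simp add: less_imp_le)
  have "a \<mu> x * a \<nu> x \<le> (1 / \<delta>) * (1 / \<delta>)"
    using a_pos[OF assms(1), of x] a_pos[OF assms(2), of x] a_le assms delta_pos
    by (intro mult_mono) auto
  then show "a \<mu> x * a \<nu> x \<le> 1 / \<delta>\<^sup>2" by (simp add: power2_eq_square)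
qed

lemma a_diff_le:
  assumes "\<mu> \<in> prob_measures" "\<nu> \<in> prob_measures"
  shows "\<bar>a \<mu> x - a \<nu> x\<bar> \<le> norm (B \<mu> - B \<nu>) / \<delta>\<^sup>2"
proof -
  have "\<bar>a \<mu> x - a \<nu> x\<bar> = (a \<mu> x * a \<nu> x) * \<bar>ev (B \<mu> - B \<nu>) x\<bar>"
    using a_mult_bounds(1)[OF assms, of x] unfolding a_diff[OF assms]
    by (simp only: abs_minus_cancel abs_mult[of "a \<mu> x * a \<nu> x"] abs_of_nonneg)
  also have "\<dots> \<le> (1 / \<delta>\<^sup>2) * norm (B \<mu> - B \<nu>)"
    by (rule mult_mono[OF a_mult_bounds(2)[OF assms] ev_bound]) auto
  finally show ?thesis by simp
qed

text \<open>The linearization of \<open>B\<close> at two measures at once: \<open>B \<mu> - B \<nu> = (\<mu> - \<nu>)(a\<^sub>\<nu>) - Phi \<mu> (a\<^sub>\<mu> a\<^sub>\<nu> (B \<mu> - B \<nu>))\<close>.\<close>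
definition L :: "'a measure \<Rightarrow> 'a measure \<Rightarrow> 'h \<Rightarrow> 'h" where
  "L \<mu> \<nu> h = Phi \<mu> (\<lambda>x. a \<mu> x * a \<nu> x * ev h x)"

context
  fixes \<mu> \<nu> :: "'a measure" assumes \<mu>: "\<mu> \<in> prob_measures" and \<nu>: "\<nu> \<in> prob_measures"
begin

lemma L_integrand: "continuous_on UNIV (\<lambda>x. a \<mu> x * a \<nu> x * ev h x)"
  by (intro continuous_intros a_continuous \<mu> \<nu> ev_continuous)

lemma L_diff: "L \<mu> \<nu> (h - g) = L \<mu> \<nu> h - L \<mu> \<nu> g"
  unfolding L_def
  by (simp add: right_diff_distrib Phi_diff[OF \<mu> integrable_continuous_prob[OF \<mu> L_integrand] integrable_continuous_prob[OF \<mu> L_integrand]])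

lemma L_scale: "L \<mu> \<nu> (r *\<^sub>R h) = r *\<^sub>R L \<mu> \<nu> h"
  unfolding L_def Phi_scale[symmetric] by (simp add: mult_ac)

lemma L_nonneg: "0 \<le> L \<mu> \<nu> h \<bullet> h"
  unfolding L_def Phi_inner[OF \<mu> integrable_continuous_prob[OF \<mu> L_integrand]]
proof (rule Bochner_Integration.integral_nonneg)
  show "0 \<le> a \<mu> x * a \<nu> x * ev h x * ev h x" for x
    unfolding mult.assoc[of "a \<mu> x * a \<nu> x"]
    by (rule mult_nonneg_nonneg[OF a_mult_bounds(1)[OF \<mu> \<nu>] zero_le_square])
qed

text \<open>Positivity of \<open>L\<close> makes id + L expand norms, with a constant independent of
  the measures. Through \<open>B_linearization\<close>, convergence of embedded increments then
  passes to \<open>B\<close>.\<close>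

lemma L_coercive: "norm h \<le> norm (h + L \<mu> \<nu> h)"
proof -
  have "norm h * norm h \<le> (h + L \<mu> \<nu> h) \<bullet> h"
    using L_nonneg[of h] by (simp add: inner_add_left power2_norm_eq_inner[symmetric] power2_eq_square)
  also have "\<dots> \<le> norm (h + L \<mu> \<nu> h) * norm h" by (rule norm_cauchy_schwarz)
  finally show ?thesis by (cases "norm h = 0") (auto simp: mult_le_cancel_right)
qed

text \<open>An exact identity rather than an expansion, because 1/p - 1/q = (q - p)/(p q).\<close>

lemma B_linearization: "Phi \<mu> (a \<nu>) - Phi \<nu> (a \<nu>) = (B \<mu> - B \<nu>) + L \<mu> \<nu> (B \<mu> - B \<nu>)"
proof -
  have i: "integrable \<mu> (a \<nu>)" "integrable \<mu> (a \<mu>)"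
    using integrable_continuous_prob[OF \<mu> a_continuous[OF \<nu>]] a_integrable[OF \<mu>] by auto
  have "L \<mu> \<nu> (B \<mu> - B \<nu>) = Phi \<mu> (\<lambda>x. a \<nu> x - a \<mu> x)"
    unfolding L_def
  proof (intro arg_cong[where f = "Phi \<mu>"] ext)
    show "a \<mu> x * a \<nu> x * ev (B \<mu> - B \<nu>) x = a \<nu> x - a \<mu> x" for x
      using a_diff[OF \<mu> \<nu>, of x] by linarith
  qed
  also have "\<dots> = Phi \<mu> (a \<nu>) - B \<mu>" unfolding Phi_diff[OF \<mu> i] by (simp add: B_eq_Phi)
  finally show ?thesis by (simp add: B_eq_Phi[of \<nu>, symmetric])
qed

end

lemma L_self: "L \<mu> \<mu> h = A \<mu> h"
  if "\<mu> \<in> prob_measures"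
  unfolding L_def A_def[OF that] E_eq[OF that] by (simp only: mult.assoc)

end

locale weak_star_path = gibbs_rkhs c \<epsilon> \<delta> ev
  for c :: "'a::metric_space \<Rightarrow> 'a \<Rightarrow> real" and \<epsilon> \<delta> :: real
    and ev :: "'h::{real_inner,banach,second_countable_topology} \<Rightarrow> 'a \<Rightarrow> real" +
  fixes \<nu> :: "real \<Rightarrow> 'a measure"
  assumes path: "t \<in> {0..1} \<Longrightarrow> \<nu> t \<in> prob_measures"
    and weak: "weak_star_continuous_path \<nu>"
begin

section \<open>Continuity along the path\<close>

lemma weak_tendsto:
  fixes g :: "'a \<Rightarrow> real"
  assumes s: "s \<in> {0..1}" and g: "continuous_on UNIV g"
  shows "((\<lambda>t. \<integral>x. g x \<partial>\<nu> t) \<longlongrightarrow> (\<integral>x. g x \<partial>\<nu> s)) (at s within {0..1})"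
proof -
  have "continuous_on {0..1} (\<lambda>t. \<integral>x. apply_bcontfun (Bcontfun g) x \<partial>\<nu> t)"
    using weak unfolding weak_star_continuous_path_def by blast
  then show ?thesis using s unfolding Bcontfun_continuous[OF g] continuous_on_def by blast
qed

lemma eventually_in_unit: "eventually (\<lambda>t. t \<in> {0..1}) (at s within {0..1::real})"
  by (auto simp: eventually_at_filter)

text \<open>Weak convergence gives convergence of the evaluations at each point, and a finite net
  makes it uniform. The squared norm of the difference \<open>D\<close> of the embeddings is a
  difference of two integrals of \<open>g * ev D\<close>, hence small with the supremum of
  \<open>ev D\<close>.\<close>

lemma Phi_tendsto_fixed:
  assumes s: "s \<in> {0..1}" and g: "continuous_on UNIV g"
  shows "((\<lambda>t. Phi (\<nu> t) g) \<longlongrightarrow> Phi (\<nu> s) g) (at s within {0..1})"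
proof -
  obtain C0 where C0: "\<And>x. norm (g x) \<le> C0" using continuous_bounded[OF g] by blast
  define C where "C = max C0 1"
  have C: "C > 0" "\<bar>g x\<bar> \<le> C" for x using C0[of x] by (auto simp: C_def)
  have gi: "integrable (\<nu> t) g" if "t \<in> {0..1}" for t
    by (rule integrable_continuous_prob[OF path[OF that] g])
  have evP: "ev (Phi (\<nu> t) g) y = (\<integral>x. g x * ev (e y) x \<partial>\<nu> t)" if "t \<in> {0..1}" for t y
    unfolding ev_e by (rule ev_Phi[OF path[OF that] gi[OF that]])
  have pt: "((\<lambda>t. ev (Phi (\<nu> t) g) y) \<longlongrightarrow> ev (Phi (\<nu> s) g) y) (at s within {0..1})" for y
  proof (rule Lim_transform_eventually)
    show "((\<lambda>t. \<integral>x. g x * ev (e y) x \<partial>\<nu> t) \<longlongrightarrow> ev (Phi (\<nu> s) g) y) (at s within {0..1})"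
      unfolding evP[OF s] by (intro weak_tendsto s continuous_intros g ev_continuous)
    show "eventually (\<lambda>t. (\<integral>x. g x * ev (e y) x \<partial>\<nu> t) = ev (Phi (\<nu> t) g) y) (at s within {0..1})"
      using eventually_in_unit by eventually_elim (simp only: evP)
  qed
  show ?thesis
  proof (rule tendstoI)
    fix \<theta> :: real assume \<theta>: "\<theta> > 0"
    \<comment> \<open>Chosen so that the final bound 6 C^2 \<eta> stays below \<theta>^2.\<close>
    define \<eta> where "\<eta> = \<theta>\<^sup>2 / (8 * C * C)"
    have \<eta>: "\<eta> > 0" using \<theta> C by (simp add: \<eta>_def)
    obtain Y where Y: "finite Y" "\<And>y. \<exists>z\<in>Y. norm (e y - e z) < \<eta>" using finite_net[OF \<eta>] by blast
    have "eventually (\<lambda>t. \<forall>z\<in>Y. \<bar>ev (Phi (\<nu> t) g) z - ev (Phi (\<nu> s) g) z\<bar> < C * \<eta>) (at s within {0..1})"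
      unfolding eventually_ball_finite_distrib[OF Y(1)]
    proof
      fix z
      show "eventually (\<lambda>t. \<bar>ev (Phi (\<nu> t) g) z - ev (Phi (\<nu> s) g) z\<bar> < C * \<eta>) (at s within {0..1})"
        using tendstoD[OF pt[of z], of "C * \<eta>"] C \<eta> by (simp add: dist_real_def)
    qed
    then show "eventually (\<lambda>t. dist (Phi (\<nu> t) g) (Phi (\<nu> s) g) < \<theta>) (at s within {0..1})"
      using eventually_in_unit
    proof eventually_elim
      case (elim t)
      let ?D = "Phi (\<nu> t) g - Phi (\<nu> s) g"
      have nP: "norm (Phi (\<nu> r) g) \<le> C" if "r \<in> {0..1}" for r
        by (rule Phi_norm_le[OF path[OF that] g C(2)])
      have nD: "norm ?D \<le> 2 * C"
        using norm_triangle_ineq4[of "Phi (\<nu> t) g" "Phi (\<nu> s) g"] nP[OF elim(2)] nP[OF s] by linarith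
      have evD: "\<bar>ev ?D y\<bar> \<le> 3 * C * \<eta>" for y
      proof -
        obtain z where z: "z \<in> Y" "norm (e y - e z) < \<eta>" using Y(2) by blast
        have "ev ?D y = ev ?D z + ?D \<bullet> (e y - e z)"
          unfolding ev_inner[of ?D y] ev_inner[of ?D z] inner_diff_right[of ?D] by simp
        moreover have "\<bar>?D \<bullet> (e y - e z)\<bar> \<le> 2 * C * \<eta>"
          using z(2) nD C by (intro order_trans[OF Cauchy_Schwarz_ineq2] mult_mono) auto
        moreover have "\<bar>ev ?D z\<bar> \<le> C * \<eta>" using elim(1) z(1) by (auto intro: less_imp_le)
        ultimately show ?thesis by linarith
      qed
      have inn: "\<bar>Phi (\<nu> r) g \<bullet> ?D\<bar> \<le> C * (3 * C * \<eta>)" if r: "r \<in> {0..1}" for r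
      proof -
        have "\<bar>Phi (\<nu> r) g \<bullet> ?D\<bar> = norm (\<integral>x. g x * ev ?D x \<partial>\<nu> r)"
          unfolding Phi_inner[OF path[OF r] gi[OF r]] by simp
        also have "\<dots> \<le> (\<integral>x. norm (g x * ev ?D x) \<partial>\<nu> r)" by (rule integral_norm_bound)
        also have "\<dots> \<le> (\<integral>x. C * (3 * C * \<eta>) \<partial>\<nu> r)"
        proof (rule Bochner_Integration.integral_mono)
          show "integrable (\<nu> r) (\<lambda>x. norm (g x * ev ?D x))"
            by (intro integrable_norm integrable_continuous_prob[OF path[OF r]] continuous_intros g ev_continuous)
          show "integrable (\<nu> r) (\<lambda>x. C * (3 * C * \<eta>))"
            by (rule integrable_continuous_prob[OF path[OF r] continuous_on_const])
          show "norm (g x * ev ?D x) \<le> C * (3 * C * \<eta>)" for x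
            unfolding real_norm_def abs_mult using C(1) by (intro mult_mono C(2) evD) auto
        qed
        also have "\<dots> = C * (3 * C * \<eta>)" by (rule prob_measure_1[OF path[OF r]])
        finally show ?thesis .
      qed
      have "(norm ?D)\<^sup>2 = Phi (\<nu> t) g \<bullet> ?D - Phi (\<nu> s) g \<bullet> ?D"
        unfolding power2_norm_eq_inner by (rule inner_diff_left)
      also have "\<dots> \<le> 6 * C * C * \<eta>" using inn[OF elim(2)] inn[OF s] by linarith
      also have "\<dots> < \<theta>\<^sup>2" using C(1) \<theta> by (simp add: \<eta>_def field_simps)
      finally show ?case unfolding dist_norm using \<theta> by (intro power2_less_imp_less[of _ \<theta>]) auto
    qed
  qed
qed

lemma Phi_tendsto:
  assumes s: "s \<in> {0..1}" and g: "\<And>t. t \<in> {0..1} \<Longrightarrow> continuous_on UNIV (g t)"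
    and lim: "\<And>\<theta>. \<theta> > 0 \<Longrightarrow> eventually (\<lambda>t. \<forall>x. \<bar>g t x - g s x\<bar> \<le> \<theta>) (at s within {0..1})"
  shows "((\<lambda>t. Phi (\<nu> t) (g t)) \<longlongrightarrow> Phi (\<nu> s) (g s)) (at s within {0..1})"
proof (rule tendstoI)
  fix \<theta> :: real assume \<theta>: "\<theta> > 0"
  have "eventually (\<lambda>t. dist (Phi (\<nu> t) (g s)) (Phi (\<nu> s) (g s)) < \<theta> / 2) (at s within {0..1})"
    using tendstoD[OF Phi_tendsto_fixed[OF s g[OF s]], of "\<theta>/2"] \<theta> by simp
  moreover have "eventually (\<lambda>t. \<forall>x. \<bar>g t x - g s x\<bar> \<le> \<theta> / 4) (at s within {0..1})"
    by (rule lim) (use \<theta> in simp)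
  ultimately show "eventually (\<lambda>t. dist (Phi (\<nu> t) (g t)) (Phi (\<nu> s) (g s)) < \<theta>) (at s within {0..1})"
    using eventually_in_unit
  proof eventually_elim
    case (elim t)
    have "norm (Phi (\<nu> t) (g t) - Phi (\<nu> t) (g s)) \<le> \<theta> / 4"
      using elim(2) by (intro Phi_scaled_diff_le path elim g s) blast
    then show ?case
      using elim(1) \<theta> dist_triangle[of "Phi (\<nu> t) (g t)" "Phi (\<nu> s) (g s)" "Phi (\<nu> t) (g s)"]
      by (simp add: dist_norm)
  qed
qed

lemma B_tendsto:
  assumes s: "s \<in> {0..1}"
  shows "((\<lambda>t. B (\<nu> t)) \<longlongrightarrow> B (\<nu> s)) (at s within {0..1})"
proof -
  have "((\<lambda>t. norm (Phi (\<nu> t) (a (\<nu> s)) - Phi (\<nu> s) (a (\<nu> s)))) \<longlongrightarrow> 0) (at s within {0..1})"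
    using Phi_tendsto_fixed[OF s a_continuous[OF path[OF s]]] by (simp add: LIM_zero tendsto_norm_zero)
  then have "((\<lambda>t. B (\<nu> t) - B (\<nu> s)) \<longlongrightarrow> 0) (at s within {0..1})"
    by (rule Lim_null_comparison[rotated])
      (use eventually_in_unit in \<open>eventually_elim, intro B_diff_le path s\<close>)
  then show ?thesis by (rule LIM_zero_cancel)
qed

lemma B_continuous_on: "continuous_on {0..1} (\<lambda>t. B (\<nu> t))"
  unfolding continuous_on_def using B_tendsto by blast

lemma a_eventually_close:
  assumes s: "s \<in> {0..1}" and \<theta>: "\<theta> > 0"
  shows "eventually (\<lambda>t. \<forall>x. \<bar>a (\<nu> t) x - a (\<nu> s) x\<bar> \<le> \<theta>) (at s within {0..1})"
proof -
  have "eventually (\<lambda>t. dist (B (\<nu> t)) (B (\<nu> s)) < \<theta> * \<delta>\<^sup>2) (at s within {0..1})"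
    using tendstoD[OF B_tendsto[OF s]] \<theta> delta_pos by simp
  then show ?thesis
    using eventually_in_unit
  proof eventually_elim
    case (elim t)
    show ?case
    proof
      fix x
      have "\<bar>a (\<nu> t) x - a (\<nu> s) x\<bar> \<le> norm (B (\<nu> t) - B (\<nu> s)) / \<delta>\<^sup>2"
        by (intro a_diff_le path elim s)
      also have "\<dots> \<le> \<theta>" using elim(1) delta_pos by (simp add: dist_norm divide_le_eq)
      finally show "\<bar>a (\<nu> t) x - a (\<nu> s) x\<bar> \<le> \<theta>" .
    qed
  qed
qed

text \<open>Strong convergence: for fixed \<open>h\<close> the scalings converge uniformly and the
  measures weakly. The quotients below combine this with the uniform bound
  \<open>L_norm_le\<close>.\<close>

lemma L_tendsto:
  assumes s: "s \<in> {0..1}"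
  shows "((\<lambda>t. L (\<nu> t) (\<nu> s) h) \<longlongrightarrow> A (\<nu> s) h) (at s within {0..1})"
  unfolding L_self[OF path[OF s], symmetric] L_def
proof (rule Phi_tendsto[OF s, where g = "\<lambda>t x. a (\<nu> t) x * a (\<nu> s) x * ev h x"])
  show "continuous_on UNIV (\<lambda>x. a (\<nu> t) x * a (\<nu> s) x * ev h x)" if "t \<in> {0..1}" for t
    by (rule L_integrand[OF path[OF that] path[OF s]])
  fix \<theta> :: real assume \<theta>: "\<theta> > 0"
  \<comment> \<open>The summand 1 makes \<open>M\<close> positive also for h = 0.\<close>
  define M where "M = (1 / \<delta>) * norm h + 1"
  have M: "M > 0" using delta_pos by (simp add: M_def add_nonneg_pos)
  have "eventually (\<lambda>t. \<forall>x. \<bar>a (\<nu> t) x - a (\<nu> s) x\<bar> \<le> \<theta> / M) (at s within {0..1})"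
    by (rule a_eventually_close[OF s]) (use \<theta> M in simp)
  then show "eventually (\<lambda>t. \<forall>x. \<bar>a (\<nu> t) x * a (\<nu> s) x * ev h x - a (\<nu> s) x * a (\<nu> s) x * ev h x\<bar> \<le> \<theta>) (at s within {0..1})"
  proof eventually_elim
    case (elim t)
    show ?case
    proof
      fix x
      have as: "0 \<le> a (\<nu> s) x" "a (\<nu> s) x \<le> 1 / \<delta>"
        using a_pos[OF path[OF s], of x] a_le[OF path[OF s], of x] by auto
      have "\<bar>a (\<nu> t) x * a (\<nu> s) x * ev h x - a (\<nu> s) x * a (\<nu> s) x * ev h x\<bar>
         = \<bar>a (\<nu> t) x - a (\<nu> s) x\<bar> * (a (\<nu> s) x * \<bar>ev h x\<bar>)"
        using as by (simp add: left_diff_distrib[symmetric] abs_mult mult.assoc)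
      also have "\<dots> \<le> \<theta> / M * ((1 / \<delta>) * norm h)"
        using elim as ev_bound[of h x] \<theta> M delta_pos by (intro mult_mono) auto
      also have "\<dots> \<le> \<theta> / M * M" using \<theta> M by (intro mult_left_mono) (auto simp: M_def)
      also have "\<dots> = \<theta>" using M by simp
      finally show "\<bar>a (\<nu> t) x * a (\<nu> s) x * ev h x - a (\<nu> s) x * a (\<nu> s) x * ev h x\<bar> \<le> \<theta>" .
    qed
  qed
qed

text \<open>Represents the difference quotient of the measures in the dual of the RKHS of the
  self-kernel of \<open>\<nu> s\<close>; this is why the scaling stays frozen at
  \<open>s\<close>.\<close>

definition RQ :: "real \<Rightarrow> real \<Rightarrow> 'h" where
  "RQ s t = (Phi (\<nu> t) (a (\<nu> s)) - Phi (\<nu> s) (a (\<nu> s))) /\<^sub>R (t - s)"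

definition BQ :: "real \<Rightarrow> real \<Rightarrow> 'h" where
  "BQ s t = (B (\<nu> t) - B (\<nu> s)) /\<^sub>R (t - s)"

lemma RQ_BQ:
  assumes "s \<in> {0..1}" "t \<in> {0..1}"
  shows "RQ s t = BQ s t + L (\<nu> t) (\<nu> s) (BQ s t)"
  unfolding RQ_def BQ_def B_linearization[OF path[OF assms(2)] path[OF assms(1)]]
  by (simp only: L_scale[OF path[OF assms(2)] path[OF assms(1)]] scaleR_add_right)

lemma L_norm_le:
  assumes "\<mu> \<in> prob_measures" "\<mu>' \<in> prob_measures"
  shows "norm (L \<mu> \<mu>' h) \<le> norm h / \<delta>\<^sup>2"
  unfolding L_def
proof (rule Phi_norm_le[OF assms(1) L_integrand[OF assms]])
  fix x
  have "\<bar>a \<mu> x * a \<mu>' x * ev h x\<bar> = (a \<mu> x * a \<mu>' x) * \<bar>ev h x\<bar>"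
    using a_mult_bounds(1)[OF assms, of x] by (simp only: abs_mult[of "a \<mu> x * a \<mu>' x"] abs_of_nonneg)
  also have "\<dots> \<le> (1 / \<delta>\<^sup>2) * norm h"
    by (rule mult_mono[OF a_mult_bounds(2)[OF assms] ev_bound]) auto
  finally show "\<bar>a \<mu> x * a \<mu>' x * ev h x\<bar> \<le> norm h / \<delta>\<^sup>2" by simp
qed

text \<open>In \<open>RQ_BQ\<close> the quotient of \<open>B\<close> is split into \<open>v\<close>
  and a remainder: \<open>L\<close> converges strongly at \<open>v\<close>, and its uniform bound
  disposes of the remainder.\<close>

lemma RQ_tendsto:
  assumes s: "s \<in> {0..1}" and v: "(BQ s \<longlongrightarrow> v) (at s within {0..1})"
  shows "(RQ s \<longlongrightarrow> v + A (\<nu> s) v) (at s within {0..1})"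
proof -
  have "((\<lambda>t. L (\<nu> t) (\<nu> s) (BQ s t - v)) \<longlongrightarrow> 0) (at s within {0..1})"
  proof (rule Lim_null_comparison)
    show "eventually (\<lambda>t. norm (L (\<nu> t) (\<nu> s) (BQ s t - v)) \<le> norm (BQ s t - v) / \<delta>\<^sup>2) (at s within {0..1})"
      using eventually_in_unit by eventually_elim (intro L_norm_le path s)
    have "((\<lambda>t. norm (BQ s t - v) / \<delta>\<^sup>2) \<longlongrightarrow> norm (v - v) / \<delta>\<^sup>2) (at s within {0..1})"
      using delta_pos by (intro tendsto_intros v) auto
    then show "((\<lambda>t. norm (BQ s t - v) / \<delta>\<^sup>2) \<longlongrightarrow> 0) (at s within {0..1})" by simp
  qed
  from tendsto_add[OF tendsto_add[OF v L_tendsto[OF s, of v]] this]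
  have "((\<lambda>t. BQ s t + L (\<nu> t) (\<nu> s) v + L (\<nu> t) (\<nu> s) (BQ s t - v)) \<longlongrightarrow> v + A (\<nu> s) v) (at s within {0..1})"
    by simp
  then show ?thesis
  proof (rule Lim_transform_eventually)
    show "eventually (\<lambda>t. BQ s t + L (\<nu> t) (\<nu> s) v + L (\<nu> t) (\<nu> s) (BQ s t - v) = RQ s t) (at s within {0..1})"
      using eventually_in_unit
      by eventually_elim (simp add: RQ_BQ[OF s] L_diff[OF path path[OF s]])
  qed
qed

text \<open>The candidate \<open>v\<close> comes from inverting id + A at \<open>S\<close>, and
  coercivity of id + L bounds \<open>BQ s t - v\<close> by a quantity that tends to 0.
  \<open>S\<close> is orthogonal to \<open>B (\<nu> s)\<close> because all measures of the path have
  mass 1.\<close>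

lemma BQ_tendsto:
  assumes s: "s \<in> {0..1}" and S: "(RQ s \<longlongrightarrow> S) (at s within {0..1})"
  obtains v where "(BQ s \<longlongrightarrow> v) (at s within {0..1})" "S = v + A (\<nu> s) v" "B (\<nu> s) \<bullet> v = 0"
proof -
  have nt: "at s within {0..1::real} \<noteq> bot"
    using s by (simp add: trivial_limit_within islimpt_Icc)
  have "B (\<nu> s) \<bullet> Phi (\<nu> t) (a (\<nu> s)) = 1" if t: "t \<in> {0..1}" for t
  proof -
    have "Phi (\<nu> t) (a (\<nu> s)) \<bullet> B (\<nu> s) = (\<integral>x. a (\<nu> s) x * ev (B (\<nu> s)) x \<partial>\<nu> t)"
      by (rule Phi_inner[OF path[OF t] integrable_continuous_prob[OF path[OF t] a_continuous[OF path[OF s]]]])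
    also have "\<dots> = (\<integral>x. 1 \<partial>\<nu> t)"
      using a_pos[OF path[OF s]] by (intro Bochner_Integration.integral_cong refl) (simp add: ev_B[OF path[OF s]] less_imp_neq[symmetric])
    also have "\<dots> = 1" by (rule prob_measure_1[OF path[OF t]])
    finally show ?thesis by (simp only: inner_commute)
  qed
  then have "B (\<nu> s) \<bullet> RQ s t = 0" if "t \<in> {0..1}" for t
    using that s by (simp add: RQ_def inner_diff_right)
  then have "eventually (\<lambda>t. B (\<nu> s) \<bullet> RQ s t = 0) (at s within {0..1})"
    using eventually_in_unit by (rule eventually_mono[rotated])
  then have "((\<lambda>t. B (\<nu> s) \<bullet> RQ s t) \<longlongrightarrow> 0) (at s within {0..1})" by (rule tendsto_eventually)
  moreover have "((\<lambda>t. B (\<nu> s) \<bullet> RQ s t) \<longlongrightarrow> B (\<nu> s) \<bullet> S) (at s within {0..1})"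
    by (intro tendsto_intros S)
  ultimately have "B (\<nu> s) \<bullet> S = 0" using tendsto_unique[OF nt] by blast
  then obtain v where v: "B (\<nu> s) \<bullet> v = 0" "v - (-1) *\<^sub>R A (\<nu> s) v = S"
    using A_solve[OF path[OF s], of S "-1"] by auto
  have Sv: "S = v + A (\<nu> s) v" using v(2) by simp
  have "((\<lambda>t. norm (RQ s t - (v + L (\<nu> t) (\<nu> s) v))) \<longlongrightarrow> norm (S - (v + A (\<nu> s) v))) (at s within {0..1})"
    by (intro tendsto_intros S L_tendsto s)
  then have lim: "((\<lambda>t. norm (RQ s t - (v + L (\<nu> t) (\<nu> s) v))) \<longlongrightarrow> 0) (at s within {0..1})"
    by (simp add: Sv)
  have "((\<lambda>t. BQ s t - v) \<longlongrightarrow> 0) (at s within {0..1})"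
  proof (rule Lim_null_comparison[OF _ lim])
    show "eventually (\<lambda>t. norm (BQ s t - v) \<le> norm (RQ s t - (v + L (\<nu> t) (\<nu> s) v))) (at s within {0..1})"
      using eventually_in_unit
    proof eventually_elim
      case (elim t)
      have eq: "RQ s t - (v + L (\<nu> t) (\<nu> s) v) = (BQ s t - v) + L (\<nu> t) (\<nu> s) (BQ s t - v)"
        unfolding RQ_BQ[OF s elim] L_diff[OF path[OF elim] path[OF s]] by simp
      show ?case unfolding eq by (rule L_coercive[OF path[OF elim] path[OF s]])
    qed
  qed
  then have "(BQ s \<longlongrightarrow> v) (at s within {0..1})" using LIM_zero_iff[of "BQ s" v] by simp
  then show ?thesis using that Sv v(1) by blast
qed

section \<open>Strong derivatives as limits of representers\<close>

lemma measure_functional_eq: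
  assumes s: "s \<in> {0..1}" and t: "t \<in> {0..1}"
  shows "measure_functional (self_ev c \<epsilon> ev (\<nu> s)) (\<nu> t) = blinfun_inner_right (Phi (\<nu> t) (a (\<nu> s)))"
proof -
  have "(\<integral>x. self_ev c \<epsilon> ev (\<nu> s) h x \<partial>\<nu> t) = Phi (\<nu> t) (a (\<nu> s)) \<bullet> h" for h
    unfolding self_ev_def
    by (rule Phi_inner[OF path[OF t] integrable_continuous_prob[OF path[OF t] a_continuous[OF path[OF s]]], symmetric])
  then have "measure_functional (self_ev c \<epsilon> ev (\<nu> s)) (\<nu> t) = Blinfun ((\<bullet>) (Phi (\<nu> t) (a (\<nu> s))))"
    unfolding measure_functional_def by simp
  also have "\<dots> = Blinfun (blinfun_apply (blinfun_inner_right (Phi (\<nu> t) (a (\<nu> s)))))" by simp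
  also have "\<dots> = blinfun_inner_right (Phi (\<nu> t) (a (\<nu> s)))" by (rule blinfun_apply_inverse)
  finally show ?thesis .
qed

lemma norm_blinfun_inner_right: "norm (blinfun_inner_right x) = norm x"
proof (rule antisym)
  show "norm (blinfun_inner_right x) \<le> norm x"
    by (rule norm_blinfun_bound) (simp_all add: Cauchy_Schwarz_ineq2)
  have "norm x * norm x = norm (blinfun_apply (blinfun_inner_right x) x)"
    by (simp add: power2_norm_eq_inner[symmetric] power2_eq_square)
  also have "\<dots> \<le> norm (blinfun_inner_right x) * norm x" by (rule norm_blinfun)
  finally show "norm x \<le> norm (blinfun_inner_right x)"
    by (cases "norm x = 0") (auto simp: mult_le_cancel_right)
qed

text \<open>The Riesz map is an isometry, so limits of functionals and of representers correspond.
  The representer of a limit comes from completeness, along a sequence of times tending to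
  \<open>s\<close>.\<close>

lemma has_strong_derivative_iff:
  assumes s: "s \<in> {0..1}"
  shows "has_strong_derivative c \<epsilon> ev \<nu> s \<sigma> \<longleftrightarrow>
    (\<exists>S. \<sigma> = blinfun_inner_right S \<and> (RQ s \<longlongrightarrow> S) (at s within {0..1}))"
proof -
  let ?M = "measure_functional (self_ev c \<epsilon> ev (\<nu> s))" and ?J = "blinfun_inner_right :: 'h \<Rightarrow> 'h \<Rightarrow>\<^sub>L real"
  let ?F = "at s within {0..1::real}"
  interpret J: bounded_linear ?J by (rule bounded_linear_blinfun_inner_right)
  have nt: "?F \<noteq> bot" using s by (simp add: trivial_limit_within islimpt_Icc)
  have eq: "(?M (\<nu> t) - ?M (\<nu> s)) /\<^sub>R (t - s) = ?J (RQ s t)" if "t \<in> {0..1}" for t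
    by (simp add: measure_functional_eq[OF s that] measure_functional_eq[OF s s] RQ_def J.diff J.scaleR)
  have ev: "eventually (\<lambda>t. (?M (\<nu> t) - ?M (\<nu> s)) /\<^sub>R (t - s) = ?J (RQ s t)) ?F"
    using eventually_in_unit by eventually_elim (rule eq)
  have iff: "has_strong_derivative c \<epsilon> ev \<nu> s \<sigma> \<longleftrightarrow> ((\<lambda>t. ?J (RQ s t)) \<longlongrightarrow> \<sigma>) ?F"
    unfolding has_strong_derivative_def Let_def by (rule tendsto_cong[OF ev])
  show ?thesis
    unfolding iff
  proof
    assume lim: "((\<lambda>t. ?J (RQ s t)) \<longlongrightarrow> \<sigma>) ?F"
    obtain f where f: "\<And>n. f n \<in> {0..1} - {s}" "f \<longlonglongrightarrow> s"
      using s islimpt_sequential[of s "{0..1}"] by (auto simp: islimpt_Icc)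
    have fF: "filterlim f ?F sequentially"
      using f by (auto simp: filterlim_at)
    have limf: "(\<lambda>n. ?J (RQ s (f n))) \<longlonglongrightarrow> \<sigma>" by (rule filterlim_compose[OF lim fF])
    have dJ: "dist (RQ s t) S = dist (?J (RQ s t)) (?J S)" for t S
      by (simp add: dist_norm J.diff[symmetric] norm_blinfun_inner_right)
    have "Cauchy (\<lambda>n. RQ s (f n))"
      using LIMSEQ_imp_Cauchy[OF limf] unfolding Cauchy_def dJ .
    then obtain S where S: "(\<lambda>n. RQ s (f n)) \<longlonglongrightarrow> S" using Cauchy_convergent convergent_def by blast
    have \<sigma>: "\<sigma> = ?J S" by (rule LIMSEQ_unique[OF limf J.tendsto[OF S]])
    have "((\<lambda>t. dist (RQ s t) S) \<longlongrightarrow> 0) ?F"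
      unfolding dJ \<sigma>[symmetric] using lim by (rule tendsto_dist_iff[THEN iffD1])
    then have "(RQ s \<longlongrightarrow> S) ?F" by (rule tendsto_dist_iff[THEN iffD2])
    then show "\<exists>S. \<sigma> = ?J S \<and> (RQ s \<longlongrightarrow> S) ?F" using \<sigma> by blast
  next
    assume "\<exists>S. \<sigma> = ?J S \<and> (RQ s \<longlongrightarrow> S) ?F"
    then show "((\<lambda>t. ?J (RQ s t)) \<longlongrightarrow> \<sigma>) ?F" using J.tendsto by blast
  qed
qed

end

section \<open>The characterization of admissible paths\<close>

text \<open>\<open>AC_curve\<close> controls a curve only on the open interval; shrinking by
  \<open>r n\<close> at both ends and continuity reach the end points.\<close>

lemma AC_extend_closed:
  fixes F :: "real \<Rightarrow> 'h::{banach,second_countable_topology}" and m :: "real \<Rightarrow> real"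
  assumes F: "continuous_on {0..1} F" and m: "integrable (lebesgue_on {0..1}) m"
    and bd: "\<And>s t. 0 < s \<Longrightarrow> s \<le> t \<Longrightarrow> t < 1 \<Longrightarrow> norm (F t - F s) \<le> (\<integral>\<tau>. m \<tau> \<partial>lebesgue_on {s..t})"
    and st: "0 \<le> s" "s \<le> t" "t \<le> 1"
  shows "norm (F t - F s) \<le> (\<integral>\<tau>. \<bar>m \<tau>\<bar> \<partial>lebesgue_on {s..t})"
proof -
  have am: "integrable (lebesgue_on {0..1}) (\<lambda>\<tau>. \<bar>m \<tau>\<bar>)" using m by simp
  define G where "G t = (\<integral>\<tau>. \<bar>m \<tau>\<bar> \<partial>lebesgue_on {0..t})" for t
  have G: "primitive_on01 G (\<lambda>\<tau>. \<bar>m \<tau>\<bar>)" unfolding G_def[abs_def] by (rule primitive_on01_indefinite[OF am])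
  have cG: "continuous_on {0..1} G" by (rule primitive_on01_continuous[OF G])
  have int: "norm (F t - F s) \<le> G t - G s" if "0 < s" "s \<le> t" "t < 1" for s t
  proof -
    have "norm (F t - F s) \<le> (\<integral>\<tau>. m \<tau> \<partial>lebesgue_on {s..t})" by (rule bd[OF that])
    also have "\<dots> \<le> (\<integral>\<tau>. \<bar>m \<tau>\<bar> \<partial>lebesgue_on {s..t})"
      using that by (intro Bochner_Integration.integral_mono integrable_lebesgue_on_subset[OF m] integrable_lebesgue_on_subset[OF am]) auto
    finally show ?thesis using primitive_on01_diff[OF G, of s t] that by simp
  qed
  have "norm (F t - F s) \<le> G t - G s"
  proof (cases "s = t")
    case False
    \<comment> \<open>At most half the length, so that the shrunken end points keep their
      order.\<close>
    define r where "r n = (t - s) / real (Suc (Suc n))" for n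
    have r: "0 < r n" "r n \<le> (t - s) / 2" for n
    proof -
      show "0 < r n" using False st by (simp add: r_def)
      show "r n \<le> (t - s) / 2" unfolding r_def using False st by (intro divide_left_mono) auto
    qed
    have r0: "r \<longlonglongrightarrow> 0"
      unfolding r_def by (intro real_tendsto_divide_at_top[OF tendsto_const]
          filterlim_compose[OF filterlim_real_sequentially] filterlim_compose[OF filterlim_Suc filterlim_Suc])
    have in01: "s + r n \<in> {0..1}" "t - r n \<in> {0..1}" "0 < s + r n" "s + r n \<le> t - r n" "t - r n < 1" for n
      using r[of n] st by auto
    have lims: "(\<lambda>n. s + r n) \<longlonglongrightarrow> s" "(\<lambda>n. t - r n) \<longlonglongrightarrow> t"
      using tendsto_add[OF tendsto_const r0, of s] tendsto_diff[OF tendsto_const r0, of t] by simp_all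
    have lim: "(\<lambda>n. f (s + r n)) \<longlonglongrightarrow> f s" "(\<lambda>n. f (t - r n)) \<longlonglongrightarrow> f t" if "continuous_on {0..1} f"
      for f :: "real \<Rightarrow> 'z::topological_space"
      using st in01 by (auto intro!: continuous_on_tendsto_compose[OF that] lims always_eventually)
    show ?thesis
    proof (rule LIMSEQ_le)
      show "(\<lambda>n. norm (F (t - r n) - F (s + r n))) \<longlonglongrightarrow> norm (F t - F s)"
        by (intro tendsto_norm tendsto_diff lim F)
      show "(\<lambda>n. G (t - r n) - G (s + r n)) \<longlonglongrightarrow> G t - G s"
        by (intro tendsto_diff lim cG)
      show "\<exists>N. \<forall>n\<ge>N. norm (F (t - r n) - F (s + r n)) \<le> G (t - r n) - G (s + r n)"
        using int[OF in01(3-5)] by blast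
    qed
  qed simp
  then show ?thesis using primitive_on01_diff[OF G st] by simp
qed

lemma AC_curveE:
  assumes "AC_curve p d 0 1 \<gamma>" "p = 1 \<or> p = 2"
  obtains m where "integrable (lebesgue_on {0..1}) m" "p = 2 \<Longrightarrow> integrable (lebesgue_on {0..1}) (\<lambda>t. (m t)\<^sup>2)"
    "\<And>s t. 0 < s \<Longrightarrow> s \<le> t \<Longrightarrow> t < 1 \<Longrightarrow> d (\<gamma> s) (\<gamma> t) \<le> (\<integral>\<tau>. m \<tau> \<partial>lebesgue_on {s..t})"
proof -
  obtain m where mm: "m \<in> borel_measurable (lebesgue_on {0..1})"
    and mp: "integrable (lebesgue_on {0..1}) (\<lambda>t. \<bar>m t\<bar> powr p)"
    and bd: "\<forall>s t. 0 < s \<and> s \<le> t \<and> t < 1 \<longrightarrow> d (\<gamma> s) (\<gamma> t) \<le> (\<integral>\<tau>. m \<tau> \<partial>lebesgue_on {s..t})"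
    using assms(1) unfolding AC_curve_def by (auto simp: borel_measurable_Icc_iff_Ioo integrable_Icc_iff_Ioo)
  have p2: "integrable (lebesgue_on {0..1}) (\<lambda>t. (m t)\<^sup>2)" if "p = 2"
    using mp that by simp
  have "integrable (lebesgue_on {0..1}) m"
    using assms(2)
  proof
    assume "p = 1"
    then have "integrable (lebesgue_on {0..1}) (\<lambda>t. norm (m t))" using mp by simp
    then show ?thesis by (rule Bochner_Integration.integrable_bound[OF _ mm]) simp
  next
    assume "p = 2"
    then show ?thesis using integral_norm_le_sqrt(1)[OF zero_le_one mm] p2 by simp
  qed
  then show ?thesis using that p2 bd by blast
qed

context gibbs_rkhs begin

text \<open>The squared norm of \<open>B\<close> is constantly 1 along the path, and its derivative
  is twice this pairing.\<close>

lemma B_tangent: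
  assumes P: "\<And>t. t \<in> {0..1} \<Longrightarrow> \<nu> t \<in> prob_measures" and t: "t \<in> {0<..<1::real}"
    and D: "((\<lambda>t. B (\<nu> t)) has_vector_derivative v) (at t)"
  shows "B (\<nu> t) \<bullet> v = 0"
proof -
  have "((\<lambda>t. B (\<nu> t) \<bullet> B (\<nu> t)) has_vector_derivative (B (\<nu> t) \<bullet> v + v \<bullet> B (\<nu> t))) (at t)"
    by (rule bounded_bilinear.has_vector_derivative[OF bounded_bilinear_inner D D])
  moreover have "((\<lambda>t. B (\<nu> t) \<bullet> B (\<nu> t)) has_vector_derivative 0) (at t)"
  proof (rule has_vector_derivative_transform_within_open[OF has_vector_derivative_const])
    show "1 = B (\<nu> t) \<bullet> B (\<nu> t)" if "t \<in> {0<..<1}" for t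
      using norm_B[OF P[of t]] that by (simp add: norm_eq_1)
  qed (use t in auto)
  ultimately have "B (\<nu> t) \<bullet> v + v \<bullet> B (\<nu> t) = 0" by (rule vector_derivative_unique_at)
  then show ?thesis by (simp add: inner_commute)
qed

section \<open>Increments of potentials against increments of \<open>B\<close>\<close>

lemma ln_diff_bounds:
  fixes x y r :: real
  assumes "0 < r" "r \<le> x" "r \<le> y" "x \<le> 1" "y \<le> 1"
  shows "\<bar>ln x - ln y\<bar> \<le> \<bar>x - y\<bar> / r" and "\<bar>x - y\<bar> \<le> \<bar>ln x - ln y\<bar>"
proof -
  have main: "ln x - ln y \<le> (x - y) / r \<and> x - y \<le> ln x - ln y"
    if "r \<le> y" "y \<le> x" "x \<le> 1" for x y
  proof -
    have p: "0 < y" "0 < x" using that \<open>0 < r\<close> by auto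
    have "ln x - ln y = ln (x / y)" using p by (simp add: ln_div)
    also have "\<dots> \<le> x / y - 1" using p by (intro ln_le_minus_one) simp
    also have "\<dots> = (x - y) / y" using p by (simp add: field_simps)
    also have "\<dots> \<le> (x - y) / r" using that p \<open>0 < r\<close> by (intro divide_left_mono) auto
    finally have 1: "ln x - ln y \<le> (x - y) / r" .
    have "ln y - ln x = ln (y / x)" using p by (simp add: ln_div)
    also have "\<dots> \<le> y / x - 1" using p by (intro ln_le_minus_one) simp
    also have "\<dots> = - ((x - y) / x)" using p by (simp add: field_simps)
    finally have "(x - y) / x \<le> ln x - ln y" by simp
    moreover have "(x - y) / 1 \<le> (x - y) / x" using that p by (intro divide_left_mono) auto
    ultimately show ?thesis using 1 by simp
  qed
  have "\<bar>ln x - ln y\<bar> \<le> \<bar>x - y\<bar> / r \<and> \<bar>x - y\<bar> \<le> \<bar>ln x - ln y\<bar>"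
  proof (cases "y \<le> x")
    case True
    then show ?thesis using main[OF assms(3) True assms(4)] by auto
  next
    case False
    then have xy: "x \<le> y" by simp
    have "ln x \<le> ln y" using xy assms by (intro ln_mono) auto
    then show ?thesis using main[OF assms(2) xy assms(5)] xy by (simp add: abs_if)
  qed
  then show "\<bar>ln x - ln y\<bar> \<le> \<bar>x - y\<bar> / r" "\<bar>x - y\<bar> \<le> \<bar>ln x - ln y\<bar>" by auto
qed

abbreviation pot :: "'a measure \<Rightarrow> 'a \<Rightarrow>\<^sub>C real" where "pot \<equiv> self_potential c \<epsilon>"

lemma dist_pot_eval:
  assumes "\<mu> \<in> prob_measures" "\<mu>' \<in> prob_measures"
  shows "dist (apply_bcontfun (pot \<mu>) x) (apply_bcontfun (pot \<mu>') x) = \<epsilon> * \<bar>ln (ev (B \<mu>) x) - ln (ev (B \<mu>') x)\<bar>"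
proof -
  have "- \<epsilon> * p - - \<epsilon> * q = - (\<epsilon> * (p - q))" for p q by (simp add: algebra_simps)
  then show ?thesis
    unfolding potential_eq[OF assms(1)] potential_eq[OF assms(2)] dist_real_def
    using eps_pos by (simp only: abs_minus_cancel abs_mult abs_of_pos)
qed

lemma dist_pot_le:
  assumes "\<mu> \<in> prob_measures" "\<mu>' \<in> prob_measures"
  shows "dist (pot \<mu>) (pot \<mu>') \<le> \<epsilon> / \<delta> * norm (B \<mu> - B \<mu>')"
proof (rule dist_bound)
  fix x
  have "dist (apply_bcontfun (pot \<mu>) x) (apply_bcontfun (pot \<mu>') x) = \<epsilon> * \<bar>ln (ev (B \<mu>) x) - ln (ev (B \<mu>') x)\<bar>"
    by (rule dist_pot_eval[OF assms])
  also have "\<dots> \<le> \<epsilon> * (\<bar>ev (B \<mu>) x - ev (B \<mu>') x\<bar> / \<delta>)"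
    using eps_pos by (intro mult_left_mono ln_diff_bounds delta_pos B_ge B_le_1 assms) auto
  also have "\<dots> \<le> \<epsilon> * (norm (B \<mu> - B \<mu>') / \<delta>)"
    using ev_bound[of "B \<mu> - B \<mu>'" x] eps_pos delta_pos by (intro mult_left_mono divide_right_mono) auto
  finally show "dist (apply_bcontfun (pot \<mu>) x) (apply_bcontfun (pot \<mu>') x) \<le> \<epsilon> / \<delta> * norm (B \<mu> - B \<mu>')"
    by simp
qed

lemma ev_B_diff_le_dist_pot:
  assumes "\<mu> \<in> prob_measures" "\<mu>' \<in> prob_measures"
  shows "\<bar>ev (B \<mu> - B \<mu>') x\<bar> \<le> dist (pot \<mu>) (pot \<mu>') / \<epsilon>"
proof -
  have "\<bar>ev (B \<mu>) x - ev (B \<mu>') x\<bar> \<le> \<bar>ln (ev (B \<mu>) x) - ln (ev (B \<mu>') x)\<bar>"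
    by (intro ln_diff_bounds(2)[OF delta_pos] B_ge B_le_1 assms)
  also have "\<epsilon> * \<dots> = dist (apply_bcontfun (pot \<mu>) x) (apply_bcontfun (pot \<mu>') x)"
    by (rule dist_pot_eval[OF assms, symmetric])
  finally have "\<epsilon> * \<bar>ev (B \<mu>) x - ev (B \<mu>') x\<bar> \<le> dist (pot \<mu>) (pot \<mu>')"
    using eps_pos dist_bounded[of "pot \<mu>" x "pot \<mu>'"] by (metis mult_le_cancel_left_pos order_trans)
  then show ?thesis using eps_pos by (simp add: pos_le_divide_eq mult.commute)
qed

end

context weak_star_path begin

lemma at_within_unit: "t \<in> {0<..<1} \<Longrightarrow> at t within {0..1::real} = at t"
  by (rule at_within_interior) (simp add: interior_atLeastAtMost_real)

lemma BQ_iff_derivative: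
  assumes "s \<in> {0<..<1}"
  shows "((\<lambda>t. B (\<nu> t)) has_vector_derivative v) (at s) \<longleftrightarrow> (BQ s \<longlongrightarrow> v) (at s within {0..1})"
  unfolding at_within_unit[OF assms] has_vector_derivative_iff_quotient BQ_def[abs_def] ..

lemma strong_derivative_eq:
  assumes s: "s \<in> {0..1}" and D: "has_strong_derivative c \<epsilon> ev \<nu> s \<sigma>"
  shows "strong_derivative c \<epsilon> ev \<nu> s = \<sigma>"
  unfolding strong_derivative_def
proof (rule the_equality[where P = "has_strong_derivative c \<epsilon> ev \<nu> s", OF D])
  have "at s within {0..1::real} \<noteq> bot" using s by (simp add: trivial_limit_within islimpt_Icc)
  then show "\<sigma>' = \<sigma>" if "has_strong_derivative c \<epsilon> ev \<nu> s \<sigma>'" for \<sigma>'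
    using that D tendsto_unique unfolding has_strong_derivative_def Let_def by blast
qed

text \<open>The strong derivative of the path and the derivative of \<open>B\<close> along it determine each other through
  \<open>id + A\<close>, which is invertible on the tangent space.\<close>
lemma strong_derivative_if_derivative:
  assumes s: "s \<in> {0<..<1}" and D: "((\<lambda>t. B (\<nu> t)) has_vector_derivative v) (at s)"
  shows "has_strong_derivative c \<epsilon> ev \<nu> s (blinfun_inner_right (v + A (\<nu> s) v))"
    and "strong_derivative c \<epsilon> ev \<nu> s = blinfun_inner_right (v + A (\<nu> s) v)"
    and "B (\<nu> s) \<bullet> v = 0"
    and "\<epsilon> / 2 * (norm v)\<^sup>2 \<le> metric_g c \<epsilon> ev (\<nu> s) (strong_derivative c \<epsilon> ev \<nu> s)"
    and "metric_g c \<epsilon> ev (\<nu> s) (strong_derivative c \<epsilon> ev \<nu> s) \<le> \<epsilon> / 2 * (1 + 2 / \<delta>) * (norm v)\<^sup>2"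
proof -
  have s01: "s \<in> {0..1}" using s by auto
  show 1: "has_strong_derivative c \<epsilon> ev \<nu> s (blinfun_inner_right (v + A (\<nu> s) v))"
    unfolding has_strong_derivative_iff[OF s01]
    using RQ_tendsto[OF s01] D[unfolded BQ_iff_derivative[OF s]] by blast
  show 2: "strong_derivative c \<epsilon> ev \<nu> s = blinfun_inner_right (v + A (\<nu> s) v)"
    by (rule strong_derivative_eq[OF s01 1])
  show 3: "B (\<nu> s) \<bullet> v = 0" by (rule B_tangent[OF path s D])
  show "\<epsilon> / 2 * (norm v)\<^sup>2 \<le> metric_g c \<epsilon> ev (\<nu> s) (strong_derivative c \<epsilon> ev \<nu> s)"
    "metric_g c \<epsilon> ev (\<nu> s) (strong_derivative c \<epsilon> ev \<nu> s) \<le> \<epsilon> / 2 * (1 + 2 / \<delta>) * (norm v)\<^sup>2"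
    unfolding 2 by (rule metric_g_bounds[OF path[OF s01] 3]; simp)+
qed

lemma derivative_if_strong_derivative:
  assumes s: "s \<in> {0<..<1}" and D: "has_strong_derivative c \<epsilon> ev \<nu> s \<sigma>"
  obtains v where "((\<lambda>t. B (\<nu> t)) has_vector_derivative v) (at s)"
proof -
  have s01: "s \<in> {0..1}" using s by auto
  obtain S where "(RQ s \<longlongrightarrow> S) (at s within {0..1})"
    using D unfolding has_strong_derivative_iff[OF s01] by blast
  then obtain v where "(BQ s \<longlongrightarrow> v) (at s within {0..1})" by (rule BQ_tendsto[OF s01])
  then show ?thesis using that BQ_iff_derivative[OF s] by blast
qed

lemma AE_unit_interior: "AE t in lebesgue_on {0..1::real}. t \<in> {0<..<1}"
proof -
  have "negligible {0, 1::real}" by simp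
  moreover have "{0..1::real} \<in> sets lebesgue" by simp
  ultimately show ?thesis
    by (subst AE_lebesgue_on_iff_negligible) (auto simp: less_le intro!: exI[of _ "{0, 1}"])
qed

text \<open>Membership of \<open>B\<close> along the path in H^1, in integrated form; each of the
  equivalent conditions is compared with this one.\<close>

definition regular :: "(real \<Rightarrow> 'h) \<Rightarrow> bool" where
  "regular v \<longleftrightarrow> primitive_on01 (\<lambda>t. B (\<nu> t)) v \<and> integrable (lebesgue_on {0..1}) (\<lambda>t. (norm (v t))\<^sup>2)"

lemma sobolev_H1_iff_regular: "sobolev_H1 (\<lambda>t. B (\<nu> t)) {0<..<1} \<longleftrightarrow> (\<exists>v. regular v)"
  unfolding sobolev_H1_def regular_def
  using sobolev_H1_derivativeI sobolev_H1_derivativeD[OF _ B_continuous_on] by blast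

lemma regular_AE:
  assumes "regular v"
  shows "AE t in lebesgue_on {0..1}. t \<in> {0<..<1} \<and> ((\<lambda>t. B (\<nu> t)) has_vector_derivative v t) (at t)"
  using AE_unit_interior primitive_on01_AE_derivative[of "\<lambda>t. B (\<nu> t)" v] assms
  unfolding regular_def by (auto elim: AE_mp)

text \<open>All three conditions are read off from the derivative \<open>v\<close> of
  \<open>B\<close>: the strong derivative is (id + A) v, the tensor is at most a multiple of the
  squared norm of \<open>v\<close>, and the potentials are logarithms of \<open>B\<close>, Lipschitz
  because \<open>B\<close> stays above \<delta>.\<close>

lemma regular_imp_conditions:
  assumes v: "regular v"
  shows "strongly_differentiable_path c \<epsilon> ev \<nu>"
    and "(\<integral>\<^sup>+t. ennreal (metric_g c \<epsilon> ev (\<nu> t) (strong_derivative c \<epsilon> ev \<nu> t)) \<partial>lebesgue_on {0..1}) < \<infinity>"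
    and "AC_curve 1 dist 0 1 (\<lambda>t. pot (\<nu> t))"
proof -
  note AE = regular_AE[OF v]
  have prim: "primitive_on01 (\<lambda>t. B (\<nu> t)) v" and v2: "integrable (lebesgue_on {0..1}) (\<lambda>t. (norm (v t))\<^sup>2)"
    using v by (auto simp: regular_def)
  show "strongly_differentiable_path c \<epsilon> ev \<nu>"
    unfolding strongly_differentiable_path_def
    using AE by eventually_elim (blast intro: strong_derivative_if_derivative(1))
  have "(\<integral>\<^sup>+t. ennreal (metric_g c \<epsilon> ev (\<nu> t) (strong_derivative c \<epsilon> ev \<nu> t)) \<partial>lebesgue_on {0..1})
    \<le> (\<integral>\<^sup>+t. ennreal (\<epsilon> / 2 * (1 + 2 / \<delta>) * (norm (v t))\<^sup>2) \<partial>lebesgue_on {0..1})"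
  proof (rule nn_integral_mono_AE)
    show "AE t in lebesgue_on {0..1}. ennreal (metric_g c \<epsilon> ev (\<nu> t) (strong_derivative c \<epsilon> ev \<nu> t))
        \<le> ennreal (\<epsilon> / 2 * (1 + 2 / \<delta>) * (norm (v t))\<^sup>2)"
      using AE by eventually_elim (intro ennreal_leI strong_derivative_if_derivative(5), auto)
  qed
  also have "\<dots> < \<infinity>"
    using v2 eps_pos delta_pos by (subst nn_integral_eq_integral) (auto intro!: AE_I2)
  finally show "(\<integral>\<^sup>+t. ennreal (metric_g c \<epsilon> ev (\<nu> t) (strong_derivative c \<epsilon> ev \<nu> t)) \<partial>lebesgue_on {0..1}) < \<infinity>" .
  define m where "m t = \<epsilon> / \<delta> * norm (v t)" for t
  have m: "integrable (lebesgue_on {0..1}) m"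
    unfolding m_def using prim by (auto simp: primitive_on01_def)
  show "AC_curve 1 dist 0 1 (\<lambda>t. pot (\<nu> t))"
    unfolding AC_curve_def
  proof (intro exI[of _ m] conjI allI impI)
    show "m \<in> borel_measurable (lebesgue_on {0<..<1})" using m by (simp add: borel_measurable_Icc_iff_Ioo[symmetric])
    show "integrable (lebesgue_on {0<..<1}) (\<lambda>t. \<bar>m t\<bar> powr 1)" using m by (simp add: integrable_Icc_iff_Ioo[symmetric])
    fix s t :: real assume st: "0 < s \<and> s \<le> t \<and> t < 1"
    then have st': "0 \<le> s" "s \<le> t" "t \<le> 1" "s \<in> {0..1}" "t \<in> {0..1}" by auto
    have "dist (pot (\<nu> s)) (pot (\<nu> t)) \<le> \<epsilon> / \<delta> * norm (B (\<nu> s) - B (\<nu> t))"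
      by (intro dist_pot_le path st')
    also have "\<dots> = \<epsilon> / \<delta> * norm (B (\<nu> t) - B (\<nu> s))" by (simp only: norm_minus_commute)
    also have "\<dots> \<le> \<epsilon> / \<delta> * (\<integral>\<tau>. norm (v \<tau>) \<partial>lebesgue_on {s..t})"
      using eps_pos delta_pos by (intro mult_left_mono primitive_on01_norm_le[OF prim] st') auto
    also have "\<dots> = (\<integral>\<tau>. m \<tau> \<partial>lebesgue_on {s..t})" unfolding m_def by (rule integral_mult_right_zero[symmetric])
    finally show "dist (pot (\<nu> s)) (pot (\<nu> t)) \<le> (\<integral>\<tau>. m \<tau> \<partial>lebesgue_on {s..t})" .
  qed
qed

text \<open>Strong differentiability gives \<open>v\<close> almost everywhere, and the tensor bounds
  its square integral. It remains to exclude a singular part of \<open>B\<close>; this is done for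
  the scalar curves \<open>B \<bullet> w\<close>, which the potentials control.\<close>

lemma conditions_imp_regular:
  assumes 1: "strongly_differentiable_path c \<epsilon> ev \<nu>"
    and 2: "(\<integral>\<^sup>+t. ennreal (metric_g c \<epsilon> ev (\<nu> t) (strong_derivative c \<epsilon> ev \<nu> t)) \<partial>lebesgue_on {0..1}) < \<infinity>"
    and 3: "AC_curve 1 dist 0 1 (\<lambda>t. pot (\<nu> t))"
  shows "\<exists>v. regular v"
proof -
  let ?\<beta> = "\<lambda>t. B (\<nu> t)"
  define v where "v s = (SOME v. (?\<beta> has_vector_derivative v) (at s))" for s
  have AE: "AE s in lebesgue_on {0..1}. s \<in> {0<..<1} \<and> (?\<beta> has_vector_derivative v s) (at s)"
    using 1[unfolded strongly_differentiable_path_def] AE_unit_interior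
  proof eventually_elim
    case (elim s)
    then obtain \<sigma> where "has_strong_derivative c \<epsilon> ev \<nu> s \<sigma>" by blast
    then obtain w where "(?\<beta> has_vector_derivative w) (at s)"
      using derivative_if_strong_derivative[OF elim(2)] by blast
    then have "(?\<beta> has_vector_derivative v s) (at s)" unfolding v_def by (rule someI)
    then show ?case using elim by blast
  qed
  \<comment> \<open>Times in (s, 1) tending to \<open>s\<close> and depending continuously on it:
    the difference quotients along them are continuous in \<open>s\<close>, so their limit
    \<open>v\<close> is measurable.\<close>
  define g where "g n s = s + (1 - s) / real (Suc (Suc n))" for n and s :: real
  have g: "s < g n s" "g n s < 1" if "s < 1" for n s
  proof -
    show "s < g n s" using that by (simp add: g_def)
    have "(1 - s) / real (Suc (Suc n)) < (1 - s) / 1" using that by (intro divide_strict_left_mono) auto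
    then show "g n s < 1" by (simp add: g_def)
  qed
  have v_meas: "v \<in> borel_measurable (lebesgue_on {0..1})"
  proof -
    let ?F = "\<lambda>n s. (?\<beta> (g n s) - ?\<beta> s) /\<^sub>R (g n s - s)"
    have "continuous_on {0<..<1} (?F n)" for n
    proof -
      have cg: "continuous_on {0<..<1} (g n)" unfolding g_def by (intro continuous_intros) auto
      have gsub: "g n ` {0<..<1} \<subseteq> {0..1}"
      proof (intro image_subsetI)
        fix s :: real assume "s \<in> {0<..<1}"
        then show "g n s \<in> {0..1}" using g[of s n] by simp
      qed
      have c1: "continuous_on {0<..<1} (\<lambda>s. ?\<beta> (g n s))"
        by (rule continuous_on_compose2[OF B_continuous_on cg gsub])
      have c2: "continuous_on {0<..<1} ?\<beta>" by (rule continuous_on_subset[OF B_continuous_on]) auto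
      have nz: "\<forall>s\<in>{0<..<1}. g n s - s \<noteq> 0"
      proof
        fix s :: real assume "s \<in> {0<..<1}"
        then show "g n s - s \<noteq> 0" using g(1)[of s n] by simp
      qed
      show ?thesis by (intro continuous_on_scaleR continuous_on_inverse continuous_on_diff c1 c2 cg continuous_on_id nz)
    qed
    then have Fm: "?F n \<in> borel_measurable (lebesgue_on {0<..<1})" for n
      by (intro continuous_imp_measurable_on_sets_lebesgue) auto
    then have "(\<lambda>s. lim (\<lambda>n. ?F n s)) \<in> borel_measurable (lebesgue_on {0<..<1})"
      by (rule borel_measurable_lim_metric)
    then have "v \<in> borel_measurable (lebesgue_on {0<..<1})"
    proof (rule borel_measurable_lebesgue_on_AE)
      have "AE s in lebesgue_on {0<..<1}. s \<in> {0<..<1} \<and> (?\<beta> has_vector_derivative v s) (at s)"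
        by (rule AE_lebesgue_on_subset[OF AE]) auto
      then show "AE s in lebesgue_on {0<..<1}. lim (\<lambda>n. ?F n s) = v s"
      proof eventually_elim
        case (elim s)
        have "g n s \<noteq> s" for n using g[of s n] elim by auto
        moreover have "(\<lambda>n. g n s) \<longlonglongrightarrow> s"
        proof -
          have "(\<lambda>n. (1 - s) / real (Suc (Suc n))) \<longlonglongrightarrow> 0"
            by (intro real_tendsto_divide_at_top[OF tendsto_const]
                filterlim_compose[OF filterlim_real_sequentially] filterlim_compose[OF filterlim_Suc filterlim_Suc])
          from tendsto_add[OF tendsto_const this, of s] show ?thesis by (simp add: g_def)
        qed
        ultimately have "filterlim (\<lambda>n. g n s) (at s) sequentially" by (auto simp: filterlim_at)
        moreover have "((\<lambda>y. (?\<beta> y - ?\<beta> s) /\<^sub>R (y - s)) \<longlongrightarrow> v s) (at s)"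
          using elim by (intro has_vector_derivative_quotient_within) auto
        ultimately have "(\<lambda>n. ?F n s) \<longlonglongrightarrow> v s" by (rule filterlim_compose[rotated])
        then show ?case by (rule limI)
      qed
    qed auto
    then show ?thesis by (simp only: borel_measurable_Icc_iff_Ioo)
  qed
  have v2: "integrable (lebesgue_on {0..1}) (\<lambda>t. (norm (v t))\<^sup>2)"
  proof -
    have "integrable (lebesgue_on {0..1}) (\<lambda>t. \<epsilon> / 2 * (norm (v t))\<^sup>2)"
    proof (rule integrableI_bounded)
      show "(\<lambda>t. \<epsilon> / 2 * (norm (v t))\<^sup>2) \<in> borel_measurable (lebesgue_on {0..1})" using v_meas by measurable
      have "(\<integral>\<^sup>+t. ennreal (norm (\<epsilon> / 2 * (norm (v t))\<^sup>2)) \<partial>lebesgue_on {0..1}) \<le>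
        (\<integral>\<^sup>+t. ennreal (metric_g c \<epsilon> ev (\<nu> t) (strong_derivative c \<epsilon> ev \<nu> t)) \<partial>lebesgue_on {0..1})"
      proof (rule nn_integral_mono_AE)
        show "AE t in lebesgue_on {0..1}. ennreal (norm (\<epsilon> / 2 * (norm (v t))\<^sup>2)) \<le>
            ennreal (metric_g c \<epsilon> ev (\<nu> t) (strong_derivative c \<epsilon> ev \<nu> t))"
          using AE
        proof eventually_elim
          case (elim s)
          then have "\<epsilon> / 2 * (norm (v s))\<^sup>2 \<le> metric_g c \<epsilon> ev (\<nu> s) (strong_derivative c \<epsilon> ev \<nu> s)"
            by (intro strong_derivative_if_derivative(4)) auto
          then show ?case using eps_pos by (intro ennreal_leI) simp
        qed
      qed
      then show "(\<integral>\<^sup>+t. ennreal (norm (\<epsilon> / 2 * (norm (v t))\<^sup>2)) \<partial>lebesgue_on {0..1}) < \<infinity>"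
        using 2 by (rule le_less_trans)
    qed
    then have "integrable (lebesgue_on {0..1}) (\<lambda>t. 2 / \<epsilon> * (\<epsilon> / 2 * (norm (v t))\<^sup>2))"
      by (rule integrable_mult_right)
    moreover have "2 / \<epsilon> * (\<epsilon> / 2 * r) = r" for r using eps_pos by simp
    ultimately show ?thesis by (simp only:)
  qed
  have v1: "integrable (lebesgue_on {0..1}) v" by (rule integral_norm_le_sqrt(1)[OF zero_le_one v_meas v2])
  obtain m where m: "integrable (lebesgue_on {0..1}) m"
    and mb: "\<And>s t. 0 < s \<Longrightarrow> s \<le> t \<Longrightarrow> t < 1 \<Longrightarrow> dist (pot (\<nu> s)) (pot (\<nu> t)) \<le> (\<integral>\<tau>. m \<tau> \<partial>lebesgue_on {s..t})"
    using AC_curveE[OF 3] by auto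
  have bound: "norm (?\<beta> t - ?\<beta> s) \<le> (\<integral>\<tau>. norm (v \<tau>) \<partial>lebesgue_on {s..t})"
    if st: "0 \<le> s" "s \<le> t" "t \<le> 1" for s t
  proof -
    have st01: "s \<in> {0..1}" "t \<in> {0..1}" using st by auto
    \<comment> \<open>The increment itself is the test vector: a difference of two values of
      \<open>B\<close>, each of them an embedded measure.\<close>
    define w where "w = ?\<beta> t - ?\<beta> s"
    \<comment> \<open>Pairing with an embedded measure is an integral with density at most
      1/\<delta> against a probability measure, so it is bounded by the supremum of the evaluations,
      and these are bounded by the distance of the potentials.\<close>
    have wb: "\<bar>(?\<beta> y - ?\<beta> x) \<bullet> w\<bar> \<le> 2 / (\<delta> * \<epsilon>) * dist (pot (\<nu> x)) (pot (\<nu> y))"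
      if xy: "x \<in> {0..1}" "y \<in> {0..1}" for x y
    proof -
      let ?d = "?\<beta> y - ?\<beta> x" and ?r = "dist (pot (\<nu> x)) (pot (\<nu> y))"
      have each: "\<bar>Phi (\<nu> r) (a (\<nu> r)) \<bullet> ?d\<bar> \<le> 1 / \<delta> * (?r / \<epsilon>)" if r: "r \<in> {0..1}" for r
      proof -
        note ac = a_continuous[OF path[OF r]]
        have "\<bar>Phi (\<nu> r) (a (\<nu> r)) \<bullet> ?d\<bar> = norm (\<integral>z. a (\<nu> r) z * ev ?d z \<partial>\<nu> r)"
          unfolding Phi_inner[OF path[OF r] a_integrable[OF path[OF r]]] by simp
        also have "\<dots> \<le> (\<integral>z. norm (a (\<nu> r) z * ev ?d z) \<partial>\<nu> r)" by (rule integral_norm_bound)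
        also have "\<dots> \<le> (\<integral>z. 1 / \<delta> * (?r / \<epsilon>) \<partial>\<nu> r)"
        proof (rule Bochner_Integration.integral_mono)
          show "integrable (\<nu> r) (\<lambda>z. norm (a (\<nu> r) z * ev ?d z))"
            by (intro integrable_norm integrable_continuous_prob[OF path[OF r]] continuous_intros ac ev_continuous)
          show "integrable (\<nu> r) (\<lambda>z. 1 / \<delta> * (?r / \<epsilon>))"
            by (rule integrable_continuous_prob[OF path[OF r] continuous_on_const])
          show "norm (a (\<nu> r) z * ev ?d z) \<le> 1 / \<delta> * (?r / \<epsilon>)" for z
            unfolding real_norm_def abs_mult
          proof (rule mult_mono)
            show "\<bar>a (\<nu> r) z\<bar> \<le> 1 / \<delta>" using a_pos[OF path[OF r], of z] a_le[OF path[OF r], of z] by simp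
            show "\<bar>ev ?d z\<bar> \<le> ?r / \<epsilon>"
              using ev_B_diff_le_dist_pot[OF path[OF xy(2)] path[OF xy(1)], of z] by (simp only: dist_commute)
          qed (use delta_pos in auto)
        qed
        also have "\<dots> = 1 / \<delta> * (?r / \<epsilon>)" by (rule prob_measure_1[OF path[OF r]])
        finally show ?thesis .
      qed
      have "?d \<bullet> w = Phi (\<nu> t) (a (\<nu> t)) \<bullet> ?d - Phi (\<nu> s) (a (\<nu> s)) \<bullet> ?d"
        by (simp only: w_def B_eq_Phi[symmetric] inner_diff_right inner_commute[of ?d])
      then have "\<bar>?d \<bullet> w\<bar> \<le> 2 * (1 / \<delta> * (?r / \<epsilon>))"
        using each[OF st01(1)] each[OF st01(2)] by linarith
      then show ?thesis by (simp add: mult.assoc)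
    qed
    define m' where "m' \<tau> = 2 / (\<delta> * \<epsilon>) * m \<tau>" for \<tau>
    have m': "integrable (lebesgue_on {0..1}) m'" unfolding m'_def using m by simp
    have "norm (?\<beta> y \<bullet> w - ?\<beta> x \<bullet> w) \<le> (\<integral>\<tau>. \<bar>m' \<tau>\<bar> \<partial>lebesgue_on {x..y})"
      if xy: "0 \<le> x" "x \<le> y" "y \<le> 1" for x y
    proof (rule AC_extend_closed[OF _ m' _ xy])
      show "continuous_on {0..1} (\<lambda>t. ?\<beta> t \<bullet> w)" by (intro continuous_intros B_continuous_on)
      fix x y :: real assume xy: "0 < x" "x \<le> y" "y < 1"
      have "norm (?\<beta> y \<bullet> w - ?\<beta> x \<bullet> w) = \<bar>(?\<beta> y - ?\<beta> x) \<bullet> w\<bar>" by (simp add: inner_diff_left)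
      also have "\<dots> \<le> 2 / (\<delta> * \<epsilon>) * dist (pot (\<nu> x)) (pot (\<nu> y))" using xy by (intro wb) auto
      also have "\<dots> \<le> 2 / (\<delta> * \<epsilon>) * (\<integral>\<tau>. m \<tau> \<partial>lebesgue_on {x..y})"
        using delta_pos eps_pos by (intro mult_left_mono mb xy) auto
      also have "\<dots> = (\<integral>\<tau>. m' \<tau> \<partial>lebesgue_on {x..y})" unfolding m'_def by (rule integral_mult_right_zero[symmetric])
      finally show "norm (?\<beta> y \<bullet> w - ?\<beta> x \<bullet> w) \<le> (\<integral>\<tau>. m' \<tau> \<partial>lebesgue_on {x..y})" .
    qed
    then have q: "primitive_on01 (\<lambda>\<tau>. ?\<beta> \<tau> \<bullet> w) (\<lambda>\<tau>. v \<tau> \<bullet> w)"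
    proof (rule primitive_on01I_AC[rotated 2])
      show "integrable (lebesgue_on {0..1}) (\<lambda>\<tau>. v \<tau> \<bullet> w)" using v1 by simp
      show "integrable (lebesgue_on {0..1}) (\<lambda>\<tau>. \<bar>m' \<tau>\<bar>)" using m' by simp
      show "AE \<tau> in lebesgue_on {0..1}. ((\<lambda>\<tau>. ?\<beta> \<tau> \<bullet> w) has_vector_derivative v \<tau> \<bullet> w) (at \<tau>)"
        using AE by eventually_elim (intro bounded_linear.has_vector_derivative[OF bounded_linear_inner_left], auto)
    qed
    have vst: "integrable (lebesgue_on {s..t}) v" using st by (intro integrable_lebesgue_on_subset[OF v1]) auto
    \<comment> \<open>Testing with \<open>w\<close> recovers the full norm of the increment.\<close>
    have "w \<bullet> w = ?\<beta> t \<bullet> w - ?\<beta> s \<bullet> w" by (simp only: w_def inner_diff_left)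
    also have "\<dots> = (\<integral>\<tau>. v \<tau> \<bullet> w \<partial>lebesgue_on {s..t})" by (rule primitive_on01_diff[OF q st])
    also have "\<dots> = (\<integral>\<tau>. v \<tau> \<partial>lebesgue_on {s..t}) \<bullet> w" using vst by (intro integral_inner_left) auto
    also have "\<dots> \<le> norm (\<integral>\<tau>. v \<tau> \<partial>lebesgue_on {s..t}) * norm w" by (rule norm_cauchy_schwarz)
    finally have "norm w * norm w \<le> norm (\<integral>\<tau>. v \<tau> \<partial>lebesgue_on {s..t}) * norm w"
      by (simp add: power2_norm_eq_inner[symmetric] power2_eq_square)
    then have "norm w \<le> norm (\<integral>\<tau>. v \<tau> \<partial>lebesgue_on {s..t})"
      by (cases "norm w = 0") (auto simp: mult_le_cancel_right)
    also have "\<dots> \<le> (\<integral>\<tau>. norm (v \<tau>) \<partial>lebesgue_on {s..t})" by (rule integral_norm_bound)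
    finally show ?thesis by (simp only: w_def)
  qed
  have "primitive_on01 ?\<beta> v"
    by (rule primitive_on01I_AC[OF v1 integrable_norm[OF v1] bound]) (use AE in \<open>auto elim: eventually_mono\<close>)
  then show ?thesis using v2 by (auto simp: regular_def)
qed

end

section \<open>The Sinkhorn distance\<close>

context gibbs_rkhs begin

definition kappa :: real where "kappa = \<epsilon> / 2 * (1 + 2 / \<delta>)"

lemma kappa_pos: "kappa > 0"
  using eps_pos delta_pos by (simp add: kappa_def add_pos_pos)

text \<open>The mixture (1 - t) \<mu> + t \<mu>', realized as a Bernoulli choice between the two
  measures. The end points are set separately so that the path joins literally the given
  measures.\<close>

definition interpolation :: "'a measure \<Rightarrow> 'a measure \<Rightarrow> real \<Rightarrow> 'a measure" where
  "interpolation \<mu> \<mu>' t = (if t = 0 then \<mu> else if t = 1 then \<mu>'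
     else measure_pmf (bernoulli_pmf t) \<bind> (\<lambda>b. if b then \<mu>' else \<mu>))"

lemma interpolation_mixture:
  fixes g :: "'a \<Rightarrow> real"
  assumes \<mu>: "\<mu> \<in> prob_measures" and \<mu>': "\<mu>' \<in> prob_measures" and t: "0 \<le> t" "t \<le> 1"
  shows "interpolation \<mu> \<mu>' t \<in> prob_measures"
    and "continuous_on UNIV g \<Longrightarrow> (\<integral>x. g x \<partial>interpolation \<mu> \<mu>' t) = (1 - t) * (\<integral>x. g x \<partial>\<mu>) + t * (\<integral>x. g x \<partial>\<mu>')"
proof -
  let ?N = "\<lambda>b. if b then \<mu>' else \<mu>" and ?M = "measure_pmf (bernoulli_pmf t)"
  let ?I = "?M \<bind> ?N"
  have N: "?N \<in> measurable ?M (subprob_algebra borel)"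
  proof -
    have "?N b \<in> space (subprob_algebra borel)" for b
      using prob_measuresD(2)[OF \<mu>] prob_measuresD(2)[OF \<mu>']
        prob_space_imp_subprob_space[OF prob_measuresD(1)[OF \<mu>]]
        prob_space_imp_subprob_space[OF prob_measuresD(1)[OF \<mu>']]
      by (simp add: space_subprob_algebra)
    then have "?N \<in> measurable (count_space UNIV) (subprob_algebra borel)"
      by (simp only: measurable_count_space_eq1) (rule Pi_I)
    then show ?thesis
      by (simp only: measurable_cong_sets[OF sets_measure_pmf_count_space refl])
  qed
  have sI: "sets ?I = sets borel"
  proof (rule sets_bind)
    show "sets (?N b) = sets borel" for b
      using prob_measuresD(2)[OF \<mu>] prob_measuresD(2)[OF \<mu>'] by simp
  qed simp
  have pI: "prob_space ?I"
  proof (rule measure_pmf.prob_space_bind[OF _ N])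
    show "AE b in ?M. prob_space (?N b)"
      using prob_measuresD(1)[OF \<mu>] prob_measuresD(1)[OF \<mu>'] by (intro AE_I2) simp
  qed
  have I: "?I \<in> prob_measures" using sI pI by (simp add: prob_measures_def)
  then show P: "interpolation \<mu> \<mu>' t \<in> prob_measures" using \<mu> \<mu>' by (simp add: interpolation_def)
  assume g: "continuous_on UNIV g"
  obtain C where C: "\<And>x. norm (g x) \<le> C" using continuous_bounded[OF g] by blast
  \<comment> \<open>Shifted to be nonnegative, since the integral over the bind is computed with
    extended nonnegative integrals.\<close>
  define f where "f x = g x + C" for x
  have f0: "0 \<le> f x" for x using C[of x] by (simp add: f_def abs_le_iff)
  have fc: "continuous_on UNIV f" unfolding f_def by (intro continuous_intros g)
  have nn: "(\<integral>\<^sup>+x. ennreal (f x) \<partial>\<rho>) = ennreal (\<integral>x. f x \<partial>\<rho>)" if "\<rho> \<in> prob_measures" for \<rho>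
    by (intro nn_integral_eq_integral integrable_continuous_prob that fc) (simp add: f0)
  have pos: "0 \<le> (\<integral>x. f x \<partial>\<rho>)" for \<rho> using f0 by (intro Bochner_Integration.integral_nonneg) auto
  have "ennreal (\<integral>x. f x \<partial>?I) = (\<integral>\<^sup>+b. (\<integral>\<^sup>+x. ennreal (f x) \<partial>?N b) \<partial>?M)"
    unfolding nn[OF I, symmetric]
    using borel_measurable_continuous_onI[OF fc] by (intro nn_integral_bind[OF _ N]) simp
  also have "\<dots> = ennreal (\<integral>x. f x \<partial>\<mu>') * ennreal t + ennreal (\<integral>x. f x \<partial>\<mu>) * ennreal (1 - t)"
    using t by (simp add: nn[OF \<mu>] nn[OF \<mu>'])
  also have "\<dots> = ennreal ((1 - t) * (\<integral>x. f x \<partial>\<mu>) + t * (\<integral>x. f x \<partial>\<mu>'))"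
    using t pos by (simp add: ennreal_plus[symmetric] ennreal_mult'[symmetric] mult.commute add.commute del: ennreal_plus)
  finally have "(\<integral>x. f x \<partial>?I) = (1 - t) * (\<integral>x. f x \<partial>\<mu>) + t * (\<integral>x. f x \<partial>\<mu>')"
    using t pos by (subst (asm) ennreal_inj) auto
  moreover have "(\<integral>x. f x \<partial>\<rho>) = (\<integral>x. g x \<partial>\<rho>) + C" if "\<rho> \<in> prob_measures" for \<rho>
  proof -
    have "(\<integral>x. f x \<partial>\<rho>) = (\<integral>x. g x \<partial>\<rho>) + (\<integral>x. C \<partial>\<rho>)"
      unfolding f_def by (intro Bochner_Integration.integral_add integrable_continuous_prob that g continuous_on_const)
    then show ?thesis by (simp only: prob_measure_1[OF that])
  qed
  ultimately have "(\<integral>x. g x \<partial>?I) = (1 - t) * (\<integral>x. g x \<partial>\<mu>) + t * (\<integral>x. g x \<partial>\<mu>')"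
    using I \<mu> \<mu>' by (simp add: algebra_simps)
  then show "(\<integral>x. g x \<partial>interpolation \<mu> \<mu>' t) = (1 - t) * (\<integral>x. g x \<partial>\<mu>) + t * (\<integral>x. g x \<partial>\<mu>')"
    by (simp add: interpolation_def)
qed

text \<open>With the scaling frozen at \<open>s\<close> the embedding is affine in the mixture
  parameter, and \<open>B_diff_le\<close> turns this into a Lipschitz bound. The embeddings of the
  two end measures have norm at most 1/\<delta> each, whence the constant.\<close>

lemma interpolation_lipschitz:
  assumes \<mu>: "\<mu> \<in> prob_measures" and \<mu>': "\<mu>' \<in> prob_measures" and st: "0 \<le> s" "s \<le> t" "t \<le> 1"
  shows "norm (B (interpolation \<mu> \<mu>' t) - B (interpolation \<mu> \<mu>' s)) \<le> 2 / \<delta> * (t - s)"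
proof -
  let ?\<nu> = "interpolation \<mu> \<mu>'"
  have s: "?\<nu> s \<in> prob_measures" and t: "?\<nu> t \<in> prob_measures"
    using interpolation_mixture(1)[OF \<mu> \<mu>'] st by auto
  note ac = a_continuous[OF s]
  have ai: "integrable \<rho> (a (?\<nu> s))" if "\<rho> \<in> prob_measures" for \<rho> by (rule integrable_continuous_prob[OF that ac])
  define D where "D = Phi \<mu>' (a (?\<nu> s)) - Phi \<mu> (a (?\<nu> s))"
  have mix: "Phi (?\<nu> r) (a (?\<nu> s)) \<bullet> h = (1 - r) * (Phi \<mu> (a (?\<nu> s)) \<bullet> h) + r * (Phi \<mu>' (a (?\<nu> s)) \<bullet> h)"
    if "0 \<le> r" "r \<le> 1" for r h
    unfolding Phi_inner[OF \<mu> ai[OF \<mu>]] Phi_inner[OF \<mu>' ai[OF \<mu>']]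
      Phi_inner[OF interpolation_mixture(1)[OF \<mu> \<mu>' that] ai[OF interpolation_mixture(1)[OF \<mu> \<mu>' that]]]
    by (rule interpolation_mixture(2)[OF \<mu> \<mu>' that]) (intro continuous_intros ac ev_continuous)
  have "(Phi (?\<nu> t) (a (?\<nu> s)) - Phi (?\<nu> s) (a (?\<nu> s)) - (t - s) *\<^sub>R D) \<bullet> h = 0" for h
    using mix[of t h] mix[of s h] st by (simp add: D_def inner_diff_left algebra_simps)
  then have eq: "Phi (?\<nu> t) (a (?\<nu> s)) - Phi (?\<nu> s) (a (?\<nu> s)) = (t - s) *\<^sub>R D"
    by (metis inner_eq_zero_iff eq_iff_diff_eq_0)
  have Pn: "norm (Phi \<rho> (a (?\<nu> s))) \<le> 1 / \<delta>" if "\<rho> \<in> prob_measures" for \<rho>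
  proof (rule Phi_norm_le[OF that ac])
    show "\<bar>a (?\<nu> s) x\<bar> \<le> 1 / \<delta>" for x using a_pos[OF s, of x] a_le[OF s, of x] by simp
  qed
  have "norm (B (?\<nu> t) - B (?\<nu> s)) \<le> norm ((t - s) *\<^sub>R D)"
    using B_diff_le[OF s t] unfolding eq .
  also have "\<dots> = (t - s) * norm D" using st by simp
  also have "\<dots> \<le> (t - s) * (1 / \<delta> + 1 / \<delta>)"
    unfolding D_def using st by (intro mult_left_mono order_trans[OF norm_triangle_ineq4] add_mono Pn \<mu> \<mu>') auto
  finally show ?thesis by (simp add: mult.commute)
qed

section \<open>Energies of paths\<close>

abbreviation path_energy :: "(real \<Rightarrow> 'a measure) \<Rightarrow> (real \<Rightarrow> 'h) \<Rightarrow> ennreal" where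
  "path_energy \<nu> w \<equiv> \<integral>\<^sup>+t. ennreal (metric_g_tilde c \<epsilon> ev (\<nu> t) (w t)) \<partial>lebesgue_on {0<..<1}"

definition energies :: "'a measure \<Rightarrow> 'a measure \<Rightarrow> ennreal set" where
  "energies \<mu> \<mu>' = {path_energy \<nu> w | \<nu> w. admissible_path c \<epsilon> ev \<nu> \<and> \<nu> 0 = \<mu> \<and> \<nu> 1 = \<mu>' \<and>
     sobolev_H1_derivative (\<lambda>t. B (\<nu> t)) w {0<..<1}}"

lemma sinkhorn_dist_energies: "sinkhorn_dist c \<epsilon> ev \<mu> \<mu>' = sqrt (enn2real (Inf (energies \<mu> \<mu>')))"
  unfolding sinkhorn_dist_def energies_def ..

text \<open>The derivative of \<open>B\<close> is bounded by \<open>C\<close> almost everywhere, and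
  \<open>kappa\<close> is the upper constant of \<open>metric_g_tilde_bounds\<close>. The lemma
  serves both mixtures and reparametrized arcs.\<close>

lemma lipschitz_path_energy:
  assumes P: "\<And>t. t \<in> {0..1} \<Longrightarrow> \<nu> t \<in> prob_measures" and C: "C \<ge> 0"
    and lip: "\<And>s t. 0 \<le> s \<Longrightarrow> s \<le> t \<Longrightarrow> t \<le> 1 \<Longrightarrow> norm (B (\<nu> t) - B (\<nu> s)) \<le> C * (t - s)"
  shows "\<exists>x\<in>energies (\<nu> 0) (\<nu> 1). x \<le> ennreal (kappa * C\<^sup>2)"
proof -
  have lip': "norm (B (\<nu> t) - B (\<nu> s)) \<le> (\<integral>\<tau>. C \<partial>lebesgue_on {s..t})"
    if "0 \<le> s" "s \<le> t" "t \<le> 1" for s t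
    using lip[OF that] unfolding integral_const_lebesgue_on_Icc[OF that(2)] by (simp add: mult.commute)
  have "\<exists>w. primitive_on01 (\<lambda>t. B (\<nu> t)) w"
    by (rule dyadic_primitive[where m = "\<lambda>_. C"]) (use lip' in auto)
  then obtain w where w: "primitive_on01 (\<lambda>t. B (\<nu> t)) w" ..
  have wC: "AE t in lebesgue_on {0..1}. norm (w t) \<le> C"
    by (rule primitive_on01_AE_bound[OF w Lebesgue_Measure.integrable_const_ivl lip'])
  have w2C: "AE t in lebesgue_on {0..1}. (norm (w t))\<^sup>2 \<le> C\<^sup>2"
    using wC by eventually_elim (rule power_mono, auto)
  have wm: "w \<in> borel_measurable (lebesgue_on {0..1})" using w by (auto simp: primitive_on01_def)
  have w2: "integrable (lebesgue_on {0..1}) (\<lambda>t. (norm (w t))\<^sup>2)"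
  proof (rule Bochner_Integration.integrable_bound)
    show "integrable (lebesgue_on {0..1::real}) (\<lambda>t. C\<^sup>2)" by (rule Lebesgue_Measure.integrable_const_ivl)
    show "(\<lambda>t. (norm (w t))\<^sup>2) \<in> borel_measurable (lebesgue_on {0..1})" using wm by measurable
    show "AE t in lebesgue_on {0..1}. norm ((norm (w t))\<^sup>2) \<le> norm (C\<^sup>2)" using w2C by simp
  qed
  have S: "sobolev_H1_derivative (\<lambda>t. B (\<nu> t)) w {0<..<1}" by (rule sobolev_H1_derivativeI[OF w w2])
  have adm: "admissible_path c \<epsilon> ev \<nu>"
    unfolding admissible_path_def sobolev_H1_def using P S primitive_on01_continuous[OF w] by blast
  have "path_energy \<nu> w \<le> (\<integral>\<^sup>+t. ennreal (kappa * C\<^sup>2) \<partial>lebesgue_on {0<..<1::real})"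
  proof (rule nn_integral_mono_AE)
    have "AE t in lebesgue_on {0<..<1}. (norm (w t))\<^sup>2 \<le> C\<^sup>2"
      by (rule AE_lebesgue_on_subset[OF w2C]) auto
    moreover have "AE t in lebesgue_on {0<..<1}. ((\<lambda>t. B (\<nu> t)) has_vector_derivative w t) (at t)"
      by (rule AE_lebesgue_on_subset[OF primitive_on01_AE_derivative[OF w]]) auto
    moreover have "AE t in lebesgue_on {0<..<1::real}. t \<in> {0<..<1}" by (rule AE_I2) simp
    ultimately show "AE t in lebesgue_on {0<..<1}. ennreal (metric_g_tilde c \<epsilon> ev (\<nu> t) (w t)) \<le> ennreal (kappa * C\<^sup>2)"
    proof eventually_elim
      case (elim t)
      have t: "t \<in> {0..1}" using elim(3) by auto
      have "B (\<nu> t) \<bullet> w t = 0" by (rule B_tangent[OF P elim(3,2)])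
      from metric_g_tilde_bounds(2)[OF P[OF t] this]
      have "metric_g_tilde c \<epsilon> ev (\<nu> t) (w t) \<le> kappa * (norm (w t))\<^sup>2" by (simp only: kappa_def)
      also have "\<dots> \<le> kappa * C\<^sup>2" using elim(1) kappa_pos by (intro mult_left_mono) auto
      finally show ?case by (rule ennreal_leI)
    qed
  qed
  also have "\<dots> = ennreal (kappa * C\<^sup>2)"
    by (simp add: emeasure_restrict_space)
  finally show ?thesis using adm S unfolding energies_def by blast
qed

lemma sinkhorn_dist_le_lipschitz:
  assumes P: "\<And>t. t \<in> {0..1} \<Longrightarrow> \<nu> t \<in> prob_measures" and C: "C \<ge> 0"
    and lip: "\<And>s t. 0 \<le> s \<Longrightarrow> s \<le> t \<Longrightarrow> t \<le> 1 \<Longrightarrow> norm (B (\<nu> t) - B (\<nu> s)) \<le> C * (t - s)"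
  shows "sinkhorn_dist c \<epsilon> ev (\<nu> 0) (\<nu> 1) \<le> sqrt kappa * C"
proof -
  obtain x where x: "x \<in> energies (\<nu> 0) (\<nu> 1)" "x \<le> ennreal (kappa * C\<^sup>2)"
    using lipschitz_path_energy[OF assms] by blast
  have "Inf (energies (\<nu> 0) (\<nu> 1)) \<le> ennreal (kappa * C\<^sup>2)" by (rule Inf_lower2[OF x])
  then have "enn2real (Inf (energies (\<nu> 0) (\<nu> 1))) \<le> kappa * C\<^sup>2"
    using kappa_pos by (intro enn2real_leI) auto
  then have "sinkhorn_dist c \<epsilon> ev (\<nu> 0) (\<nu> 1) \<le> sqrt (kappa * C\<^sup>2)"
    unfolding sinkhorn_dist_energies by (rule real_sqrt_le_mono)
  then show ?thesis using C by (simp add: real_sqrt_mult)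
qed

text \<open>Along an admissible path the energy is at least \<epsilon>/2 times the integral of the
  squared speed of \<open>B\<close>, which by Cauchy-Schwarz dominates the squared
  increment.\<close>

lemma sinkhorn_dist_ge:
  assumes \<mu>: "\<mu> \<in> prob_measures" and \<mu>': "\<mu>' \<in> prob_measures"
  shows "sqrt (\<epsilon> / 2) * norm (B \<mu>' - B \<mu>) \<le> sinkhorn_dist c \<epsilon> ev \<mu> \<mu>'"
proof -
  let ?\<nu> = "interpolation \<mu> \<mu>'" and ?r = "\<epsilon> / 2 * (norm (B \<mu>' - B \<mu>))\<^sup>2"
  \<comment> \<open>Finiteness of the infimum: \<open>enn2real\<close> sends infinity to 0, which
    would destroy a lower bound.\<close>
  have "\<exists>x\<in>energies (?\<nu> 0) (?\<nu> 1). x \<le> ennreal (kappa * (2 / \<delta>)\<^sup>2)"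
    using delta_pos interpolation_mixture(1)[OF \<mu> \<mu>'] interpolation_lipschitz[OF \<mu> \<mu>']
    by (intro lipschitz_path_energy) auto
  then obtain x where x: "x \<in> energies \<mu> \<mu>'" "x \<le> ennreal (kappa * (2 / \<delta>)\<^sup>2)"
    by (auto simp: interpolation_def)
  then have "x < top" using ennreal_less_top le_less_trans by blast
  then have fin: "Inf (energies \<mu> \<mu>') < top" using Inf_lower[OF x(1)] by (rule le_less_trans[rotated])
  have "ennreal ?r \<le> Inf (energies \<mu> \<mu>')"
  proof (rule Inf_greatest)
    fix y assume "y \<in> energies \<mu> \<mu>'"
    then obtain \<nu> w where y: "y = path_energy \<nu> w" "admissible_path c \<epsilon> ev \<nu>" "\<nu> 0 = \<mu>" "\<nu> 1 = \<mu>'"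
      "sobolev_H1_derivative (\<lambda>t. B (\<nu> t)) w {0<..<1}" unfolding energies_def by blast
    have P: "\<And>t. t \<in> {0..1} \<Longrightarrow> \<nu> t \<in> prob_measures" and cont: "continuous_on {0..1} (\<lambda>t. B (\<nu> t))"
      using y(2) unfolding admissible_path_def by auto
    note w = sobolev_H1_derivativeD[OF y(5) cont]
    have wm: "w \<in> borel_measurable (lebesgue_on {0..1})" using w(1) by (auto simp: primitive_on01_def)
    have "norm (B \<mu>' - B \<mu>) \<le> (\<integral>t. norm (w t) \<partial>lebesgue_on {0..1})"
      using primitive_on01_norm_le[OF w(1), of 0 1] y(3,4) by simp
    then have "(norm (B \<mu>' - B \<mu>))\<^sup>2 \<le> (\<integral>t. norm (w t) \<partial>lebesgue_on {0..1})\<^sup>2" by (intro power_mono) auto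
    also have "\<dots> \<le> (1 - 0) * (\<integral>t. (norm (w t))\<^sup>2 \<partial>lebesgue_on {0..1})"
      by (rule integral_norm_le_sqrt(2)[OF zero_le_one wm w(2)])
    finally have "?r \<le> \<epsilon> / 2 * (\<integral>t. (norm (w t))\<^sup>2 \<partial>lebesgue_on {0..1})"
      using eps_pos by (intro mult_left_mono) auto
    also have "\<dots> = (\<integral>t. \<epsilon> / 2 * (norm (w t))\<^sup>2 \<partial>lebesgue_on {0<..<1})"
      unfolding integral_Icc_eq_Ioo[symmetric] by (rule integral_mult_right_zero[symmetric])
    finally have "ennreal ?r \<le> ennreal (\<integral>t. \<epsilon> / 2 * (norm (w t))\<^sup>2 \<partial>lebesgue_on {0<..<1})"
      by (rule ennreal_leI)
    also have "\<dots> = (\<integral>\<^sup>+t. ennreal (\<epsilon> / 2 * (norm (w t))\<^sup>2) \<partial>lebesgue_on {0<..<1})"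
      using w(2) eps_pos by (intro nn_integral_eq_integral[symmetric]) (auto simp: integrable_Icc_iff_Ioo)
    also have "\<dots> \<le> path_energy \<nu> w"
    proof (rule nn_integral_mono_AE)
      have "AE t in lebesgue_on {0<..<1}. ((\<lambda>t. B (\<nu> t)) has_vector_derivative w t) (at t)"
        by (rule AE_lebesgue_on_subset[OF primitive_on01_AE_derivative[OF w(1)]]) auto
      moreover have "AE t in lebesgue_on {0<..<1::real}. t \<in> {0<..<1}" by (rule AE_I2) simp
      ultimately show "AE t in lebesgue_on {0<..<1}. ennreal (\<epsilon> / 2 * (norm (w t))\<^sup>2) \<le> ennreal (metric_g_tilde c \<epsilon> ev (\<nu> t) (w t))"
      proof eventually_elim
        case (elim t)
        have t: "t \<in> {0..1}" using elim(2) by auto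
        have "B (\<nu> t) \<bullet> w t = 0" by (rule B_tangent[OF P elim(2,1)])
        then show ?case by (intro ennreal_leI metric_g_tilde_bounds(1)[OF P[OF t]])
      qed
    qed
    finally show "ennreal ?r \<le> y" by (simp only: y(1))
  qed
  then have "enn2real (ennreal ?r) \<le> enn2real (Inf (energies \<mu> \<mu>'))" using fin by (rule enn2real_mono)
  then have "?r \<le> enn2real (Inf (energies \<mu> \<mu>'))" using eps_pos by simp
  then have "sqrt ?r \<le> sinkhorn_dist c \<epsilon> ev \<mu> \<mu>'"
    unfolding sinkhorn_dist_energies by (rule real_sqrt_le_mono)
  then show ?thesis by (simp only: real_sqrt_mult real_sqrt_abs abs_norm_cancel)
qed

end

context weak_star_path begin

text \<open>Reparametrize the arc from \<open>s\<close> to \<open>t\<close> with speed at most \<open>\<integral>\<^sub>s\<^sup>t (|v| + 1)\<close>; the summand 1 makes the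
  arc length strictly increasing.\<close>
lemma sinkhorn_dist_le_length:
  assumes v: "regular v" and st: "0 < s" "s \<le> t" "t < 1"
  shows "sinkhorn_dist c \<epsilon> ev (\<nu> s) (\<nu> t) \<le> (\<integral>\<tau>. sqrt kappa * (norm (v \<tau>) + 1) \<partial>lebesgue_on {s..t})"
proof -
  have prim: "primitive_on01 (\<lambda>t. B (\<nu> t)) v" using v by (simp add: regular_def)
  define f where "f \<tau> = norm (v \<tau>) + 1" for \<tau>
  have f: "integrable (lebesgue_on {0..1}) f"
    unfolding f_def using prim
    by (intro Bochner_Integration.integrable_add integrable_norm Lebesgue_Measure.integrable_const_ivl) (simp add: primitive_on01_def)
  define \<theta> where "\<theta> r = (\<integral>\<tau>. f \<tau> \<partial>lebesgue_on {0..r})" for r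
  have \<theta>: "primitive_on01 \<theta> f" unfolding \<theta>_def[abs_def] by (rule primitive_on01_indefinite[OF f])
  have inc: "norm (B (\<nu> y) - B (\<nu> x)) \<le> \<theta> y - \<theta> x" "y - x \<le> \<theta> y - \<theta> x" if xy: "0 \<le> x" "x \<le> y" "y \<le> 1" for x y
  proof -
    have vi: "integrable (lebesgue_on {x..y}) (\<lambda>\<tau>. norm (v \<tau>))"
      using primitive_on01_subset[OF prim, of "{x..y}"] xy by auto
    have "\<theta> y - \<theta> x = (\<integral>\<tau>. norm (v \<tau>) + 1 \<partial>lebesgue_on {x..y})"
      unfolding f_def[symmetric] by (rule primitive_on01_diff[OF \<theta> xy])
    also have "\<dots> = (\<integral>\<tau>. norm (v \<tau>) \<partial>lebesgue_on {x..y}) + (\<integral>\<tau>. 1 \<partial>lebesgue_on {x..y})"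
      by (rule Bochner_Integration.integral_add[OF vi Lebesgue_Measure.integrable_const_ivl])
    also have "(\<integral>\<tau>. 1 \<partial>lebesgue_on {x..y}) = y - x"
      using integral_const_lebesgue_on_Icc[OF xy(2), of "1::real"] by (simp only: real_scaleR_def mult_1_right)
    finally have eq: "\<theta> y - \<theta> x = (\<integral>\<tau>. norm (v \<tau>) \<partial>lebesgue_on {x..y}) + (y - x)" .
    have "0 \<le> (\<integral>\<tau>. norm (v \<tau>) \<partial>lebesgue_on {x..y})" by (rule Bochner_Integration.integral_nonneg) simp
    then show "y - x \<le> \<theta> y - \<theta> x" by (simp add: eq)
    show "norm (B (\<nu> y) - B (\<nu> x)) \<le> \<theta> y - \<theta> x"
      using primitive_on01_norm_le[OF prim xy] xy(2) unfolding eq by simp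
  qed
  define C where "C = \<theta> t - \<theta> s"
  have tC: "t - s \<le> C" using inc(2)[of s t] st by (simp add: C_def)
  have C0: "C \<ge> 0" using tC st by simp
  have c\<theta>: "continuous_on {s..t} \<theta>"
    by (rule continuous_on_subset[OF primitive_on01_continuous[OF \<theta>]]) (use st in auto)
  \<comment> \<open>The intermediate value theorem gives times \<open>\<sigma> y\<close> along which
    \<theta> grows linearly. The increments of \<open>B\<close> are bounded by those of \<theta>, so
    any choice of such times is Lipschitz for \<open>B\<close>.\<close>
  have "\<exists>r\<ge>s. r \<le> t \<and> \<theta> r = \<theta> s + y * C" if y: "y \<in> {0..1}" for y
  proof (rule IVT'[OF _ _ st(2) c\<theta>])
    show "\<theta> s \<le> \<theta> s + y * C" using y C0 by simp
    have "y * C \<le> 1 * C" using y C0 by (intro mult_right_mono) auto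
    then show "\<theta> s + y * C \<le> \<theta> t" by (simp add: C_def)
  qed
  then obtain \<sigma> where \<sigma>: "\<And>y. y \<in> {0..1} \<Longrightarrow> s \<le> \<sigma> y \<and> \<sigma> y \<le> t \<and> \<theta> (\<sigma> y) = \<theta> s + y * C"
    by metis
  have \<sigma>01: "\<sigma> y \<in> {0..1}" if "y \<in> {0..1}" for y using \<sigma>[OF that] st by auto
  have \<sigma>0: "\<sigma> 0 = s" using inc(2)[of s "\<sigma> 0"] \<sigma>[of 0] st by auto
  have \<sigma>1: "\<sigma> 1 = t" using inc(2)[of "\<sigma> 1" t] \<sigma>[of 1] st by (auto simp: C_def)
  have "sinkhorn_dist c \<epsilon> ev (\<nu> (\<sigma> 0)) (\<nu> (\<sigma> 1)) \<le> sqrt kappa * C"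
  proof (rule sinkhorn_dist_le_lipschitz[where \<nu> = "\<lambda>y. \<nu> (\<sigma> y)", OF _ C0])
    show "\<nu> (\<sigma> y) \<in> prob_measures" if "y \<in> {0..1}" for y by (rule path[OF \<sigma>01[OF that]])
    fix x y :: real assume xy: "0 \<le> x" "x \<le> y" "y \<le> 1"
    then have x: "x \<in> {0..1}" and y: "y \<in> {0..1}" by auto
    have d: "\<theta> (\<sigma> y) - \<theta> (\<sigma> x) = C * (y - x)" using \<sigma>[OF x] \<sigma>[OF y] by (simp add: algebra_simps)
    have "0 \<le> C * (y - x)" using C0 xy by simp
    show "norm (B (\<nu> (\<sigma> y)) - B (\<nu> (\<sigma> x))) \<le> C * (y - x)"
    proof (cases "\<sigma> x \<le> \<sigma> y")
      case True
      then show ?thesis using inc(1)[of "\<sigma> x" "\<sigma> y"] \<sigma>01[OF x] \<sigma>01[OF y] d by simp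
    next
      case False
      then have "norm (B (\<nu> (\<sigma> x)) - B (\<nu> (\<sigma> y))) \<le> \<theta> (\<sigma> x) - \<theta> (\<sigma> y)"
        using \<sigma>01[OF x] \<sigma>01[OF y] by (intro inc(1)) auto
      also have "\<dots> \<le> C * (y - x)" using d \<open>0 \<le> C * (y - x)\<close> by linarith
      finally show ?thesis by (simp only: norm_minus_commute)
    qed
  qed
  also have "sqrt kappa * C = (\<integral>\<tau>. sqrt kappa * f \<tau> \<partial>lebesgue_on {s..t})"
    unfolding C_def using st primitive_on01_diff[OF \<theta>, of s t] by simp
  finally show ?thesis unfolding \<sigma>0 \<sigma>1 f_def .
qed

text \<open>From left to right the density is a multiple of the speed of \<open>B\<close> plus 1.
  From right to left the lower bound on the distance bounds the increments of \<open>B\<close>, and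
  \<open>dyadic_primitive\<close> produces the derivative.\<close>

lemma regular_iff_AC: "(\<exists>v. regular v) \<longleftrightarrow> AC_curve 2 (sinkhorn_dist c \<epsilon> ev) 0 1 \<nu>"
proof
  assume "\<exists>v. regular v"
  then obtain v where v: "regular v" ..
  then have v1: "integrable (lebesgue_on {0..1}) v" and v2: "integrable (lebesgue_on {0..1}) (\<lambda>t. (norm (v t))\<^sup>2)"
    by (auto simp: regular_def primitive_on01_def)
  define m where "m \<tau> = sqrt kappa * (norm (v \<tau>) + 1)" for \<tau>
  have m: "integrable (lebesgue_on {0..1}) m" unfolding m_def
    by (intro integrable_mult_right Bochner_Integration.integrable_add integrable_norm v1 Lebesgue_Measure.integrable_const_ivl)
  have "(m t)\<^sup>2 = kappa * (norm (v t))\<^sup>2 + (2 * kappa * norm (v t) + kappa)" for t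
    using kappa_pos by (simp add: m_def power_mult_distrib power2_sum algebra_simps)
  moreover have "integrable (lebesgue_on {0..1}) (\<lambda>t. kappa * (norm (v t))\<^sup>2 + (2 * kappa * norm (v t) + kappa))"
    by (intro integrable_mult_right Bochner_Integration.integrable_add integrable_norm v1 v2 Lebesgue_Measure.integrable_const_ivl)
  ultimately have m2: "integrable (lebesgue_on {0..1}) (\<lambda>t. (m t)\<^sup>2)" by simp
  show "AC_curve 2 (sinkhorn_dist c \<epsilon> ev) 0 1 \<nu>"
    unfolding AC_curve_def
  proof (intro exI[of _ m] conjI allI impI)
    show "m \<in> borel_measurable (lebesgue_on {0<..<1})" using m by (auto simp: borel_measurable_Icc_iff_Ioo[symmetric])
    show "integrable (lebesgue_on {0<..<1}) (\<lambda>t. \<bar>m t\<bar> powr 2)"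
      using m2 by (simp add: integrable_Icc_iff_Ioo[symmetric])
    show "sinkhorn_dist c \<epsilon> ev (\<nu> s) (\<nu> t) \<le> (\<integral>\<tau>. m \<tau> \<partial>lebesgue_on {s..t})" if "0 < s \<and> s \<le> t \<and> t < 1" for s t
      unfolding m_def using that by (intro sinkhorn_dist_le_length[OF v]) auto
  qed
next
  assume AC: "AC_curve 2 (sinkhorn_dist c \<epsilon> ev) 0 1 \<nu>"
  obtain m where m: "integrable (lebesgue_on {0..1}) m" "integrable (lebesgue_on {0..1}) (\<lambda>t. (m t)\<^sup>2)"
    and mb: "\<And>s t. 0 < s \<Longrightarrow> s \<le> t \<Longrightarrow> t < 1 \<Longrightarrow> sinkhorn_dist c \<epsilon> ev (\<nu> s) (\<nu> t) \<le> (\<integral>\<tau>. m \<tau> \<partial>lebesgue_on {s..t})"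
    using AC_curveE[OF AC] by auto
  \<comment> \<open>The inverse of the constant in \<open>sinkhorn_dist_ge\<close>.\<close>
  define q where "q = 1 / sqrt (\<epsilon> / 2)"
  have q: "q > 0" using eps_pos by (simp add: q_def)
  define m' where "m' \<tau> = q * m \<tau>" for \<tau>
  have m': "integrable (lebesgue_on {0..1}) m'" unfolding m'_def using m by simp
  have bd: "norm (B (\<nu> t) - B (\<nu> s)) \<le> (\<integral>\<tau>. \<bar>m' \<tau>\<bar> \<partial>lebesgue_on {s..t})" if st: "0 \<le> s" "s \<le> t" "t \<le> 1" for s t
  proof (rule AC_extend_closed[OF B_continuous_on m' _ st])
    fix s t :: real assume st: "0 < s" "s \<le> t" "t < 1"
    have "norm (B (\<nu> t) - B (\<nu> s)) = q * (sqrt (\<epsilon> / 2) * norm (B (\<nu> t) - B (\<nu> s)))"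
      using eps_pos by (simp add: q_def)
    also have "\<dots> \<le> q * (\<integral>\<tau>. m \<tau> \<partial>lebesgue_on {s..t})"
      using q st by (intro mult_left_mono order_trans[OF sinkhorn_dist_ge mb] path) auto
    also have "\<dots> = (\<integral>\<tau>. m' \<tau> \<partial>lebesgue_on {s..t})" unfolding m'_def by (rule integral_mult_right_zero[symmetric])
    finally show "norm (B (\<nu> t) - B (\<nu> s)) \<le> (\<integral>\<tau>. m' \<tau> \<partial>lebesgue_on {s..t})" .
  qed
  have am': "integrable (lebesgue_on {0..1}) (\<lambda>\<tau>. \<bar>m' \<tau>\<bar>)" using m' by simp
  have am'2: "integrable (lebesgue_on {0..1}) (\<lambda>\<tau>. \<bar>m' \<tau>\<bar>\<^sup>2)"
    using m(2) by (simp add: m'_def power_mult_distrib)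
  have "\<exists>v. primitive_on01 (\<lambda>t. B (\<nu> t)) v"
    by (rule dyadic_primitive[OF borel_measurable_integrable[OF am'] am'2 bd])
  then obtain v where v: "primitive_on01 (\<lambda>t. B (\<nu> t)) v" ..
  have vm: "v \<in> borel_measurable (lebesgue_on {0..1})" using v by (auto simp: primitive_on01_def)
  have "integrable (lebesgue_on {0..1}) (\<lambda>t. (norm (v t))\<^sup>2)"
  proof (rule Bochner_Integration.integrable_bound[OF am'2])
    show "(\<lambda>t. (norm (v t))\<^sup>2) \<in> borel_measurable (lebesgue_on {0..1})" using vm by measurable
    show "AE t in lebesgue_on {0..1}. norm ((norm (v t))\<^sup>2) \<le> norm (\<bar>m' t\<bar>\<^sup>2)"
    proof -
      have "AE t in lebesgue_on {0..1}. norm (v t) \<le> \<bar>m' t\<bar>"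
        by (rule primitive_on01_AE_bound[OF v am']) (rule bd)
      then show ?thesis
    proof eventually_elim
      case (elim t)
      then have "(norm (v t))\<^sup>2 \<le> \<bar>m' t\<bar>\<^sup>2" by (intro power_mono) auto
      then show ?case by simp
    qed
    qed
  qed
  then show "\<exists>v. regular v" using v by (auto simp: regular_def)
qed

end

section \<open>Integration by parts\<close>

context gibbs_rkhs begin

lemma scaled_test_path_apply:
  "apply_bcontfun (scaled_test_path c \<epsilon> ev \<nu> \<phi> t) = (\<lambda>x. a (\<nu> t) x * ev (\<phi> t) x)"
proof -
  have "continuous_on UNIV (\<lambda>x. exp (apply_bcontfun (self_potential c \<epsilon> (\<nu> t)) x / \<epsilon>) * ev (\<phi> t) x)"
    using eps_pos by (intro continuous_intros ev_continuous continuous_on_apply_bcontfun) auto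
  from Bcontfun_continuous[OF this] show ?thesis
    unfolding scaled_test_path_def scaling_def .
qed

end

context weak_star_path begin

text \<open>Both scalings move with the measure here, whereas in \<open>L_tendsto\<close> one of
  them is frozen.\<close>

lemma A_path_tendsto:
  assumes s: "s \<in> {0..1}"
  shows "((\<lambda>t. A (\<nu> t) h) \<longlongrightarrow> A (\<nu> s) h) (at s within {0..1})"
proof -
  have "((\<lambda>t. Phi (\<nu> t) (\<lambda>x. a (\<nu> t) x * a (\<nu> t) x * ev h x)) \<longlongrightarrow> Phi (\<nu> s) (\<lambda>x. a (\<nu> s) x * a (\<nu> s) x * ev h x)) (at s within {0..1})"
  proof (rule Phi_tendsto[OF s, where g = "\<lambda>t x. a (\<nu> t) x * a (\<nu> t) x * ev h x"])
    show "continuous_on UNIV (\<lambda>x. a (\<nu> t) x * a (\<nu> t) x * ev h x)" if "t \<in> {0..1}" for t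
      by (rule L_integrand[OF path[OF that] path[OF that]])
    fix \<theta> :: real assume \<theta>: "\<theta> > 0"
    \<comment> \<open>The factor 2 comes from the sum of the two scalings in the difference of their
      squares; the summand 1 covers h = 0.\<close>
    define M where "M = 2 / \<delta> * norm h + 1"
    have M: "M > 0" using delta_pos by (simp add: M_def add_nonneg_pos)
    have "eventually (\<lambda>t. \<forall>x. \<bar>a (\<nu> t) x - a (\<nu> s) x\<bar> \<le> \<theta> / M) (at s within {0..1})"
      by (rule a_eventually_close[OF s]) (use \<theta> M in simp)
    then show "eventually (\<lambda>t. \<forall>x. \<bar>a (\<nu> t) x * a (\<nu> t) x * ev h x - a (\<nu> s) x * a (\<nu> s) x * ev h x\<bar> \<le> \<theta>) (at s within {0..1})"
      using eventually_in_unit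
    proof eventually_elim
      case (elim t)
      show ?case
      proof
        fix x
        have b: "0 \<le> a (\<nu> r) x" "a (\<nu> r) x \<le> 1 / \<delta>" if "r \<in> {0..1}" for r
          using a_pos[OF path[OF that], of x] a_le[OF path[OF that], of x] by auto
        have "a (\<nu> t) x * a (\<nu> t) x * ev h x - a (\<nu> s) x * a (\<nu> s) x * ev h x
           = (a (\<nu> t) x - a (\<nu> s) x) * ((a (\<nu> t) x + a (\<nu> s) x) * ev h x)"
          by (simp add: algebra_simps)
        also have "\<bar>\<dots>\<bar> = \<bar>a (\<nu> t) x - a (\<nu> s) x\<bar> * (\<bar>a (\<nu> t) x + a (\<nu> s) x\<bar> * \<bar>ev h x\<bar>)"
          by (simp only: abs_mult)
        also have "\<dots> \<le> \<theta> / M * (2 / \<delta> * norm h)"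
          using elim(1) b[OF elim(2)] b[OF s] ev_bound[of h x] \<theta> M delta_pos by (intro mult_mono) auto
        also have "\<dots> \<le> \<theta> / M * M" using \<theta> M by (intro mult_left_mono) (auto simp: M_def)
        also have "\<dots> = \<theta>" using M by simp
        finally show "\<bar>a (\<nu> t) x * a (\<nu> t) x * ev h x - a (\<nu> s) x * a (\<nu> s) x * ev h x\<bar> \<le> \<theta>" .
      qed
    qed
  qed
  then have "((\<lambda>t. L (\<nu> t) (\<nu> t) h) \<longlongrightarrow> A (\<nu> s) h) (at s within {0..1})"
    unfolding L_self[OF path[OF s], symmetric] unfolding L_def .
  then show ?thesis
    by (rule Lim_transform_eventually) (use eventually_in_unit in \<open>eventually_elim, simp add: L_self[OF path]\<close>)
qed

text \<open>Since \<open>v\<close> is only measurable, symmetry moves \<open>A\<close> from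
  \<open>v t\<close> to the test curve; the resulting factor is continuous by this lemma, so its
  pairing with \<open>v t\<close> is integrable.\<close>

lemma A_path_continuous:
  assumes \<phi>: "continuous_on {0..1} \<phi>"
  shows "continuous_on {0..1} (\<lambda>t. A (\<nu> t) (\<phi> t))"
  unfolding continuous_on_def
proof
  fix s :: real assume s: "s \<in> {0..1}"
  have "((\<lambda>t. A (\<nu> t) (\<phi> t - \<phi> s)) \<longlongrightarrow> 0) (at s within {0..1})"
  proof (rule Lim_null_comparison)
    show "eventually (\<lambda>t. norm (A (\<nu> t) (\<phi> t - \<phi> s)) \<le> norm (\<phi> t - \<phi> s) / \<delta>\<^sup>2) (at s within {0..1})"
      using eventually_in_unit
    proof eventually_elim
      case (elim t)
      show ?case unfolding L_self[OF path[OF elim], symmetric] by (rule L_norm_le[OF path[OF elim] path[OF elim]])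
    qed
    have "((\<lambda>t. norm (\<phi> t - \<phi> s) / \<delta>\<^sup>2) \<longlongrightarrow> norm (\<phi> s - \<phi> s) / \<delta>\<^sup>2) (at s within {0..1})"
      using \<phi> s delta_pos by (intro tendsto_intros) (auto simp: continuous_on_def)
    then show "((\<lambda>t. norm (\<phi> t - \<phi> s) / \<delta>\<^sup>2) \<longlongrightarrow> 0) (at s within {0..1})" by simp
  qed
  from tendsto_add[OF A_path_tendsto[OF s, of "\<phi> s"] this]
  have "((\<lambda>t. A (\<nu> t) (\<phi> s) + A (\<nu> t) (\<phi> t - \<phi> s)) \<longlongrightarrow> A (\<nu> s) (\<phi> s)) (at s within {0..1})" by simp
  then show "((\<lambda>t. A (\<nu> t) (\<phi> t)) \<longlongrightarrow> A (\<nu> s) (\<phi> s)) (at s within {0..1})"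
    by (rule Lim_transform_eventually)
      (use eventually_in_unit in \<open>eventually_elim, simp add: A_diff[OF path]\<close>)
qed

text \<open>As the scaling is 1/B, its derivative is minus its square times \<open>v\<close>, and
  \<open>D\<close> is the product rule. Convergence is in supremum norm because evaluations are
  bounded by the RKHS norm.\<close>

lemma scaled_test_path_derivative:
  assumes t: "t \<in> {0<..<1}" and v: "((\<lambda>t. B (\<nu> t)) has_vector_derivative v) (at t)"
    and \<phi>: "(\<phi> has_vector_derivative \<phi>') (at t)"
  defines "D \<equiv> Bcontfun (\<lambda>x. a (\<nu> t) x * ev \<phi>' x - a (\<nu> t) x * a (\<nu> t) x * ev v x * ev (\<phi> t) x)"
  shows "(scaled_test_path c \<epsilon> ev \<nu> \<phi> has_vector_derivative D) (at t)"
    and "apply_bcontfun D = (\<lambda>x. a (\<nu> t) x * ev \<phi>' x - a (\<nu> t) x * a (\<nu> t) x * ev v x * ev (\<phi> t) x)"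
    and "(\<integral>x. apply_bcontfun D x \<partial>\<nu> t) = B (\<nu> t) \<bullet> \<phi>' - A (\<nu> t) v \<bullet> \<phi> t"
proof -
  let ?\<psi> = "scaled_test_path c \<epsilon> ev \<nu> \<phi>"
  have t01: "t \<in> {0..1}" using t by auto
  note Pt = path[OF t01]
  note ac = a_continuous[OF Pt]
  have Dc: "continuous_on UNIV (\<lambda>x. a (\<nu> t) x * ev \<phi>' x - a (\<nu> t) x * a (\<nu> t) x * ev v x * ev (\<phi> t) x)"
    by (intro continuous_intros ac ev_continuous)
  show Da: "apply_bcontfun D = (\<lambda>x. a (\<nu> t) x * ev \<phi>' x - a (\<nu> t) x * a (\<nu> t) x * ev v x * ev (\<phi> t) x)"
    unfolding D_def by (rule Bcontfun_continuous[OF Dc])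
  show "(\<integral>x. apply_bcontfun D x \<partial>\<nu> t) = B (\<nu> t) \<bullet> \<phi>' - A (\<nu> t) v \<bullet> \<phi> t"
  proof -
    have "(\<integral>x. apply_bcontfun D x \<partial>\<nu> t) = (\<integral>x. E (\<nu> t) \<phi>' x - E (\<nu> t) v x * E (\<nu> t) (\<phi> t) x \<partial>\<nu> t)"
      unfolding Da E_eq[OF Pt] by (simp add: mult_ac)
    also have "\<dots> = (\<integral>x. E (\<nu> t) \<phi>' x \<partial>\<nu> t) - (\<integral>x. E (\<nu> t) v x * E (\<nu> t) (\<phi> t) x \<partial>\<nu> t)"
      by (intro Bochner_Integration.integral_diff integrable_continuous_prob[OF Pt] continuous_intros E_continuous[OF Pt])
    finally show ?thesis by (simp only: inner_B[OF Pt] A_inner[OF Pt])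
  qed
  define FQ where "FQ y = (\<phi> y - \<phi> t) /\<^sub>R (y - t)" for y
  have FQ: "(FQ \<longlongrightarrow> \<phi>') (at t)" unfolding FQ_def[abs_def] by (rule has_vector_derivative_quotient_within[OF \<phi>])
  have BQ: "(BQ t \<longlongrightarrow> v) (at t)" using v unfolding BQ_iff_derivative[OF t] at_within_unit[OF t] .
  define \<omega> where "\<omega> y = norm (B (\<nu> y) - B (\<nu> t)) / \<delta>\<^sup>2" for y
  have "((\<lambda>y. B (\<nu> y)) \<longlongrightarrow> B (\<nu> t)) (at t)" using B_tendsto[OF t01] by (simp only: at_within_unit[OF t])
  then have "(\<omega> \<longlongrightarrow> norm (B (\<nu> t) - B (\<nu> t)) / \<delta>\<^sup>2) (at t)"
    unfolding \<omega>_def using delta_pos by (intro tendsto_intros) auto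
  then have \<omega>: "(\<omega> \<longlongrightarrow> 0) (at t)" by simp
  \<comment> \<open>One summand for each term in the decomposition below of the quotient minus
    \<open>D\<close>.\<close>
  define R where "R y = \<omega> y * norm (FQ y) + 1 / \<delta> * norm (FQ y - \<phi>') + \<omega> y * (1 / \<delta>) * norm (BQ t y) * norm (\<phi> t)
      + 1 / \<delta>\<^sup>2 * norm (BQ t y - v) * norm (\<phi> t)" for y
  have "(R \<longlongrightarrow> 0 * norm \<phi>' + 1 / \<delta> * norm (\<phi>' - \<phi>') + 0 * (1 / \<delta>) * norm v * norm (\<phi> t)
      + 1 / \<delta>\<^sup>2 * norm (v - v) * norm (\<phi> t)) (at t)"
    unfolding R_def by (intro tendsto_add tendsto_mult tendsto_norm tendsto_diff tendsto_const FQ BQ \<omega>)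
  then have R: "(R \<longlongrightarrow> 0) (at t)" by simp
  have "eventually (\<lambda>y. y \<in> {0<..<1}) (at t)"
    using t by (intro eventually_at_in_open') auto
  moreover have "eventually (\<lambda>y. y \<noteq> t) (at t)" by (simp add: eventually_at_filter)
  ultimately have "eventually (\<lambda>y. dist ((?\<psi> y - ?\<psi> t) /\<^sub>R (y - t)) D \<le> R y) (at t)"
  proof eventually_elim
    case (elim y)
    have y01: "y \<in> {0..1}" using elim(1) by auto
    note Py = path[OF y01]
    show ?case
    proof (rule dist_bound)
      fix x
      let ?at = "a (\<nu> t) x" and ?ay = "a (\<nu> y) x" and ?r = "inverse (y - t)"
      have yt: "y - t \<noteq> 0" using elim(2) by simp
      have b: "0 \<le> ?at" "?at \<le> 1 / \<delta>" using a_pos[OF Pt, of x] a_le[OF Pt, of x] by auto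
      have d: "\<bar>?ay - ?at\<bar> \<le> \<omega> y" unfolding \<omega>_def by (rule a_diff_le[OF Py Pt])
      have q: "?r * (?ay - ?at) = - (?ay * ?at * ev (BQ t y) x)"
        unfolding a_diff[OF Py Pt] BQ_def by (simp add: mult_ac)
      have f: "?r * (ev (\<phi> y) x - ev (\<phi> t) x) = ev (FQ y) x" by (simp add: FQ_def)
      have "apply_bcontfun ((?\<psi> y - ?\<psi> t) /\<^sub>R (y - t)) x = ?r * (?ay * ev (\<phi> y) x - ?at * ev (\<phi> t) x)"
        by (simp add: scaled_test_path_apply)
      also have "\<dots> = ?ay * (?r * (ev (\<phi> y) x - ev (\<phi> t) x)) + ?r * (?ay - ?at) * ev (\<phi> t) x"
        by (simp add: algebra_simps)
      also have "\<dots> = ?ay * ev (FQ y) x - ?ay * ?at * ev (BQ t y) x * ev (\<phi> t) x"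
        unfolding f q by simp
      finally have "apply_bcontfun ((?\<psi> y - ?\<psi> t) /\<^sub>R (y - t)) x - apply_bcontfun D x =
          (?ay - ?at) * ev (FQ y) x + ?at * ev (FQ y - \<phi>') x - (?ay - ?at) * ?at * ev (BQ t y) x * ev (\<phi> t) x
          - ?at * ?at * ev (BQ t y - v) x * ev (\<phi> t) x"
        by (simp add: Da algebra_simps)
      moreover have "\<bar>(?ay - ?at) * ev (FQ y) x\<bar> \<le> \<omega> y * norm (FQ y)"
        unfolding abs_mult using d by (intro mult_mono ev_bound) auto
      moreover have "\<bar>?at * ev (FQ y - \<phi>') x\<bar> \<le> 1 / \<delta> * norm (FQ y - \<phi>')"
        unfolding abs_mult using b delta_pos by (intro mult_mono ev_bound) auto
      moreover have "\<bar>(?ay - ?at) * ?at * ev (BQ t y) x * ev (\<phi> t) x\<bar> \<le> \<omega> y * (1 / \<delta>) * norm (BQ t y) * norm (\<phi> t)"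
        unfolding abs_mult using b d delta_pos by (intro mult_mono ev_bound mult_nonneg_nonneg) auto
      moreover have "\<bar>?at * ?at * ev (BQ t y - v) x * ev (\<phi> t) x\<bar> \<le> 1 / \<delta>\<^sup>2 * norm (BQ t y - v) * norm (\<phi> t)"
      proof -
        have "\<bar>?at * ?at\<bar> \<le> 1 / \<delta>\<^sup>2" using a_mult_bounds[OF Pt Pt, of x] by simp
        then show ?thesis
          unfolding abs_mult[of _ "ev (\<phi> t) x"] abs_mult[of _ "ev (BQ t y - v) x"] by (intro mult_mono ev_bound) auto
      qed
      ultimately show "dist (apply_bcontfun ((?\<psi> y - ?\<psi> t) /\<^sub>R (y - t)) x) (apply_bcontfun D x) \<le> R y"
        unfolding dist_real_def R_def by linarith
    qed
  qed
  then have "eventually (\<lambda>y. norm (dist ((?\<psi> y - ?\<psi> t) /\<^sub>R (y - t)) D) \<le> R y) (at t)" by simp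
  then have "((\<lambda>y. dist ((?\<psi> y - ?\<psi> t) /\<^sub>R (y - t)) D) \<longlongrightarrow> 0) (at t)" using R by (rule Lim_null_comparison)
  then show "(?\<psi> has_vector_derivative D) (at t)"
    unfolding has_vector_derivative_iff_quotient by (rule tendsto_dist_iff[THEN iffD2])
qed

text \<open>Almost everywhere the two integrands are
  \<open>B \<bullet> \<phi>' - A v \<bullet> \<phi>\<close> and
  \<open>v \<bullet> \<phi> + A v \<bullet> \<phi>\<close>. In their sum the terms with
  \<open>A\<close> cancel, and what remains is the derivative of \<open>\<phi> \<bullet> B\<close>,
  which vanishes at both end points.\<close>

lemma integration_by_parts:
  assumes v: "regular v" and \<phi>: "\<phi> \<in> test_functions {0<..<1}"
  defines "\<psi> \<equiv> scaled_test_path c \<epsilon> ev \<nu> \<phi>"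
  shows "AE t in lebesgue_on {0..1}. \<psi> differentiable at t"
    and "integrable (lebesgue_on {0..1}) (\<lambda>t. \<integral>x. apply_bcontfun (vector_derivative \<psi> (at t)) x \<partial>\<nu> t)"
    and "integrable (lebesgue_on {0..1})
      (\<lambda>t. pairing (self_ev c \<epsilon> ev (\<nu> t)) (strong_derivative c \<epsilon> ev \<nu> t) (apply_bcontfun (\<psi> t)))"
    and "(\<integral>t. (\<integral>x. apply_bcontfun (vector_derivative \<psi> (at t)) x \<partial>\<nu> t) \<partial>lebesgue_on {0..1}) =
      - (\<integral>t. pairing (self_ev c \<epsilon> ev (\<nu> t)) (strong_derivative c \<epsilon> ev \<nu> t) (apply_bcontfun (\<psi> t)) \<partial>lebesgue_on {0..1})"
proof -
  let ?\<beta> = "\<lambda>t. B (\<nu> t)"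
  have prim: "primitive_on01 ?\<beta> v" using v by (simp add: regular_def)
  obtain D where D: "\<phi> = D 0" "\<And>n t. (D n has_vector_derivative D (Suc n) t) (at t)"
    "\<And>t. t \<notin> {0<..<1} \<Longrightarrow> \<phi> t = 0" "\<And>t. vector_derivative \<phi> (at t) = D 1 t"
    using \<phi> by (rule test_function_boundary) (rule that)
  define \<phi>' where "\<phi>' = D 1"
  have d\<phi>: "(\<phi> has_vector_derivative \<phi>' t) (at t)" for t using D(1) D(2)[of 0 t] by (simp add: \<phi>'_def)
  have c\<phi>: "continuous_on {0..1} \<phi>" "continuous_on {0..1} \<phi>'"
    unfolding D(1) \<phi>'_def
    by (intro continuous_at_imp_continuous_on ballI has_vector_derivative_continuous[OF D(2)])+
  define I1 where "I1 t = ?\<beta> t \<bullet> \<phi>' t - A (\<nu> t) (v t) \<bullet> \<phi> t" for t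
  define I2 where "I2 t = v t \<bullet> \<phi> t + A (\<nu> t) (v t) \<bullet> \<phi> t" for t
  let ?J1 = "\<lambda>t. \<integral>x. apply_bcontfun (vector_derivative \<psi> (at t)) x \<partial>\<nu> t"
  let ?J2 = "\<lambda>t. pairing (self_ev c \<epsilon> ev (\<nu> t)) (strong_derivative c \<epsilon> ev \<nu> t) (apply_bcontfun (\<psi> t))"
  show "AE t in lebesgue_on {0..1}. \<psi> differentiable at t"
    using regular_AE[OF v]
  proof eventually_elim
    case (elim t)
    then have "(\<psi> has_vector_derivative Bcontfun (\<lambda>x. a (\<nu> t) x * ev (\<phi>' t) x - a (\<nu> t) x * a (\<nu> t) x * ev (v t) x * ev (\<phi> t) x)) (at t)"
      unfolding \<psi>_def by (intro scaled_test_path_derivative(1) d\<phi>) auto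
    then show ?case by (rule differentiableI_vector)
  qed
  have J1: "AE t in lebesgue_on {0..1}. ?J1 t = I1 t"
    using regular_AE[OF v]
  proof eventually_elim
    case (elim t)
    then have t: "t \<in> {0<..<1}" and vt: "(?\<beta> has_vector_derivative v t) (at t)" by auto
    note S = scaled_test_path_derivative[OF t vt d\<phi>]
    show ?case
      unfolding \<psi>_def vector_derivative_at[OF S(1)] I1_def by (rule S(3))
  qed
  have J2: "AE t in lebesgue_on {0..1}. ?J2 t = I2 t"
    using regular_AE[OF v]
  proof eventually_elim
    case (elim t)
    then have t: "t \<in> {0<..<1}" and vt: "(?\<beta> has_vector_derivative v t) (at t)" by auto
    have Pt: "\<nu> t \<in> prob_measures" using t by (intro path) auto
    have "apply_bcontfun (\<psi> t) = E (\<nu> t) (\<phi> t)"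
      unfolding \<psi>_def scaled_test_path_apply by (rule ext) (simp only: E_eq[OF Pt])
    then have "inv (self_ev c \<epsilon> ev (\<nu> t)) (apply_bcontfun (\<psi> t)) = \<phi> t"
      using inv_f_f[OF inj_E[OF Pt], of "\<phi> t"] by (simp only: E_def[OF Pt])
    then show ?case
      unfolding pairing_def strong_derivative_if_derivative(2)[OF t vt] I2_def
      by (simp add: inner_add_left)
  qed
  have vi: "integrable (lebesgue_on {0..1}) v" using prim by (simp add: primitive_on01_def)
  have inner_int: "integrable (lebesgue_on {0..1}) (\<lambda>t. v t \<bullet> g t)" if g: "continuous_on {0..1} g" for g
  proof -
    obtain C where C: "\<And>t. t \<in> {0..1} \<Longrightarrow> norm (g t) \<le> C"
      using compact_imp_bounded[OF compact_continuous_image[OF g compact_Icc]] unfolding bounded_iff by blast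
    have gm: "g \<in> borel_measurable (lebesgue_on {0..1})"
      using g by (intro continuous_imp_measurable_on_sets_lebesgue) auto
    show ?thesis
    proof (rule Bochner_Integration.integrable_bound)
      show "integrable (lebesgue_on {0..1}) (\<lambda>t. C * norm (v t))" using vi by simp
      show "(\<lambda>t. v t \<bullet> g t) \<in> borel_measurable (lebesgue_on {0..1})"
        using vi gm by (intro borel_measurable_inner) auto
      show "AE t in lebesgue_on {0..1}. norm (v t \<bullet> g t) \<le> norm (C * norm (v t))"
      proof (rule AE_I2)
        fix t assume "t \<in> space (lebesgue_on {0..1::real})"
        then have "norm (v t) * norm (g t) \<le> norm (v t) * C" using C[of t] by (intro mult_left_mono) auto
        then have "\<bar>v t \<bullet> g t\<bar> \<le> C * norm (v t)"
          using Cauchy_Schwarz_ineq2[of "v t" "g t"] by (simp add: mult.commute)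
        then show "norm (v t \<bullet> g t) \<le> norm (C * norm (v t))" unfolding real_norm_def by linarith
      qed
    qed
  qed
  have iv: "integrable (lebesgue_on {0..1}) (\<lambda>t. v t \<bullet> \<phi> t)" by (rule inner_int[OF c\<phi>(1)])
  have iA: "integrable (lebesgue_on {0..1}) (\<lambda>t. A (\<nu> t) (v t) \<bullet> \<phi> t)"
  proof -
    have "integrable (lebesgue_on {0..1}) (\<lambda>t. v t \<bullet> A (\<nu> t) (\<phi> t))"
      by (rule inner_int[OF A_path_continuous[OF c\<phi>(1)]])
    then show ?thesis
      by (rule Bochner_Integration.integrable_cong[THEN iffD1, rotated 2]) (auto simp: A_sym[OF path])
  qed
  have ib: "integrable (lebesgue_on {0..1}) (\<lambda>t. ?\<beta> t \<bullet> \<phi>' t)"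
    by (rule continuous_imp_integrable_real) (intro continuous_intros B_continuous_on c\<phi>)
  have I1: "integrable (lebesgue_on {0..1}) I1" unfolding I1_def by (rule Bochner_Integration.integrable_diff[OF ib iA])
  have I2: "integrable (lebesgue_on {0..1}) I2" unfolding I2_def by (rule Bochner_Integration.integrable_add[OF iv iA])
  have "AE t in lebesgue_on {0..1}. I1 t = ?J1 t" using J1 by eventually_elim (rule sym)
  then have J1m: "?J1 \<in> borel_measurable (lebesgue_on {0..1})"
    by (rule borel_measurable_lebesgue_on_AE[OF borel_measurable_integrable[OF I1], rotated]) simp
  have "AE t in lebesgue_on {0..1}. I2 t = ?J2 t" using J2 by eventually_elim (rule sym)
  then have J2m: "?J2 \<in> borel_measurable (lebesgue_on {0..1})"
    by (rule borel_measurable_lebesgue_on_AE[OF borel_measurable_integrable[OF I2], rotated]) simp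
  show "integrable (lebesgue_on {0..1}) ?J1"
    using integrable_cong_AE[OF J1m borel_measurable_integrable[OF I1] J1] I1 by blast
  show "integrable (lebesgue_on {0..1}) ?J2"
    using integrable_cong_AE[OF J2m borel_measurable_integrable[OF I2] J2] I2 by blast
  have P: "primitive_on01 (\<lambda>t. \<phi> t \<bullet> ?\<beta> t) (\<lambda>t. \<phi> t \<bullet> v t + \<phi>' t \<bullet> ?\<beta> t)"
    by (rule primitive_on01_bilinear[OF bounded_bilinear_inner prim d\<phi> c\<phi>(2)])
  have "0 = (\<integral>t. \<phi> t \<bullet> v t + \<phi>' t \<bullet> ?\<beta> t \<partial>lebesgue_on {0..1})"
    using primitive_on01_diff[OF P, of 0 1] D(3)[of 0] D(3)[of 1] by simp
  also have "\<dots> = (\<integral>t. v t \<bullet> \<phi> t \<partial>lebesgue_on {0..1}) + (\<integral>t. ?\<beta> t \<bullet> \<phi>' t \<partial>lebesgue_on {0..1})"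
    using iv ib by (simp add: inner_commute)
  finally have zero: "(\<integral>t. v t \<bullet> \<phi> t \<partial>lebesgue_on {0..1}) + (\<integral>t. ?\<beta> t \<bullet> \<phi>' t \<partial>lebesgue_on {0..1}) = 0" by simp
  have "(\<integral>t. ?J1 t \<partial>lebesgue_on {0..1}) = (\<integral>t. I1 t \<partial>lebesgue_on {0..1})"
    by (rule integral_cong_AE[OF J1m borel_measurable_integrable[OF I1] J1])
  also have "\<dots> = (\<integral>t. ?\<beta> t \<bullet> \<phi>' t \<partial>lebesgue_on {0..1}) - (\<integral>t. A (\<nu> t) (v t) \<bullet> \<phi> t \<partial>lebesgue_on {0..1})"
    unfolding I1_def by (rule Bochner_Integration.integral_diff[OF ib iA])
  also have "\<dots> = - ((\<integral>t. v t \<bullet> \<phi> t \<partial>lebesgue_on {0..1}) + (\<integral>t. A (\<nu> t) (v t) \<bullet> \<phi> t \<partial>lebesgue_on {0..1}))"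
    using zero by linarith
  also have "\<dots> = - (\<integral>t. I2 t \<partial>lebesgue_on {0..1})"
    unfolding I2_def by (subst Bochner_Integration.integral_add[OF iv iA]) (rule refl)
  also have "(\<integral>t. I2 t \<partial>lebesgue_on {0..1}) = (\<integral>t. ?J2 t \<partial>lebesgue_on {0..1})"
    by (rule integral_cong_AE[OF J2m borel_measurable_integrable[OF I2] J2, symmetric])
  finally show "(\<integral>t. ?J1 t \<partial>lebesgue_on {0..1}) = - (\<integral>t. ?J2 t \<partial>lebesgue_on {0..1})" .
qed

end

lemma gibbs_kernel_lower_bound:
  fixes c :: "'a::metric_space \<Rightarrow> 'a \<Rightarrow> real"
  assumes "compact (UNIV :: 'a set)" "continuous_on UNIV (\<lambda>(x, y). c x y)" "\<epsilon> > 0"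
  obtains \<delta> where "\<delta> > 0" "\<And>x y. \<delta> \<le> gibbs_kernel c \<epsilon> x y"
proof -
  have "compact (UNIV \<times> UNIV :: ('a \<times> 'a) set)" by (rule compact_Times[OF assms(1) assms(1)])
  then have "compact ((\<lambda>(x, y). c x y) ` UNIV)"
    using assms(2) by (intro compact_continuous_image) auto
  then obtain C where C: "\<And>x y. \<bar>c x y\<bar> \<le> C"
    using compact_imp_bounded by (fastforce simp: bounded_iff)
  show ?thesis
  proof (rule that[of "exp (- C / \<epsilon>)"])
    fix x y
    have "- C / \<epsilon> \<le> - c x y / \<epsilon>" using C[of x y] assms(3) by (intro divide_right_mono) auto
    then show "exp (- C / \<epsilon>) \<le> gibbs_kernel c \<epsilon> x y" by (simp add: gibbs_kernel_def)
  qed simp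
qed

theorem proposition5p8:
  fixes c :: "'a::metric_space \<Rightarrow> 'a \<Rightarrow> real"
    and \<epsilon> :: real
    and ev :: "'h::{real_inner,banach,second_countable_topology} \<Rightarrow> 'a \<Rightarrow> real"
    and \<mu> :: "real \<Rightarrow> 'a measure"
  assumes "compact (UNIV :: 'a set)"
    and "\<epsilon> > 0"
    and "continuous_on UNIV (\<lambda>(x, y). c x y)"
    and "\<forall>x y. c x y \<ge> 0"
    and "\<forall>x y. c x y = c y x"
    and "positive_definite_kernel (gibbs_kernel c \<epsilon>)"
    and "is_rkhs (gibbs_kernel c \<epsilon>) ev"
    and "universal_rkhs ev"
    and "\<forall>t\<in>{0..1}. \<mu> t \<in> prob_measures"
    and "weak_star_continuous_path \<mu>"
  shows
    "(admissible_path c \<epsilon> ev \<mu> \<longleftrightarrow> sobolev_H1 (\<lambda>t. B_embedding c \<epsilon> ev (\<mu> t)) {0<..<1}) \<and>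
     (admissible_path c \<epsilon> ev \<mu> \<longleftrightarrow> AC_curve 2 (sinkhorn_dist c \<epsilon> ev) 0 1 \<mu>) \<and>
     (admissible_path c \<epsilon> ev \<mu> \<longleftrightarrow>
        strongly_differentiable_path c \<epsilon> ev \<mu> \<and>
        (\<integral>\<^sup>+t. ennreal (metric_g c \<epsilon> ev (\<mu> t) (strong_derivative c \<epsilon> ev \<mu> t)) \<partial>lebesgue_on {0..1})
          < \<infinity> \<and>
        AC_curve 1 dist 0 1 (\<lambda>t. self_potential c \<epsilon> (\<mu> t))) \<and>
     (strongly_differentiable_path c \<epsilon> ev \<mu> \<and>
        (\<integral>\<^sup>+t. ennreal (metric_g c \<epsilon> ev (\<mu> t) (strong_derivative c \<epsilon> ev \<mu> t)) \<partial>lebesgue_on {0..1})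
          < \<infinity> \<and>
        AC_curve 1 dist 0 1 (\<lambda>t. self_potential c \<epsilon> (\<mu> t)) \<longrightarrow>
      (\<forall>\<phi>\<in>test_functions {0<..<1}. let \<psi> = scaled_test_path c \<epsilon> ev \<mu> \<phi> in
        (AE t in lebesgue_on {0..1}. \<psi> differentiable at t) \<and>
        integrable (lebesgue_on {0..1})
          (\<lambda>t. \<integral>x. apply_bcontfun (vector_derivative \<psi> (at t)) x \<partial>\<mu> t) \<and>
        integrable (lebesgue_on {0..1})
          (\<lambda>t. pairing (self_ev c \<epsilon> ev (\<mu> t)) (strong_derivative c \<epsilon> ev \<mu> t)
                 (apply_bcontfun (\<psi> t))) \<and>
        (\<integral>t. (\<integral>x. apply_bcontfun (vector_derivative \<psi> (at t)) x \<partial>\<mu> t) \<partial>lebesgue_on {0..1}) =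
        - (\<integral>t. pairing (self_ev c \<epsilon> ev (\<mu> t)) (strong_derivative c \<epsilon> ev \<mu> t)
                  (apply_bcontfun (\<psi> t)) \<partial>lebesgue_on {0..1})))"
proof -
  obtain \<delta> where \<delta>: "\<delta> > 0" "\<And>x y. \<delta> \<le> gibbs_kernel c \<epsilon> x y"
    using gibbs_kernel_lower_bound[OF assms(1,3,2)] by metis
  interpret weak_star_path c \<epsilon> \<delta> ev \<mu>
    by unfold_locales (use assms \<delta> in simp_all)
  let ?H = "sobolev_H1 (\<lambda>t. B_embedding c \<epsilon> ev (\<mu> t)) {0<..<1}"
  let ?C = "strongly_differentiable_path c \<epsilon> ev \<mu> \<and>
        (\<integral>\<^sup>+t. ennreal (metric_g c \<epsilon> ev (\<mu> t) (strong_derivative c \<epsilon> ev \<mu> t)) \<partial>lebesgue_on {0..1}) < \<infinity> \<and>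
        AC_curve 1 dist 0 1 (\<lambda>t. self_potential c \<epsilon> (\<mu> t))"
  have adm: "admissible_path c \<epsilon> ev \<mu> \<longleftrightarrow> ?H"
    unfolding admissible_path_def using assms(9) B_continuous_on by blast
  have AC: "?H \<longleftrightarrow> AC_curve 2 (sinkhorn_dist c \<epsilon> ev) 0 1 \<mu>"
    unfolding sobolev_H1_iff_regular by (rule regular_iff_AC)
  have cond: "?H \<longleftrightarrow> ?C"
    unfolding sobolev_H1_iff_regular using regular_imp_conditions conditions_imp_regular by blast
  have parts: "?C \<longrightarrow> (\<forall>\<phi>\<in>test_functions {0<..<1}. let \<psi> = scaled_test_path c \<epsilon> ev \<mu> \<phi> in
        (AE t in lebesgue_on {0..1}. \<psi> differentiable at t) \<and>
        integrable (lebesgue_on {0..1})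
          (\<lambda>t. \<integral>x. apply_bcontfun (vector_derivative \<psi> (at t)) x \<partial>\<mu> t) \<and>
        integrable (lebesgue_on {0..1})
          (\<lambda>t. pairing (self_ev c \<epsilon> ev (\<mu> t)) (strong_derivative c \<epsilon> ev \<mu> t)
                 (apply_bcontfun (\<psi> t))) \<and>
        (\<integral>t. (\<integral>x. apply_bcontfun (vector_derivative \<psi> (at t)) x \<partial>\<mu> t) \<partial>lebesgue_on {0..1}) =
        - (\<integral>t. pairing (self_ev c \<epsilon> ev (\<mu> t)) (strong_derivative c \<epsilon> ev \<mu> t)
                  (apply_bcontfun (\<psi> t)) \<partial>lebesgue_on {0..1}))"
  proof (intro impI ballI)
    fix \<phi> :: "real \<Rightarrow> 'h" assume C: ?C and \<phi>: "\<phi> \<in> test_functions {0<..<1}"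
    obtain v where v: "regular v" using cond C unfolding sobolev_H1_iff_regular by blast
    show "let \<psi> = scaled_test_path c \<epsilon> ev \<mu> \<phi> in
        (AE t in lebesgue_on {0..1}. \<psi> differentiable at t) \<and>
        integrable (lebesgue_on {0..1})
          (\<lambda>t. \<integral>x. apply_bcontfun (vector_derivative \<psi> (at t)) x \<partial>\<mu> t) \<and>
        integrable (lebesgue_on {0..1})
          (\<lambda>t. pairing (self_ev c \<epsilon> ev (\<mu> t)) (strong_derivative c \<epsilon> ev \<mu> t)
                 (apply_bcontfun (\<psi> t))) \<and>
        (\<integral>t. (\<integral>x. apply_bcontfun (vector_derivative \<psi> (at t)) x \<partial>\<mu> t) \<partial>lebesgue_on {0..1}) =
        - (\<integral>t. pairing (self_ev c \<epsilon> ev (\<mu> t)) (strong_derivative c \<epsilon> ev \<mu> t)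
                  (apply_bcontfun (\<psi> t)) \<partial>lebesgue_on {0..1})"
      unfolding Let_def by (intro conjI integration_by_parts[OF v \<phi>])
  qed
  show ?thesis using adm AC cond parts by (intro conjI) (simp_all only:)
qed

end
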